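(* Let $\mathcal H$ be an SSH category, $\mathcal C=\mathcal H([1])$. For every object $F\in\mathcal C$ there is a canonical isomorphism, coming from the SSH structure on $\mathcal C$, of functors $\mathcal C^{\otimes[2]}\to\mathcal C$: $$\Delta^r_F\circ m\ \cong\ m\circ(\Delta^r)^2_{\Delta^l(F)} .$$
   Context: **Conventions.** $\Bbbk$ is a field of characteristic $0$; $\mathbf{Vect}$ is the category of finite-dimensional $\Bbbk$-vector spaces; $[n]=\{1,\dots,n\}$. $\mathbf{FinSet}_*$ is the category of pointed finite sets; $[n]_*=\{1,\dots,n,*\}$. A map in $\mathbf{FinSet}_*$ is active if the preimage of the basepoint is the basepoint. **$\mathbf{2Vect}_{gr}$.** A 2-vector space is a semisimple $\Bbbk$-linear category equivalent to a finite sum of copies of $\mathbf{Vect}$. The bicategory $\mathbf{2Vect}_{gr}$ has as objects the sequences $(\mathcal C_n)_{n\ge 0}$ of 2-vector spaces (thought of as graded categories), as 1-morphisms finite sums of exact functors of bounded degree, as 2-morphisms natural transformations. Every 1-morphism has left and right adjoints. $\otimes$ denotes the (graded) Deligne tensor product. **$\mathbf{FinSet}^{\sqcup}\to\mathbf{FinSet}_*$.** Objects over $I$: collections $(S_i)_{i\in I}$ of finite sets with $S_{*}$ a point (omitted from notation). Morphisms over $\varphi:I\to J$: collections of maps $S_i\to T_{\varphi(i)}$, $i\in I$. **$\mathbf{2Vect}_{gr}^{\otimes}\to\mathbf{FinSet}_*$.** Objects over $I$: collections $(\mathcal C_i)_{i\in I}$ of objects of $\mathbf{2Vect}_{gr}$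 with $\mathcal C_*=0$. A 1-morphism $(\mathcal C_i)\to(\mathcal D_j)$ over $\varphi:I\to J$ is a collection of multi-exact bounded functors $f_j:\prod_{\varphi(i)=j}\mathcal C_i\to\mathcal D_j$ (finite sums of multi-exact functors of non-negative bounded degree; the empty product is $\mathbf{Vect}$, so for empty fibre $f_j$ is an object of $\mathcal D_j$). 2-morphisms are collections of natural transformations. **coCartesian arrows.** For $p:\mathcal E\to B$ a functor from a bicategory to a 1-category, $F:X\to Y$ over $f$ is coCartesian if for all $Z$ and $g:p(Y)\to p(Z)$, precomposition with $F$ is an equivalence from the category of arrows $Y\to Z$ over $g$ to the category of arrows $X\to Z$ over $g f$. In $\mathbf{FinSet}^\sqcup$, coCartesian arrows over $I\to[1]_*$ active are presentations of a set as a disjoint union; in $\mathbf{2Vect}_{gr}^\otimes$ they are presentations of a category as a Deligne tensor product. **Beck–Chevalley (BC) condition.** For a square with top $g:A\to B$, left $f:A\to C$, right $h:B\to D$, bottom $i:C\to D$ and 2-morphism $\alpha:hg\Rightarrow if$: if $f,h$ have right adjoints $f_R,h_R$, the right mate is $\alpha_R:gf_R\to h_Rhgf_R\to h_Riff_R\to h_Ri$; if $g,i$ have left adjoints $g_L,i_L$, the left mate is $\alpha_L:i_Lh\to i_Lhgg_L\to i_Lifg_L\to fg_L$. The square satisfies the right (left) BC condition if $\alpha_R$ (resp. $\alpha_L$) is invertible; when both mates exist the conditions are equivalent. **SSH category.** A symmetric self-adjoint Hopf (SSH) category is a pseudofunctor $\mathcal H:\mathbf{FinSet}^\sqcup\to\mathbf{2Vect}_{gr}^\otimes$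 over $\mathbf{FinSet}_*$ which (1) takes maps to degree-zero maps, (2) takes coCartesian arrows to coCartesian arrows, (3) takes Cartesian squares in the fibre over $[1]_*$ (i.e. in $\mathbf{FinSet}$) to squares satisfying the BC condition. One says $\mathcal H$ is an SSH structure on $\mathcal C=\mathcal H([1])$. Write $\mathcal C^{\otimes U}=\mathcal H(U)$ for a finite set $U$. **Functors in the statement.** $m:\mathcal C^{\otimes[2]}\to\mathcal C$ is $\mathcal H([2]\to[1])$; $\Delta^l,\Delta^r$ are its left and right adjoints. $\boxtimes:\mathcal C\times\mathcal C\to\mathcal C^{\otimes[2]}$ is the image of the coCartesian arrow $(\{1\},\{2\})\to\{1,2\}$ given by the inclusions. For $F\in\mathcal C$, $i_F:\mathcal C\to\mathcal C^{\otimes[2]}$, $i_F(X)=F\boxtimes X$, with right adjoint $j^r_F$; $m_F=m\circ i_F$ and $\Delta^r_F=j^r_F\circ\Delta^r$, which is right adjoint to $m_F$. Let $\bar c:([2],[2])\to([4])$ be the arrow of $\mathbf{FinSet}^\sqcup$ given by the maps $(1\mapsto1,\,2\mapsto3)$ and $(1\mapsto2,\,2\mapsto4)$. For $\Phi\in\mathcal C^{\otimes[2]}$ let $i_\Phi:\mathcal C^{\otimes[2]}\to\mathcal C^{\otimes[4]}$, $i_\Phi(X)=\mathcal H(\bar c)(\Phi,X)$, with right adjoint $j^r_\Phi$. Let $m^2:\mathcal C^{\otimes[4]}\to\mathcal C^{\otimes[2]}$ be the image under $\mathcal H$ of the map $[4]\to[2]$, $1,2\mapsto1$, $3,4\mapsto2$,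 with right adjoint $(\Delta^r)^2$. Put $m^2_\Phi=m^2\circ i_\Phi$ and $(\Delta^r)^2_\Phi=j^r_\Phi\circ(\Delta^r)^2:\mathcal C^{\otimes[2]}\to\mathcal C^{\otimes[2]}$, which is right adjoint to $m^2_\Phi$. *)

theory Defs
  imports Complex_Main "HOL-Library.FuncSet" "HOL-Library.Function_Algebras"
begin

section \<open>Linear categories\<close>

record ('k, 'o, 'a) lcat =
  Ob :: "'o set"
  Ar :: "'a set"
  Dom :: "'a \<Rightarrow> 'o"
  Cod :: "'a \<Rightarrow> 'o"
  Id :: "'o \<Rightarrow> 'a"
  Cmp :: "'a \<Rightarrow> 'a \<Rightarrow> 'a"
  Zero :: "'o \<Rightarrow> 'o \<Rightarrow> 'a"
  Add :: "'a \<Rightarrow> 'a \<Rightarrow> 'a"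
  Scl :: "'k \<Rightarrow> 'a \<Rightarrow> 'a"

text \<open>\<open>Cmp C g f\<close> is the composite ``first \<open>f\<close>, then \<open>g\<close>''; \<open>Zero C X Y\<close> is the zero arrow
  from \<open>X\<close> to \<open>Y\<close>.\<close>

definition hom :: "('k, 'o, 'a) lcat \<Rightarrow> 'o \<Rightarrow> 'o \<Rightarrow> 'a set" where
  "hom C X Y = {f \<in> Ar C. Dom C f = X \<and> Cod C f = Y}"

locale linear_category =
  fixes C :: "('k::field, 'o, 'a) lcat"
  assumes Dom_in: "f \<in> Ar C \<Longrightarrow> Dom C f \<in> Ob C"
    and Cod_in: "f \<in> Ar C \<Longrightarrow> Cod C f \<in> Ob C"
    and Id_in: "X \<in> Ob C \<Longrightarrow> Id C X \<in> hom C X X"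
    and Cmp_in: "\<lbrakk>f \<in> hom C X Y; g \<in> hom C Y Z\<rbrakk> \<Longrightarrow> Cmp C g f \<in> hom C X Z"
    and Cmp_Id: "f \<in> hom C X Y \<Longrightarrow> Cmp C f (Id C X) = f"
    and Id_Cmp: "f \<in> hom C X Y \<Longrightarrow> Cmp C (Id C Y) f = f"
    and Cmp_assoc: "\<lbrakk>f \<in> hom C X Y; g \<in> hom C Y Z; h \<in> hom C Z W\<rbrakk>
      \<Longrightarrow> Cmp C (Cmp C h g) f = Cmp C h (Cmp C g f)"
    and Zero_in: "\<lbrakk>X \<in> Ob C; Y \<in> Ob C\<rbrakk> \<Longrightarrow> Zero C X Y \<in> hom C X Y"
    and Add_in: "\<lbrakk>f \<in> hom C X Y; g \<in> hom C X Y\<rbrakk> \<Longrightarrow> Add C f g \<in> hom C X Y"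
    and Scl_in: "f \<in> hom C X Y \<Longrightarrow> Scl C c f \<in> hom C X Y"
    and Add_assoc: "\<lbrakk>f \<in> hom C X Y; g \<in> hom C X Y; h \<in> hom C X Y\<rbrakk>
      \<Longrightarrow> Add C (Add C f g) h = Add C f (Add C g h)"
    and Add_comm: "\<lbrakk>f \<in> hom C X Y; g \<in> hom C X Y\<rbrakk> \<Longrightarrow> Add C f g = Add C g f"
    and Add_Zero: "f \<in> hom C X Y \<Longrightarrow> Add C f (Zero C X Y) = f"
    and Add_inverse: "f \<in> hom C X Y \<Longrightarrow> \<exists>g \<in> hom C X Y. Add C f g = Zero C X Y"
    and Scl_Add: "\<lbrakk>f \<in> hom C X Y; g \<in> hom C X Y\<rbrakk>
      \<Longrightarrow> Scl C c (Add C f g) = Add C (Scl C c f) (Scl C c g)"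
    and Scl_plus: "f \<in> hom C X Y \<Longrightarrow> Scl C (c + d) f = Add C (Scl C c f) (Scl C d f)"
    and Scl_times: "f \<in> hom C X Y \<Longrightarrow> Scl C (c * d) f = Scl C c (Scl C d f)"
    and Scl_one: "f \<in> hom C X Y \<Longrightarrow> Scl C 1 f = f"
    and Cmp_Add_left: "\<lbrakk>f \<in> hom C X Y; g \<in> hom C Y Z; h \<in> hom C Y Z\<rbrakk>
      \<Longrightarrow> Cmp C (Add C g h) f = Add C (Cmp C g f) (Cmp C h f)"
    and Cmp_Add_right: "\<lbrakk>f \<in> hom C X Y; g \<in> hom C X Y; h \<in> hom C Y Z\<rbrakk>
      \<Longrightarrow> Cmp C h (Add C f g) = Add C (Cmp C h f) (Cmp C h g)"
    and Cmp_Scl_left: "\<lbrakk>f \<in> hom C X Y; g \<in> hom C Y Z\<rbrakk>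
      \<Longrightarrow> Cmp C (Scl C c g) f = Scl C c (Cmp C g f)"
    and Cmp_Scl_right: "\<lbrakk>f \<in> hom C X Y; g \<in> hom C Y Z\<rbrakk>
      \<Longrightarrow> Cmp C g (Scl C c f) = Scl C c (Cmp C g f)"

definition is_inverse :: "('k, 'o, 'a) lcat \<Rightarrow> 'a \<Rightarrow> 'a \<Rightarrow> bool" where
  "is_inverse C f g \<longleftrightarrow> f \<in> Ar C \<and> g \<in> hom C (Cod C f) (Dom C f) \<and>
     Cmp C g f = Id C (Dom C f) \<and> Cmp C f g = Id C (Cod C f)"

definition is_iso :: "('k, 'o, 'a) lcat \<Rightarrow> 'a \<Rightarrow> bool" where
  "is_iso C f \<longleftrightarrow> (\<exists>g. is_inverse C f g)"

definition inv_ar :: "('k, 'o, 'a) lcat \<Rightarrow> 'a \<Rightarrow> 'a" where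
  "inv_ar C f = (THE g. is_inverse C f g)"

definition zero_object :: "('k, 'o, 'a) lcat \<Rightarrow> 'o \<Rightarrow> bool" where
  "zero_object C Z \<longleftrightarrow> Z \<in> Ob C \<and>
     (\<forall>X \<in> Ob C. (\<exists>!f. f \<in> hom C X Z) \<and> (\<exists>!f. f \<in> hom C Z X))"

definition is_kernel :: "('k, 'o, 'a) lcat \<Rightarrow> 'a \<Rightarrow> 'a \<Rightarrow> bool" where
  "is_kernel C g f \<longleftrightarrow> f \<in> Ar C \<and> g \<in> Ar C \<and> Cod C f = Dom C g \<and>
     Cmp C g f = Zero C (Dom C f) (Cod C g) \<and>
     (\<forall>h \<in> Ar C. Cod C h = Dom C g \<and> Cmp C g h = Zero C (Dom C h) (Cod C g) \<longrightarrow>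
        (\<exists>!u. u \<in> hom C (Dom C h) (Dom C f) \<and> Cmp C f u = h))"

definition is_cokernel :: "('k, 'o, 'a) lcat \<Rightarrow> 'a \<Rightarrow> 'a \<Rightarrow> bool" where
  "is_cokernel C f g \<longleftrightarrow> f \<in> Ar C \<and> g \<in> Ar C \<and> Cod C f = Dom C g \<and>
     Cmp C g f = Zero C (Dom C f) (Cod C g) \<and>
     (\<forall>h \<in> Ar C. Dom C h = Cod C f \<and> Cmp C h f = Zero C (Dom C f) (Cod C h) \<longrightarrow>
        (\<exists>!u. u \<in> hom C (Cod C g) (Cod C h) \<and> Cmp C u g = h))"

definition short_exact :: "('k, 'o, 'a) lcat \<Rightarrow> 'a \<Rightarrow> 'a \<Rightarrow> bool" where
  "short_exact C f g \<longleftrightarrow> is_kernel C g f \<and> is_cokernel C f g"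

section \<open>Functors, natural transformations, adjunctions\<close>

record ('o1, 'a1, 'o2, 'a2) fctr =
  FO :: "'o1 \<Rightarrow> 'o2"
  FA :: "'a1 \<Rightarrow> 'a2"

definition fcomp :: "('o2, 'a2, 'o3, 'a3) fctr \<Rightarrow> ('o1, 'a1, 'o2, 'a2) fctr
    \<Rightarrow> ('o1, 'a1, 'o3, 'a3) fctr"  (infixl "\<odot>" 65) where
  "G \<odot> F = \<lparr>FO = (\<lambda>X. FO G (FO F X)), FA = (\<lambda>f. FA G (FA F f))\<rparr>"

definition is_functor ::
  "('k1, 'o1, 'a1) lcat \<Rightarrow> ('k2, 'o2, 'a2) lcat \<Rightarrow> ('o1, 'a1, 'o2, 'a2) fctr \<Rightarrow> bool" where
  "is_functor C D F \<longleftrightarrow>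
     (\<forall>X \<in> Ob C. FO F X \<in> Ob D \<and> FA F (Id C X) = Id D (FO F X)) \<and>
     (\<forall>f \<in> Ar C. FA F f \<in> hom D (FO F (Dom C f)) (FO F (Cod C f))) \<and>
     (\<forall>f \<in> Ar C. \<forall>g \<in> Ar C. Cod C f = Dom C g \<longrightarrow> FA F (Cmp C g f) = Cmp D (FA F g) (FA F f))"

definition linear_functor ::
  "('k, 'o1, 'a1) lcat \<Rightarrow> ('k, 'o2, 'a2) lcat \<Rightarrow> ('o1, 'a1, 'o2, 'a2) fctr \<Rightarrow> bool" where
  "linear_functor C D F \<longleftrightarrow> is_functor C D F \<and>
     (\<forall>f \<in> Ar C. \<forall>g \<in> hom C (Dom C f) (Cod C f). FA F (Add C f g) = Add D (FA F f) (FA F g)) \<and>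
     (\<forall>f \<in> Ar C. \<forall>c. FA F (Scl C c f) = Scl D c (FA F f))"

definition exact_functor ::
  "('k, 'o1, 'a1) lcat \<Rightarrow> ('k, 'o2, 'a2) lcat \<Rightarrow> ('o1, 'a1, 'o2, 'a2) fctr \<Rightarrow> bool" where
  "exact_functor C D F \<longleftrightarrow> linear_functor C D F \<and>
     (\<forall>f g. short_exact C f g \<longrightarrow> short_exact D (FA F f) (FA F g))"

definition linear_equivalence ::
  "('k, 'o1, 'a1) lcat \<Rightarrow> ('k, 'o2, 'a2) lcat \<Rightarrow> ('o1, 'a1, 'o2, 'a2) fctr \<Rightarrow> bool" where
  "linear_equivalence C D F \<longleftrightarrow> linear_functor C D F \<and>
     (\<forall>X \<in> Ob C. \<forall>Y \<in> Ob C. bij_betw (FA F) (hom C X Y) (hom D (FO F X) (FO F Y))) \<and>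
     (\<forall>Z \<in> Ob D. \<exists>X \<in> Ob C. \<exists>f \<in> hom D (FO F X) Z. is_iso D f)"

definition nat_trans :: "('k1, 'o1, 'a1) lcat \<Rightarrow> ('k2, 'o2, 'a2) lcat
    \<Rightarrow> ('o1, 'a1, 'o2, 'a2) fctr \<Rightarrow> ('o1, 'a1, 'o2, 'a2) fctr \<Rightarrow> ('o1 \<Rightarrow> 'a2) \<Rightarrow> bool" where
  "nat_trans C D F G t \<longleftrightarrow>
     (\<forall>X \<in> Ob C. t X \<in> hom D (FO F X) (FO G X)) \<and>
     (\<forall>f \<in> Ar C. Cmp D (t (Cod C f)) (FA F f) = Cmp D (FA G f) (t (Dom C f)))"

definition nat_iso :: "('k1, 'o1, 'a1) lcat \<Rightarrow> ('k2, 'o2, 'a2) lcat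
    \<Rightarrow> ('o1, 'a1, 'o2, 'a2) fctr \<Rightarrow> ('o1, 'a1, 'o2, 'a2) fctr \<Rightarrow> ('o1 \<Rightarrow> 'a2) \<Rightarrow> bool" where
  "nat_iso C D F G t \<longleftrightarrow> nat_trans C D F G t \<and> (\<forall>X \<in> Ob C. is_iso D (t X))"

definition id_fctr :: "('o, 'a, 'o, 'a) fctr" where
  "id_fctr = \<lparr>FO = (\<lambda>X. X), FA = (\<lambda>f. f)\<rparr>"

record ('o1, 'a1, 'o2, 'a2) adjn =
  LF :: "('o1, 'a1, 'o2, 'a2) fctr"
  RF :: "('o2, 'a2, 'o1, 'a1) fctr"
  Unit :: "'o1 \<Rightarrow> 'a1"
  Counit :: "'o2 \<Rightarrow> 'a2"

definition adjunction :: "('k, 'o1, 'a1) lcat \<Rightarrow> ('k, 'o2, 'a2) lcat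
    \<Rightarrow> ('o1, 'a1, 'o2, 'a2) adjn \<Rightarrow> bool" where
  "adjunction C D A \<longleftrightarrow>
     is_functor C D (LF A) \<and> is_functor D C (RF A) \<and>
     nat_trans C C id_fctr (RF A \<odot> LF A) (Unit A) \<and>
     nat_trans D D (LF A \<odot> RF A) id_fctr (Counit A) \<and>
     (\<forall>X \<in> Ob C. Cmp D (Counit A (FO (LF A) X)) (FA (LF A) (Unit A X)) = Id D (FO (LF A) X)) \<and>
     (\<forall>Y \<in> Ob D. Cmp C (FA (RF A) (Counit A Y)) (Unit A (FO (RF A) Y)) = Id C (FO (RF A) Y))"

text \<open>\<open>D\<close> is the source of \<open>LF A\<close> and \<open>E\<close> the target of \<open>LF B\<close>.\<close>

definition adj_comp :: "('k, 'o1, 'a1) lcat \<Rightarrow> ('k, 'o3, 'a3) lcat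
    \<Rightarrow> ('o2, 'a2, 'o3, 'a3) adjn \<Rightarrow> ('o1, 'a1, 'o2, 'a2) adjn \<Rightarrow> ('o1, 'a1, 'o3, 'a3) adjn" where
  "adj_comp D E B A =
     \<lparr>LF = LF B \<odot> LF A, RF = RF A \<odot> RF B,
      Unit = (\<lambda>X. Cmp D (FA (RF A) (Unit B (FO (LF A) X))) (Unit A X)),
      Counit = (\<lambda>Y. Cmp E (Counit B Y) (FA (LF B) (Counit A (FO (RF B) Y))))\<rparr>"

section \<open>Vector spaces and 2-vector spaces\<close>

definition prodc :: "'i set \<Rightarrow> ('i \<Rightarrow> ('k, 'o, 'a) lcat) \<Rightarrow> ('k, 'i \<Rightarrow> 'o, 'i \<Rightarrow> 'a) lcat" where
  "prodc I C =
     \<lparr>Ob = (\<Pi>\<^sub>E i\<in>I. Ob (C i)), Ar = (\<Pi>\<^sub>E i\<in>I. Ar (C i)),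
      Dom = (\<lambda>f. \<lambda>i\<in>I. Dom (C i) (f i)), Cod = (\<lambda>f. \<lambda>i\<in>I. Cod (C i) (f i)),
      Id = (\<lambda>X. \<lambda>i\<in>I. Id (C i) (X i)), Cmp = (\<lambda>g f. \<lambda>i\<in>I. Cmp (C i) (g i) (f i)),
      Zero = (\<lambda>X Y. \<lambda>i\<in>I. Zero (C i) (X i) (Y i)),
      Add = (\<lambda>f g. \<lambda>i\<in>I. Add (C i) (f i) (g i)),
      Scl = (\<lambda>c f. \<lambda>i\<in>I. Scl (C i) c (f i))\<rparr>"

definition fscale :: "'k::field \<Rightarrow> (nat \<Rightarrow> 'k) \<Rightarrow> (nat \<Rightarrow> 'k)" where
  "fscale c v = (\<lambda>n. c * v n)"

text \<open>Finite-dimensional vector spaces, realized as the finite-dimensional subspaces of the space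
  of all sequences; every finite-dimensional vector space is isomorphic to such a subspace.\<close>

definition Vect ::
  "('k::field, (nat \<Rightarrow> 'k) set,
    (nat \<Rightarrow> 'k) set \<times> ((nat \<Rightarrow> 'k) \<Rightarrow> (nat \<Rightarrow> 'k)) \<times> (nat \<Rightarrow> 'k) set) lcat" where
  "Vect =
     (let obs = {V. \<exists>B. finite B \<and> V = module.span fscale B} in
     \<lparr>Ob = obs,
      Ar = {(V, f, W) | V f W. V \<in> obs \<and> W \<in> obs \<and> f \<in> V \<rightarrow>\<^sub>E W \<and>
              (\<forall>x \<in> V. \<forall>y \<in> V. f (x + y) = f x + f y) \<and>
              (\<forall>c. \<forall>x \<in> V. f (fscale c x) = fscale c (f x))},
      Dom = (\<lambda>(V, f, W). V), Cod = (\<lambda>(V, f, W). W),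
      Id = (\<lambda>V. (V, \<lambda>x\<in>V. x, V)),
      Cmp = (\<lambda>(V', g, W') (V, f, W). (V, compose V g f, W')),
      Zero = (\<lambda>V W. (V, \<lambda>x\<in>V. 0, W)),
      Add = (\<lambda>(V, f, W) (V', g, W'). (V, \<lambda>x\<in>V. f x + g x, W)),
      Scl = (\<lambda>c (V, f, W). (V, \<lambda>x\<in>V. fscale c (f x), W))\<rparr>)"

text \<open>Being equivalent to a finite sum of copies of \<open>Vect\<close>, such a category is automatically
  semisimple.\<close>

definition two_vect :: "('k::field, 'o, 'a) lcat \<Rightarrow> bool" where
  "two_vect C \<longleftrightarrow> linear_category C \<and>
     (\<exists>(r::nat) F. linear_equivalence C (prodc {..<r} (\<lambda>_. Vect)) F)"

section \<open>Graded 2-vector spaces\<close>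

type_synonym ('k, 'o, 'a) grcat = "nat \<Rightarrow> ('k, 'o, 'a) lcat"

definition supp :: "('k, 'o, 'a) grcat \<Rightarrow> (nat \<Rightarrow> 'o) \<Rightarrow> nat set" where
  "supp C X = {n. \<not> zero_object (C n) (X n)}"

text \<open>The category underlying a sequence of 2-vector spaces, i.e. their direct sum: its objects and
  arrows are the sequences of objects and arrows with finitely many nonzero objects.\<close>

definition tot :: "('k, 'o, 'a) grcat \<Rightarrow> ('k, nat \<Rightarrow> 'o, nat \<Rightarrow> 'a) lcat" where
  "tot C =
     (let obs = {X. (\<forall>n. X n \<in> Ob (C n)) \<and> finite (supp C X)} in
     \<lparr>Ob = obs,
      Ar = {f. (\<forall>n. f n \<in> Ar (C n)) \<and>
               (\<lambda>n. Dom (C n) (f n)) \<in> obs \<and> (\<lambda>n. Cod (C n) (f n)) \<in> obs},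
      Dom = (\<lambda>f n. Dom (C n) (f n)), Cod = (\<lambda>f n. Cod (C n) (f n)),
      Id = (\<lambda>X n. Id (C n) (X n)), Cmp = (\<lambda>g f n. Cmp (C n) (g n) (f n)),
      Zero = (\<lambda>X Y n. Zero (C n) (X n) (Y n)),
      Add = (\<lambda>f g n. Add (C n) (f n) (g n)),
      Scl = (\<lambda>c f n. Scl (C n) c (f n))\<rparr>)"

text \<open>A functor between total categories is a finite sum of functors of degrees in \<open>{-N..N}\<close>
  (where degree \<open>d\<close> means \<open>C n \<rightarrow> D (n + d)\<close>) iff it sends objects concentrated
  in degree \<open>d\<close> to objects supported in degrees \<open>{d - N..d + N}\<close>: its summands are its composites
  with the projections onto the homogeneous components.\<close>

type_synonym ('o, 'a) gfun = "(nat \<Rightarrow> 'o, nat \<Rightarrow> 'a, nat \<Rightarrow> 'o, nat \<Rightarrow> 'a) fctr"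

type_synonym ('o, 'a) gadj = "(nat \<Rightarrow> 'o, nat \<Rightarrow> 'a, nat \<Rightarrow> 'o, nat \<Rightarrow> 'a) adjn"

definition gr_mor :: "('k, 'o, 'a) grcat \<Rightarrow> ('k, 'o, 'a) grcat \<Rightarrow> ('o, 'a) gfun \<Rightarrow> bool" where
  "gr_mor C D F \<longleftrightarrow> exact_functor (tot C) (tot D) F \<and>
     (\<exists>N::nat. \<forall>X \<in> Ob (tot C). \<forall>d. supp C X \<subseteq> {d} \<longrightarrow>
        (\<forall>n \<in> supp D (FO F X). \<bar>int n - int d\<bar> \<le> int N))"

definition gr_adj :: "('k, 'o, 'a) grcat \<Rightarrow> ('k, 'o, 'a) grcat \<Rightarrow> ('o, 'a) gadj \<Rightarrow> bool" where
  "gr_adj C D A \<longleftrightarrow> gr_mor C D (LF A) \<and> gr_mor D C (RF A) \<and> adjunction (tot C) (tot D) A"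

definition gr_adj_equiv :: "('k, 'o, 'a) grcat \<Rightarrow> ('k, 'o, 'a) grcat \<Rightarrow> ('o, 'a) gadj \<Rightarrow> bool" where
  "gr_adj_equiv C D A \<longleftrightarrow> gr_adj C D A \<and>
     (\<forall>X \<in> Ob (tot C). is_iso (tot C) (Unit A X)) \<and> (\<forall>Y \<in> Ob (tot D). is_iso (tot D) (Counit A Y))"

section \<open>The bicategory of families of graded 2-vector spaces over pointed finite sets\<close>

text \<open>A pointed finite set is given by its set \<open>I\<close> of elements other than the base point, a finite
  set of natural numbers, and a pointed map by the partial map sending \<open>i\<close> to \<open>None\<close> if \<open>i\<close> is
  mapped to the base point.\<close>

definition ptd_map :: "nat set \<Rightarrow> nat set \<Rightarrow> (nat \<rightharpoonup> nat) \<Rightarrow> bool" where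
  "ptd_map I J \<phi> \<longleftrightarrow> dom \<phi> \<subseteq> I \<and> ran \<phi> \<subseteq> J"

definition fib :: "(nat \<rightharpoonup> nat) \<Rightarrow> nat \<Rightarrow> nat set" where
  "fib \<phi> j = {i. \<phi> i = Some j}"

type_synonym ('o, 'a) mfun =
  "(nat \<Rightarrow> nat \<Rightarrow> 'o, nat \<Rightarrow> nat \<Rightarrow> 'a, nat \<Rightarrow> 'o, nat \<Rightarrow> 'a) fctr"

abbreviation mdom :: "nat set \<Rightarrow> (nat \<Rightarrow> ('k, 'o, 'a) grcat)
    \<Rightarrow> ('k, nat \<Rightarrow> nat \<Rightarrow> 'o, nat \<Rightarrow> nat \<Rightarrow> 'a) lcat" where
  "mdom I C \<equiv> prodc I (\<lambda>i. tot (C i))"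

definition in_variable :: "nat set \<Rightarrow> (nat \<Rightarrow> ('k, 'o, 'a) grcat) \<Rightarrow> ('o, 'a) mfun
    \<Rightarrow> (nat \<Rightarrow> nat \<Rightarrow> 'o) \<Rightarrow> nat \<Rightarrow> ('o, 'a) gfun" where
  "in_variable I C F X i =
     \<lparr>FO = (\<lambda>Y. FO F (X(i := Y))), FA = (\<lambda>f. FA F ((Id (mdom I C) X)(i := f)))\<rparr>"

definition multi_exact :: "nat set \<Rightarrow> (nat \<Rightarrow> ('k, 'o, 'a) grcat) \<Rightarrow> ('k, 'o, 'a) grcat
    \<Rightarrow> ('o, 'a) mfun \<Rightarrow> bool" where
  "multi_exact I C D F \<longleftrightarrow> is_functor (mdom I C) (tot D) F \<and>
     (\<forall>i \<in> I. \<forall>X \<in> Ob (mdom I C). exact_functor (tot (C i)) (tot D) (in_variable I C F X i))"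

definition has_degrees :: "nat set \<Rightarrow> (nat \<Rightarrow> ('k, 'o, 'a) grcat) \<Rightarrow> ('k, 'o, 'a) grcat
    \<Rightarrow> nat set \<Rightarrow> ('o, 'a) mfun \<Rightarrow> bool" where
  "has_degrees I C D E F \<longleftrightarrow>
     (\<forall>X \<in> Ob (mdom I C). \<forall>d. (\<forall>i \<in> I. supp (C i) (X i) \<subseteq> {d i}) \<longrightarrow>
        supp D (FO F X) \<subseteq> {(\<Sum>i\<in>I. d i) + e | e. e \<in> E})"

definition multi_mor :: "nat set \<Rightarrow> (nat \<Rightarrow> ('k, 'o, 'a) grcat) \<Rightarrow> ('k, 'o, 'a) grcat
    \<Rightarrow> ('o, 'a) mfun \<Rightarrow> bool" where
  "multi_mor I C D F \<longleftrightarrow> multi_exact I C D F \<and> (\<exists>N. has_degrees I C D {0..N} F)"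

type_synonym ('k, 'o, 'a) tvob = "nat set \<times> (nat \<Rightarrow> ('k, 'o, 'a) grcat)"

definition tv_ob :: "('k::field, 'o, 'a) tvob \<Rightarrow> bool" where
  "tv_ob X \<longleftrightarrow> finite (fst X) \<and> (\<forall>i \<in> fst X. \<forall>n. two_vect (snd X i n))"

definition tv_mor :: "('k, 'o, 'a) tvob \<Rightarrow> ('k, 'o, 'a) tvob \<Rightarrow> (nat \<rightharpoonup> nat)
    \<Rightarrow> (nat \<Rightarrow> ('o, 'a) mfun) \<Rightarrow> bool" where
  "tv_mor X Y \<phi> f \<longleftrightarrow> ptd_map (fst X) (fst Y) \<phi> \<and>
     (\<forall>j \<in> fst Y. multi_mor (fib \<phi> j) (snd X) (snd Y j) (f j))"

type_synonym ('o, 'a) tvcell = "nat \<Rightarrow> (nat \<Rightarrow> nat \<Rightarrow> 'o) \<Rightarrow> (nat \<Rightarrow> 'a)"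

definition tv_nat :: "('k, 'o, 'a) tvob \<Rightarrow> ('k, 'o, 'a) tvob \<Rightarrow> (nat \<rightharpoonup> nat)
    \<Rightarrow> (nat \<Rightarrow> ('o, 'a) mfun) \<Rightarrow> (nat \<Rightarrow> ('o, 'a) mfun) \<Rightarrow> ('o, 'a) tvcell \<Rightarrow> bool" where
  "tv_nat X Y \<phi> f g t \<longleftrightarrow>
     (\<forall>j \<in> fst Y. nat_trans (mdom (fib \<phi> j) (snd X)) (tot (snd Y j)) (f j) (g j) (t j))"

definition tv_iso :: "('k, 'o, 'a) tvob \<Rightarrow> ('k, 'o, 'a) tvob \<Rightarrow> (nat \<rightharpoonup> nat)
    \<Rightarrow> (nat \<Rightarrow> ('o, 'a) mfun) \<Rightarrow> (nat \<Rightarrow> ('o, 'a) mfun) \<Rightarrow> ('o, 'a) tvcell \<Rightarrow> bool" where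
  "tv_iso X Y \<phi> f g t \<longleftrightarrow>
     (\<forall>j \<in> fst Y. nat_iso (mdom (fib \<phi> j) (snd X)) (tot (snd Y j)) (f j) (g j) (t j))"

text \<open>Cells are functions on the whole type of objects; only their values on actual objects matter,
  so this is equality of 2-morphisms.\<close>

definition tv_eq :: "('k, 'o, 'a) tvob \<Rightarrow> ('k, 'o, 'a) tvob \<Rightarrow> (nat \<rightharpoonup> nat)
    \<Rightarrow> ('o, 'a) tvcell \<Rightarrow> ('o, 'a) tvcell \<Rightarrow> bool" where
  "tv_eq X Y \<phi> s t \<longleftrightarrow> (\<forall>j \<in> fst Y. \<forall>A \<in> Ob (mdom (fib \<phi> j) (snd X)). s j A = t j A)"

definition tv_id :: "nat \<Rightarrow> ('o, 'a) mfun" where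
  "tv_id j = \<lparr>FO = (\<lambda>X. X j), FA = (\<lambda>f. f j)\<rparr>"

text \<open>\<open>f\<close> is over \<open>\<phi>\<close> and \<open>g\<close> over \<open>\<psi>\<close>; the \<open>k\<close>-th component of \<open>g \<circ> f\<close> is
  \<open>g k\<close> applied to the family of all \<open>f j\<close> with \<open>\<psi> j = Some k\<close>.\<close>

definition spread_ob :: "(nat \<rightharpoonup> nat) \<Rightarrow> (nat \<rightharpoonup> nat) \<Rightarrow> (nat \<Rightarrow> ('o, 'a) mfun) \<Rightarrow> nat
    \<Rightarrow> (nat \<Rightarrow> nat \<Rightarrow> 'o) \<Rightarrow> (nat \<Rightarrow> nat \<Rightarrow> 'o)" where
  "spread_ob \<phi> \<psi> f k X = (\<lambda>j \<in> fib \<psi> k. FO (f j) (restrict X (fib \<phi> j)))"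

definition spread_ar :: "(nat \<rightharpoonup> nat) \<Rightarrow> (nat \<rightharpoonup> nat) \<Rightarrow> (nat \<Rightarrow> ('o, 'a) mfun) \<Rightarrow> nat
    \<Rightarrow> (nat \<Rightarrow> nat \<Rightarrow> 'a) \<Rightarrow> (nat \<Rightarrow> nat \<Rightarrow> 'a)" where
  "spread_ar \<phi> \<psi> f k h = (\<lambda>j \<in> fib \<psi> k. FA (f j) (restrict h (fib \<phi> j)))"

definition tv_comp :: "(nat \<rightharpoonup> nat) \<Rightarrow> (nat \<rightharpoonup> nat)
    \<Rightarrow> (nat \<Rightarrow> ('o, 'a) mfun) \<Rightarrow> (nat \<Rightarrow> ('o, 'a) mfun) \<Rightarrow> nat \<Rightarrow> ('o, 'a) mfun" where
  "tv_comp \<phi> \<psi> g f k =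
     \<lparr>FO = (\<lambda>X. FO (g k) (spread_ob \<phi> \<psi> f k X)), FA = (\<lambda>h. FA (g k) (spread_ar \<phi> \<psi> f k h))\<rparr>"

definition whisker_left :: "(nat \<rightharpoonup> nat) \<Rightarrow> (nat \<rightharpoonup> nat)
    \<Rightarrow> (nat \<Rightarrow> ('o, 'a) mfun) \<Rightarrow> ('o, 'a) tvcell \<Rightarrow> ('o, 'a) tvcell" where
  "whisker_left \<phi> \<psi> g t k X = FA (g k) (\<lambda>j \<in> fib \<psi> k. t j (restrict X (fib \<phi> j)))"

definition whisker_right :: "(nat \<rightharpoonup> nat) \<Rightarrow> (nat \<rightharpoonup> nat)
    \<Rightarrow> ('o, 'a) tvcell \<Rightarrow> (nat \<Rightarrow> ('o, 'a) mfun) \<Rightarrow> ('o, 'a) tvcell" where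
  "whisker_right \<phi> \<psi> t f k X = t k (spread_ob \<phi> \<psi> f k X)"

text \<open>Precomposition with \<open>F\<close> is essentially surjective and fully faithful.\<close>

definition tv_cocartesian :: "('k::field, 'o, 'a) tvob \<Rightarrow> ('k, 'o, 'a) tvob \<Rightarrow> (nat \<rightharpoonup> nat)
    \<Rightarrow> (nat \<Rightarrow> ('o, 'a) mfun) \<Rightarrow> bool" where
  "tv_cocartesian X Y \<phi> F \<longleftrightarrow> tv_mor X Y \<phi> F \<and>
     (\<forall>Z \<psi>. tv_ob Z \<and> ptd_map (fst Y) (fst Z) \<psi> \<longrightarrow>
        (\<forall>h. tv_mor X Z (\<psi> \<circ>\<^sub>m \<phi>) h \<longrightarrow>
           (\<exists>g t. tv_mor Y Z \<psi> g \<and> tv_iso X Z (\<psi> \<circ>\<^sub>m \<phi>) (tv_comp \<phi> \<psi> g F) h t)) \<and>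
        (\<forall>g g' s. tv_mor Y Z \<psi> g \<and> tv_mor Y Z \<psi> g' \<and>
             tv_nat X Z (\<psi> \<circ>\<^sub>m \<phi>) (tv_comp \<phi> \<psi> g F) (tv_comp \<phi> \<psi> g' F) s \<longrightarrow>
           (\<exists>t. tv_nat Y Z \<psi> g g' t \<and> tv_eq X Z (\<psi> \<circ>\<^sub>m \<phi>) (whisker_right \<phi> \<psi> t F) s \<and>
              (\<forall>t'. tv_nat Y Z \<psi> g g' t' \<and> tv_eq X Z (\<psi> \<circ>\<^sub>m \<phi>) (whisker_right \<phi> \<psi> t' F) s \<longrightarrow>
                 tv_eq Y Z \<psi> t' t))))"

section \<open>The category of families of finite sets over pointed finite sets\<close>

type_synonym fsob = "nat set \<times> (nat \<Rightarrow> nat set)"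

record fsar =
  Src :: fsob
  Tgt :: fsob
  Base :: "nat \<rightharpoonup> nat"
  Maps :: "nat \<Rightarrow> nat \<Rightarrow> nat"

definition fs_ob :: "fsob \<Rightarrow> bool" where
  "fs_ob X \<longleftrightarrow> finite (fst X) \<and> snd X \<in> fst X \<rightarrow>\<^sub>E Collect finite"

text \<open>The maps to the one-point set over the base point are omitted.\<close>

definition fs_ar :: "fsar \<Rightarrow> bool" where
  "fs_ar u \<longleftrightarrow> fs_ob (Src u) \<and> fs_ob (Tgt u) \<and> ptd_map (fst (Src u)) (fst (Tgt u)) (Base u) \<and>
     Maps u \<in> (\<Pi>\<^sub>E i\<in>dom (Base u). snd (Src u) i \<rightarrow>\<^sub>E snd (Tgt u) (the (Base u i)))"

definition fs_id :: "fsob \<Rightarrow> fsar" where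
  "fs_id X = \<lparr>Src = X, Tgt = X, Base = (\<lambda>i. if i \<in> fst X then Some i else None),
     Maps = (\<lambda>i\<in>fst X. \<lambda>x\<in>snd X i. x)\<rparr>"

definition fs_comp :: "fsar \<Rightarrow> fsar \<Rightarrow> fsar"  (infixl "\<cdot>" 70) where
  "v \<cdot> u = \<lparr>Src = Src u, Tgt = Tgt v, Base = Base v \<circ>\<^sub>m Base u,
     Maps = (\<lambda>i\<in>dom (Base v \<circ>\<^sub>m Base u).
       compose (snd (Src u) i) (Maps v (the (Base u i))) (Maps u i))\<rparr>"

definition fs_cocartesian :: "fsar \<Rightarrow> bool" where
  "fs_cocartesian u \<longleftrightarrow> fs_ar u \<and>
     (\<forall>Z \<psi>. fs_ob Z \<and> ptd_map (fst (Tgt u)) (fst Z) \<psi> \<longrightarrow>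
        (\<forall>w. fs_ar w \<and> Src w = Src u \<and> Tgt w = Z \<and> Base w = \<psi> \<circ>\<^sub>m Base u \<longrightarrow>
           (\<exists>!v. fs_ar v \<and> Src v = Tgt u \<and> Tgt v = Z \<and> Base v = \<psi> \<and> v \<cdot> u = w)))"

text \<open>The fibre over the pointed set with one element \<open>1\<close> besides the base point.\<close>

definition sing :: "nat set \<Rightarrow> fsob" where
  "sing S = ({1}, \<lambda>i\<in>{1}. S)"

definition fs_map :: "nat set \<Rightarrow> nat set \<Rightarrow> (nat \<Rightarrow> nat) \<Rightarrow> fsar" where
  "fs_map S T f = \<lparr>Src = sing S, Tgt = sing T, Base = [1 \<mapsto> 1], Maps = (\<lambda>i\<in>{1}. \<lambda>x\<in>S. f x)\<rparr>"

text \<open>A Cartesian square of finite sets with top \<open>g\<close>, left \<open>f\<close>, right \<open>h\<close> and bottom \<open>i\<close>.\<close>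

definition cartesian_square :: "nat set \<Rightarrow> nat set \<Rightarrow> nat set \<Rightarrow> nat set
    \<Rightarrow> (nat \<Rightarrow> nat) \<Rightarrow> (nat \<Rightarrow> nat) \<Rightarrow> (nat \<Rightarrow> nat) \<Rightarrow> (nat \<Rightarrow> nat) \<Rightarrow> bool" where
  "cartesian_square A B C D g f h i \<longleftrightarrow>
     finite A \<and> finite B \<and> finite C \<and> finite D \<and>
     g \<in> A \<rightarrow> B \<and> f \<in> A \<rightarrow> C \<and> h \<in> B \<rightarrow> D \<and> i \<in> C \<rightarrow> D \<and> (\<forall>a\<in>A. h (g a) = i (f a)) \<and>
     (\<forall>(T::nat set) p q. finite T \<and> p \<in> T \<rightarrow> B \<and> q \<in> T \<rightarrow> C \<and> (\<forall>t\<in>T. h (p t) = i (q t)) \<longrightarrow>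
        (\<exists>!r. r \<in> T \<rightarrow>\<^sub>E A \<and> (\<forall>t\<in>T. g (r t) = p t \<and> f (r t) = q t)))"

section \<open>The Beck--Chevalley condition\<close>

text \<open>In the following, \<open>g\<close> is the top, \<open>f\<close> the left, \<open>h\<close> the right and \<open>i\<close> the bottom of a square of
  functors with \<open>\<alpha> : h \<odot> g \<Rightarrow> i \<odot> f\<close>.  The right mate goes from \<open>g \<odot> f\<^sub>R\<close>
  to \<open>h\<^sub>R \<odot> i\<close>; the adjunctions \<open>f \<stileturn> f\<^sub>R\<close>, \<open>h \<stileturn> h\<^sub>R\<close> are \<open>af\<close>, \<open>ah\<close>, and \<open>B\<close>
  is the upper right corner.  The left mate goes from \<open>i\<^sub>L \<odot> h\<close> to \<open>f \<odot> g\<^sub>L\<close>; the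
  adjunctions \<open>g\<^sub>L \<stileturn> g\<close>, \<open>i\<^sub>L \<stileturn> i\<close> are \<open>ag\<close>, \<open>ai\<close>, and \<open>C\<close> is the lower left corner.\<close>

definition right_mate :: "('k, 'oB, 'aB) lcat \<Rightarrow> ('oA, 'aA, 'oB, 'aB) fctr
    \<Rightarrow> ('oC, 'aC, 'oD, 'aD) fctr \<Rightarrow> ('oA, 'aA, 'oC, 'aC) adjn \<Rightarrow> ('oB, 'aB, 'oD, 'aD) adjn
    \<Rightarrow> ('oA \<Rightarrow> 'aD) \<Rightarrow> 'oC \<Rightarrow> 'aB" where
  "right_mate B g i af ah \<alpha> Y =
     Cmp B (FA (RF ah) (FA i (Counit af Y)))
       (Cmp B (FA (RF ah) (\<alpha> (FO (RF af) Y)))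
          (Unit ah (FO g (FO (RF af) Y))))"

definition left_mate :: "('k, 'oC, 'aC) lcat \<Rightarrow> ('oA, 'aA, 'oC, 'aC) fctr
    \<Rightarrow> ('oB, 'aB, 'oD, 'aD) fctr \<Rightarrow> ('oB, 'aB, 'oA, 'aA) adjn \<Rightarrow> ('oD, 'aD, 'oC, 'aC) adjn
    \<Rightarrow> ('oA \<Rightarrow> 'aD) \<Rightarrow> 'oB \<Rightarrow> 'aC" where
  "left_mate C f h ag ai \<alpha> Y =
     Cmp C (Counit ai (FO f (FO (LF ag) Y)))
       (Cmp C (FA (LF ai) (\<alpha> (FO (LF ag) Y)))
          (FA (LF ai) (FA h (Unit ag Y))))"

text \<open>All 1-morphisms of graded 2-vector spaces have adjoints on both sides; whether the mates are
  invertible does not depend on the choice of adjoints.\<close>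

definition beck_chevalley :: "('k, 'o, 'a) grcat \<Rightarrow> ('k, 'o, 'a) grcat \<Rightarrow> ('k, 'o, 'a) grcat
    \<Rightarrow> ('k, 'o, 'a) grcat \<Rightarrow> ('o, 'a) gfun \<Rightarrow> ('o, 'a) gfun \<Rightarrow> ('o, 'a) gfun \<Rightarrow> ('o, 'a) gfun
    \<Rightarrow> ((nat \<Rightarrow> 'o) \<Rightarrow> (nat \<Rightarrow> 'a)) \<Rightarrow> bool" where
  "beck_chevalley A B C D g f h i \<alpha> \<longleftrightarrow>
     (\<forall>af ah. gr_adj A C af \<and> LF af = f \<and> gr_adj B D ah \<and> LF ah = h \<longrightarrow>
        (\<forall>Y \<in> Ob (tot C). is_iso (tot B) (right_mate (tot B) g i af ah \<alpha> Y))) \<and>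
     (\<forall>ag ai. gr_adj B A ag \<and> RF ag = g \<and> gr_adj D C ai \<and> RF ai = i \<longrightarrow>
        (\<forall>Y \<in> Ob (tot B). is_iso (tot C) (left_mate (tot C) f h ag ai \<alpha> Y)))"

section \<open>SSH categories\<close>

text \<open>Data of a pseudofunctor: \<open>HCmp H v u\<close> is the comparison from \<open>H v \<circ> H u\<close> to \<open>H (v \<cdot> u)\<close> and
  \<open>HId H X\<close> the one from the identity of \<open>H X\<close> to \<open>H (fs_id X)\<close>.\<close>

record ('k, 'o, 'a) psdata =
  HOb :: "fsob \<Rightarrow> nat \<Rightarrow> ('k, 'o, 'a) grcat"
  HAr :: "fsar \<Rightarrow> nat \<Rightarrow> ('o, 'a) mfun"
  HCmp :: "fsar \<Rightarrow> fsar \<Rightarrow> ('o, 'a) tvcell"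
  HId :: "fsob \<Rightarrow> ('o, 'a) tvcell"

definition img :: "('k, 'o, 'a) psdata \<Rightarrow> fsob \<Rightarrow> ('k, 'o, 'a) tvob" where
  "img H X = (fst X, HOb H X)"

text \<open>Composition of 1-morphisms of families is strictly associative and unital on objects of the
  source, so no associators or unitors appear in the coherence laws.\<close>

locale pseudofunctor =
  fixes H :: "('k::field_char_0, 'o, 'a) psdata"
  assumes HOb: "fs_ob X \<Longrightarrow> tv_ob (img H X)"
    and HAr: "fs_ar u \<Longrightarrow> tv_mor (img H (Src u)) (img H (Tgt u)) (Base u) (HAr H u)"
    and HCmp: "\<lbrakk>fs_ar u; fs_ar v; Src v = Tgt u\<rbrakk> \<Longrightarrow>
      tv_iso (img H (Src u)) (img H (Tgt v)) (Base v \<circ>\<^sub>m Base u)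
        (tv_comp (Base u) (Base v) (HAr H v) (HAr H u)) (HAr H (v \<cdot> u)) (HCmp H v u)"
    and HId: "fs_ob X \<Longrightarrow>
      tv_iso (img H X) (img H X) (Base (fs_id X)) tv_id (HAr H (fs_id X)) (HId H X)"
    and HCmp_assoc: "\<lbrakk>fs_ar u; fs_ar v; fs_ar w; Src v = Tgt u; Src w = Tgt v\<rbrakk> \<Longrightarrow>
      tv_eq (img H (Src u)) (img H (Tgt w)) (Base w \<circ>\<^sub>m Base v \<circ>\<^sub>m Base u)
        (\<lambda>l A. Cmp (tot (HOb H (Tgt w) l)) (HCmp H w (v \<cdot> u) l A)
           (whisker_left (Base v \<circ>\<^sub>m Base u) (Base w) (HAr H w) (HCmp H v u) l A))
        (\<lambda>l A. Cmp (tot (HOb H (Tgt w) l)) (HCmp H (w \<cdot> v) u l A)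
           (whisker_right (Base u) (Base w \<circ>\<^sub>m Base v) (HCmp H w v) (HAr H u) l A))"
    and HCmp_Id: "fs_ar u \<Longrightarrow>
      tv_eq (img H (Src u)) (img H (Tgt u)) (Base u)
        (\<lambda>j A. Cmp (tot (HOb H (Tgt u) j)) (HCmp H u (fs_id (Src u)) j A)
           (whisker_left (Base (fs_id (Src u))) (Base u) (HAr H u) (HId H (Src u)) j A))
        (\<lambda>j A. Id (tot (HOb H (Tgt u) j)) (FO (HAr H u j) A))"
    and HId_Cmp: "fs_ar u \<Longrightarrow>
      tv_eq (img H (Src u)) (img H (Tgt u)) (Base u)
        (\<lambda>j A. Cmp (tot (HOb H (Tgt u) j)) (HCmp H (fs_id (Tgt u)) u j A)
           (whisker_right (Base u) (Base (fs_id (Tgt u))) (HId H (Tgt u)) (HAr H u) j A))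
        (\<lambda>j A. Id (tot (HOb H (Tgt u) j)) (FO (HAr H u j) A))"

text \<open>For \<open>v \<cdot> u = v' \<cdot> u'\<close>, the invertible 2-morphism from \<open>H v \<circ> H u\<close> to \<open>H v' \<circ> H u'\<close>.\<close>

definition sq_cell :: "('k, 'o, 'a) psdata \<Rightarrow> fsar \<Rightarrow> fsar \<Rightarrow> fsar \<Rightarrow> fsar \<Rightarrow> ('o, 'a) tvcell" where
  "sq_cell H v u v' u' j A =
     (let D = tot (HOb H (Tgt v) j) in Cmp D (inv_ar D (HCmp H v' u' j A)) (HCmp H v u j A))"

text \<open>A functor on a product with only one factor, of index \<open>i\<close>, as a functor on that factor.\<close>

definition unary :: "nat \<Rightarrow> ('o, 'a) mfun \<Rightarrow> ('o, 'a) gfun" where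
  "unary i F = \<lparr>FO = (\<lambda>X. FO F (\<lambda>k\<in>{i}. X)), FA = (\<lambda>f. FA F (\<lambda>k\<in>{i}. f))\<rparr>"

text \<open>\<open>H(S)\<close> for a finite set \<open>S\<close>, and \<open>H(f : S \<rightarrow> T)\<close> for a map of finite sets.\<close>

abbreviation HS :: "('k, 'o, 'a) psdata \<Rightarrow> nat set \<Rightarrow> ('k, 'o, 'a) grcat" where
  "HS H S \<equiv> HOb H (sing S) 1"

definition HM :: "('k, 'o, 'a) psdata \<Rightarrow> nat set \<Rightarrow> nat set \<Rightarrow> (nat \<Rightarrow> nat) \<Rightarrow> ('o, 'a) gfun" where
  "HM H S T f = unary 1 (HAr H (fs_map S T f) 1)"

locale ssh_category = pseudofunctor H for H :: "('k::field_char_0, 'o, 'a) psdata" +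
  assumes degree_zero: "\<lbrakk>fs_ar u; j \<in> fst (Tgt u)\<rbrakk> \<Longrightarrow>
      has_degrees (fib (Base u) j) (HOb H (Src u)) (HOb H (Tgt u) j) {0} (HAr H u j)"
    and cocartesian: "fs_cocartesian u \<Longrightarrow>
      tv_cocartesian (img H (Src u)) (img H (Tgt u)) (Base u) (HAr H u)"
    and BC: "cartesian_square A B C D g f h i \<Longrightarrow>
      beck_chevalley (HS H A) (HS H B) (HS H C) (HS H D)
        (HM H A B g) (HM H A C f) (HM H B D h) (HM H C D i)
        (\<lambda>X. sq_cell H (fs_map B D h) (fs_map A B g) (fs_map C D i) (fs_map A C f) 1 (\<lambda>k\<in>{1}. X))"

section \<open>External products\<close>

definition pair :: "nat set \<Rightarrow> nat set \<Rightarrow> fsob" where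
  "pair S T = ({1,2}, \<lambda>i\<in>{1,2}. if i = 1 then S else T)"

text \<open>The arrow \<open>(S, T) \<rightarrow> U\<close> given by maps \<open>s 1\<close> and \<open>s 2\<close> on \<open>S\<close> and \<open>T\<close>, and the arrow
  \<open>(S, T) \<rightarrow> U\<close> that forgets one component and is given by \<open>b\<close> on the \<open>i\<close>-th one.\<close>

definition join_ar :: "nat set \<Rightarrow> nat set \<Rightarrow> nat set \<Rightarrow> (nat \<Rightarrow> nat \<Rightarrow> nat) \<Rightarrow> fsar" where
  "join_ar S T U s = \<lparr>Src = pair S T, Tgt = sing U, Base = [1 \<mapsto> 1, 2 \<mapsto> 1],
     Maps = (\<lambda>i\<in>{1,2}. \<lambda>x\<in>snd (pair S T) i. s i x)\<rparr>"

definition proj_ar :: "nat \<Rightarrow> nat set \<Rightarrow> nat set \<Rightarrow> nat set \<Rightarrow> (nat \<Rightarrow> nat) \<Rightarrow> fsar" where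
  "proj_ar i S T U b = \<lparr>Src = pair S T, Tgt = sing U, Base = [i \<mapsto> 1],
     Maps = (\<lambda>k\<in>{i}. \<lambda>x\<in>snd (pair S T) i. b x)\<rparr>"

text \<open>The coCartesian arrows \<open>({1}, {2}) \<rightarrow> {1,2}\<close> and \<open>({1,2}, {1,2}) \<rightarrow> {1..4}\<close>; the second one is
  \<open>1 \<mapsto> 1\<close>, \<open>2 \<mapsto> 3\<close> on the first and \<open>1 \<mapsto> 2\<close>, \<open>2 \<mapsto> 4\<close> on the second component.\<close>

definition c_ar :: fsar where
  "c_ar = join_ar {1} {2} {1,2} (\<lambda>_ x. x)"

definition cbar_ar :: fsar where
  "cbar_ar = join_ar {1,2} {1,2} {1..4} (\<lambda>i x. if i = 1 then 2 * x - 1 else 2 * x)"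

text \<open>The projections \<open>({1}, {2}) \<rightarrow> {1}\<close>, where \<open>{2}\<close> is identified with \<open>{1}\<close>, and the projections
  \<open>({1,2}, {1,2}) \<rightarrow> {1,2}\<close>.  They are coCartesian, so that their images are equivalences, by which
  the components of \<open>H({1}, {2})\<close> are identified with \<open>H({1})\<close> and those of \<open>H({1,2}, {1,2})\<close>
  with \<open>H({1,2})\<close>.\<close>

definition p_ar :: "nat \<Rightarrow> fsar" where
  "p_ar i = proj_ar i {1} {2} {1} (\<lambda>_. 1)"

definition q_ar :: "nat \<Rightarrow> fsar" where
  "q_ar i = proj_ar i {1,2} {1,2} {1,2} (\<lambda>x. x)"

definition p_identification ::
  "('k, 'o, 'a) psdata \<Rightarrow> (nat \<Rightarrow> ('o, 'a) gadj) \<Rightarrow> bool" where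
  "p_identification H e \<longleftrightarrow> (\<forall>i\<in>{1,2}.
     gr_adj_equiv (HS H {1}) (HOb H (pair {1} {2}) i) (e i) \<and> RF (e i) = unary i (HAr H (p_ar i) 1))"

definition q_identification ::
  "('k, 'o, 'a) psdata \<Rightarrow> (nat \<Rightarrow> ('o, 'a) gadj) \<Rightarrow> bool" where
  "q_identification H e \<longleftrightarrow> (\<forall>i\<in>{1,2}.
     gr_adj_equiv (HS H {1,2}) (HOb H (pair {1,2} {1,2}) i) (e i) \<and>
     RF (e i) = unary i (HAr H (q_ar i) 1))"

text \<open>The functor \<open>(X, Y) \<mapsto> H(u)(X, Y)\<close> for an arrow \<open>u : (S, T) \<rightarrow> U\<close> over the active
  map, with \<open>X\<close> and \<open>Y\<close> transported along the identifications \<open>e\<close>.\<close>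

definition ext_ob :: "('k, 'o, 'a) psdata \<Rightarrow> (nat \<Rightarrow> ('o, 'a) gadj) \<Rightarrow> fsar
    \<Rightarrow> (nat \<Rightarrow> 'o) \<Rightarrow> (nat \<Rightarrow> 'o) \<Rightarrow> (nat \<Rightarrow> 'o)" where
  "ext_ob H e u X Y = FO (HAr H u 1) (\<lambda>i\<in>{1,2}. FO (LF (e i)) (if i = 1 then X else Y))"

definition ext_ar :: "('k, 'o, 'a) psdata \<Rightarrow> (nat \<Rightarrow> ('o, 'a) gadj) \<Rightarrow> fsar
    \<Rightarrow> (nat \<Rightarrow> 'a) \<Rightarrow> (nat \<Rightarrow> 'a) \<Rightarrow> (nat \<Rightarrow> 'a)" where
  "ext_ar H e u f g = FA (HAr H u 1) (\<lambda>i\<in>{1,2}. FA (LF (e i)) (if i = 1 then f else g))"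

text \<open>\<open>i_fun H e F\<close> is \<open>X \<mapsto> F \<boxtimes> X\<close>, and \<open>ibar_fun H e \<Phi>\<close> is \<open>X \<mapsto> H(cbar)(\<Phi>, X)\<close>.\<close>

definition i_fun :: "('k, 'o, 'a) psdata \<Rightarrow> (nat \<Rightarrow> ('o, 'a) gadj) \<Rightarrow> (nat \<Rightarrow> 'o) \<Rightarrow> ('o, 'a) gfun" where
  "i_fun H e F = \<lparr>FO = ext_ob H e c_ar F, FA = ext_ar H e c_ar (Id (tot (HS H {1})) F)\<rparr>"

definition ibar_fun :: "('k, 'o, 'a) psdata \<Rightarrow> (nat \<Rightarrow> ('o, 'a) gadj) \<Rightarrow> (nat \<Rightarrow> 'o) \<Rightarrow> ('o, 'a) gfun" where
  "ibar_fun H e \<Phi> = \<lparr>FO = ext_ob H e cbar_ar \<Phi>, FA = ext_ar H e cbar_ar (Id (tot (HS H {1,2})) \<Phi>)\<rparr>"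

section \<open>Multiplication and the canonical comparison\<close>

text \<open>\<open>m2_ar\<close> and \<open>n_ar\<close> exhibit \<open>{1..4}\<close> as the fibre product of \<open>{1,2}\<close> with itself over \<open>{1}\<close>.\<close>

definition m_ar :: fsar where
  "m_ar = fs_map {1,2} {1} (\<lambda>_. 1)"

definition m2_ar :: fsar where
  "m2_ar = fs_map {1..4} {1,2} (\<lambda>x. if x \<le> 2 then 1 else 2)"

definition n_ar :: fsar where
  "n_ar = fs_map {1..4} {1,2} (\<lambda>x. if odd x then 1 else 2)"

definition m_fun :: "('k, 'o, 'a) psdata \<Rightarrow> ('o, 'a) gfun" where
  "m_fun H = HM H {1,2} {1} (\<lambda>_. 1)"

definition m2_fun :: "('k, 'o, 'a) psdata \<Rightarrow> ('o, 'a) gfun" where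
  "m2_fun H = HM H {1..4} {1,2} (\<lambda>x. if x \<le> 2 then 1 else 2)"

text \<open>The arrow \<open>({1,2}, {1,2}) \<rightarrow> ({1}, {2})\<close> over the identity; it satisfies
  \<open>p_ar i \<cdot> mm_ar = m_ar \<cdot> q_ar i\<close> and \<open>c_ar \<cdot> mm_ar = n_ar \<cdot> cbar_ar\<close>.\<close>

definition mm_ar :: fsar where
  "mm_ar = \<lparr>Src = pair {1,2} {1,2}, Tgt = pair {1} {2}, Base = [1 \<mapsto> 1, 2 \<mapsto> 2],
     Maps = (\<lambda>i\<in>{1,2}. \<lambda>x\<in>{1,2}. i)\<rparr>"

text \<open>\<open>mm_transport\<close> is the isomorphism from \<open>m\<close> to the \<open>i\<close>-th component of \<open>H(mm_ar)\<close>,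
  modulo the identifications \<open>e\<close> and \<open>e'\<close>.\<close>

definition mm_transport :: "('k, 'o, 'a) psdata \<Rightarrow> (nat \<Rightarrow> ('o, 'a) gadj) \<Rightarrow> (nat \<Rightarrow> ('o, 'a) gadj)
    \<Rightarrow> nat \<Rightarrow> (nat \<Rightarrow> 'o) \<Rightarrow> (nat \<Rightarrow> 'a)" where
  "mm_transport H e e' i =
     left_mate (tot (HOb H (pair {1} {2}) i)) (unary i (HAr H mm_ar i)) (m_fun H) (e' i) (e i)
       (\<lambda>A. sq_cell H m_ar (q_ar i) (p_ar i) mm_ar 1 (\<lambda>k\<in>{i}. A))"

text \<open>The isomorphism from \<open>m(\<Phi>) \<boxtimes> m(X)\<close> to \<open>H(n_ar)(H(cbar)(\<Phi>, X))\<close>.\<close>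

definition m_box_m :: "('k, 'o, 'a) psdata \<Rightarrow> (nat \<Rightarrow> ('o, 'a) gadj) \<Rightarrow> (nat \<Rightarrow> ('o, 'a) gadj)
    \<Rightarrow> (nat \<Rightarrow> 'o) \<Rightarrow> (nat \<Rightarrow> 'o) \<Rightarrow> (nat \<Rightarrow> 'a)" where
  "m_box_m H e e' \<Phi> X =
     Cmp (tot (HS H {1,2}))
       (sq_cell H c_ar mm_ar n_ar cbar_ar 1 (\<lambda>i\<in>{1,2}. FO (LF (e' i)) (if i = 1 then \<Phi> else X)))
       (FA (HAr H c_ar 1) (\<lambda>i\<in>{1,2}. mm_transport H e e' i (if i = 1 then \<Phi> else X)))"

text \<open>The 2-morphism from \<open>m\<^sub>F \<odot> m\<close> to \<open>m \<odot> m\<^sup>2\<^sub>\<Phi>\<close> with \<open>\<Phi> = \<Delta>\<^sup>l(F)\<close>, given by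
  \<open>m(F \<boxtimes> m X) \<rightarrow> m(m \<Phi> \<boxtimes> m X) \<cong> m(H(n_ar)(H(cbar)(\<Phi>, X))) \<cong> m(m\<^sup>2(H(cbar)(\<Phi>, X)))\<close>; the first
  arrow is induced by the unit of \<open>\<Delta>\<^sup>l \<stileturn> m\<close>, which is \<open>al\<close>.\<close>

definition canonical_cell :: "('k, 'o, 'a) psdata \<Rightarrow> (nat \<Rightarrow> ('o, 'a) gadj) \<Rightarrow> (nat \<Rightarrow> ('o, 'a) gadj)
    \<Rightarrow> ('o, 'a) gadj \<Rightarrow> (nat \<Rightarrow> 'o) \<Rightarrow> (nat \<Rightarrow> 'o) \<Rightarrow> (nat \<Rightarrow> 'a)" where
  "canonical_cell H e e' al F X =
     (let C = tot (HS H {1}); \<Phi> = FO (LF al) F; m = m_fun H in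
     Cmp C (sq_cell H m_ar n_ar m_ar m2_ar 1 (\<lambda>k\<in>{1}. ext_ob H e' cbar_ar \<Phi> X))
       (Cmp C (FA m (m_box_m H e e' \<Phi> X))
          (FA m (ext_ar H e c_ar (Unit al F) (Id C (FO m X))))))"

text \<open>The right mate of \<open>canonical_cell\<close> with respect to the adjunctions \<open>m\<^sup>2\<^sub>\<Phi> \<stileturn> (\<Delta>\<^sup>r)\<^sup>2\<^sub>\<Phi>\<close>
  and \<open>m\<^sub>F \<stileturn> \<Delta>\<^sup>r\<^sub>F\<close>, for \<open>m \<stileturn> \<Delta>\<^sup>r\<close>, \<open>i\<^sub>F \<stileturn> j\<^sup>r\<^sub>F\<close>, \<open>m\<^sup>2 \<stileturn> (\<Delta>\<^sup>r)\<^sup>2\<close> and \<open>i\<^sub>\<Phi> \<stileturn> j\<^sup>r\<^sub>\<Phi>\<close>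
  given by \<open>ar\<close>, \<open>aF\<close>, \<open>ar2\<close> and \<open>a\<Phi>\<close>.  It goes from \<open>m \<odot> (\<Delta>\<^sup>r)\<^sup>2\<^sub>\<Phi>\<close> to \<open>\<Delta>\<^sup>r\<^sub>F \<odot> m\<close>.\<close>

definition canonical_map :: "('k, 'o, 'a) psdata \<Rightarrow> (nat \<Rightarrow> ('o, 'a) gadj) \<Rightarrow> (nat \<Rightarrow> ('o, 'a) gadj)
    \<Rightarrow> ('o, 'a) gadj \<Rightarrow> ('o, 'a) gadj \<Rightarrow> ('o, 'a) gadj \<Rightarrow> ('o, 'a) gadj \<Rightarrow> ('o, 'a) gadj
    \<Rightarrow> (nat \<Rightarrow> 'o) \<Rightarrow> (nat \<Rightarrow> 'o) \<Rightarrow> (nat \<Rightarrow> 'a)" where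
  "canonical_map H e e' al ar aF ar2 a\<Phi> F =
     right_mate (tot (HS H {1})) (m_fun H) (m_fun H)
       (adj_comp (tot (HS H {1,2})) (tot (HS H {1,2})) ar2 a\<Phi>)
       (adj_comp (tot (HS H {1})) (tot (HS H {1})) ar aF)
       (canonical_cell H e e' al F)"

end

theory Submission
  imports Defs
begin

text \<open>The canonical cell is pasted from two squares: the Cartesian square exhibiting \<open>[4]\<close>
  as \<open>[2] \<times> [2]\<close>, with top \<open>n\<close>, whose right mate is invertible by the Beck--Chevalley
  condition, and the square \<open>F \<boxtimes> m X \<rightarrow> m \<Phi> \<boxtimes> m X \<cong> n(H(cbar)(\<Phi>, X))\<close>.  Right mates are
  compatible with pasting, so it remains to see that the mate of the second square is
  invertible.  By adjunction this holds once the arrow from \<open>F \<boxtimes> X\<close> to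
  \<open>m \<Delta>\<^sup>l F \<boxtimes> m \<Delta>\<^sup>l X \<cong> n(H(cbar)(\<Delta>\<^sup>l F, \<Delta>\<^sup>l X))\<close> is a universal arrow to \<open>n\<close>, which says
  that the left adjoint of \<open>n\<close> is \<open>\<Delta>\<^sup>l \<otimes> \<Delta>\<^sup>l\<close>.  To construct that adjoint,
  \<open>H(cbar) \<circ> (\<Delta>\<^sup>l, \<Delta>\<^sup>l)\<close> is extended along the coCartesian arrow \<open>\<boxtimes>\<close> to a functor \<open>L\<close>, and
  the unit and the counit are obtained from the full faithfulness of precomposition with
  \<open>\<boxtimes>\<close> and with \<open>H(cbar)\<close>.  The extension requires \<open>\<Delta>\<^sup>l\<close> to have nonnegative degree; being
  left adjoint to a functor of degree zero, it has degree zero.\<close>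

section \<open>Universal arrows\<close>

text \<open>Why universality makes a mate invertible: if \<open>g\<close> has a left adjoint
  \<open>g\<^sub>L\<close>, arrows \<open>X -> g (f\<^sub>R Y)\<close> correspond to
  \<open>g\<^sub>L X -> f\<^sub>R Y\<close>, hence to \<open>f (g\<^sub>L X) -> Y\<close>, while
  arrows \<open>X -> h\<^sub>R (i Y)\<close> correspond to \<open>h X -> i Y\<close>. A universal
  arrow \<open>h X -> i (f (g\<^sub>L X))\<close> matches the two sides, and the resulting bijection
  is postcomposition with the mate. Two obstacles shape the rest. The components of
  \<open>H({1},{2})\<close> and \<open>H({1,2},{1,2})\<close> are only equivalent to
  \<open>H({1})\<close> and \<open>H({1,2})\<close>, so \<open>\<Delta>\<^sup>l\<close> has to be
  transported along the identifications. And the coCartesian property sees a natural transformation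
  only through its values on external products: the triangle identity needed at every object comes
  from faithfulness of precomposition with \<open>H(cbar)\<close>, while the other one is needed,
  and computed, only at external products. Universal arrows at single objects suit this asymmetry.
  The degree question arises because \<open>gr_mor\<close> admits negative degrees and
  \<open>multi_mor\<close> does not.\<close>

locale category =
  fixes C :: "('k, 'o, 'a) lcat"
  assumes Dom_Ob [simp]: "f \<in> Ar C \<Longrightarrow> Dom C f \<in> Ob C"
    and Cod_Ob [simp]: "f \<in> Ar C \<Longrightarrow> Cod C f \<in> Ob C"
    and Id_Ar [simp]: "X \<in> Ob C \<Longrightarrow> Id C X \<in> Ar C"
    and Dom_Id [simp]: "X \<in> Ob C \<Longrightarrow> Dom C (Id C X) = X"
    and Cod_Id [simp]: "X \<in> Ob C \<Longrightarrow> Cod C (Id C X) = X"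
    and Cmp_Ar [simp]: "\<lbrakk>f \<in> Ar C; g \<in> Ar C; Cod C f = Dom C g\<rbrakk> \<Longrightarrow> Cmp C g f \<in> Ar C"
    and Dom_Cmp [simp]: "\<lbrakk>f \<in> Ar C; g \<in> Ar C; Cod C f = Dom C g\<rbrakk> \<Longrightarrow> Dom C (Cmp C g f) = Dom C f"
    and Cod_Cmp [simp]: "\<lbrakk>f \<in> Ar C; g \<in> Ar C; Cod C f = Dom C g\<rbrakk> \<Longrightarrow> Cod C (Cmp C g f) = Cod C g"
    and right_unit: "f \<in> Ar C \<Longrightarrow> Cmp C f (Id C (Dom C f)) = f"
    and left_unit: "f \<in> Ar C \<Longrightarrow> Cmp C (Id C (Cod C f)) f = f"
    and assoc [simp]: "\<lbrakk>f \<in> Ar C; g \<in> Ar C; h \<in> Ar C; Cod C f = Dom C g; Cod C g = Dom C h\<rbrakk>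
      \<Longrightarrow> Cmp C (Cmp C h g) f = Cmp C h (Cmp C g f)"
begin

lemma right_unit' [simp]: "\<lbrakk>f \<in> Ar C; Dom C f = X\<rbrakk> \<Longrightarrow> Cmp C f (Id C X) = f"
  using right_unit by auto

lemma left_unit' [simp]: "\<lbrakk>f \<in> Ar C; Cod C f = X\<rbrakk> \<Longrightarrow> Cmp C (Id C X) f = f"
  using left_unit by auto

text \<open>Composites are kept nested to the right, so an equation between two-fold composites does
  not match inside a longer one; this version and \<open>reassoc1\<close> carry a further arrow
  \<open>h\<close> along.\<close>

lemma reassoc:
  assumes "Cmp C g f = Cmp C g' f'" and "f \<in> Ar C" "g \<in> Ar C" "f' \<in> Ar C" "g' \<in> Ar C" "h \<in> Ar C"
    and "Cod C f = Dom C g" "Cod C f' = Dom C g'" "Cod C h = Dom C f" "Dom C f' = Dom C f"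
  shows "Cmp C g (Cmp C f h) = Cmp C g' (Cmp C f' h)"
proof -
  have "Cmp C g (Cmp C f h) = Cmp C (Cmp C g f) h" using assms(2-) by simp
  also have "\<dots> = Cmp C g' (Cmp C f' h)" unfolding assms(1) using assms(2-) by simp
  finally show ?thesis .
qed

lemma reassoc1:
  assumes "Cmp C g f = k" and "f \<in> Ar C" "g \<in> Ar C" "h \<in> Ar C"
    and "Cod C f = Dom C g" "Cod C h = Dom C f"
  shows "Cmp C g (Cmp C f h) = Cmp C k h"
  using assms by auto

lemma is_inverse_unique: "\<lbrakk>is_inverse C f g; is_inverse C f h\<rbrakk> \<Longrightarrow> g = h"
  unfolding is_inverse_def hom_def by (smt (verit) assoc left_unit mem_Collect_eq right_unit)

lemma inv_ar_eq: "is_inverse C f g \<Longrightarrow> inv_ar C f = g"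
  unfolding inv_ar_def using is_inverse_unique by blast

lemma is_inverse_inv_ar: "is_iso C f \<Longrightarrow> is_inverse C f (inv_ar C f)"
  using inv_ar_eq is_iso_def by metis

lemma is_iso_Ar: "is_iso C f \<Longrightarrow> f \<in> Ar C"
  by (auto simp: is_iso_def is_inverse_def)

lemma inv_ar_simps [simp]:
  assumes "is_iso C f"
  shows "inv_ar C f \<in> Ar C" "Dom C (inv_ar C f) = Cod C f" "Cod C (inv_ar C f) = Dom C f"
    "Cmp C (inv_ar C f) f = Id C (Dom C f)" "Cmp C f (inv_ar C f) = Id C (Cod C f)"
  using is_inverse_inv_ar [OF assms] by (auto simp: is_inverse_def hom_def)

lemma inv_ar_assoc [simp]:
  assumes "is_iso C f" "h \<in> Ar C"
  shows "Cod C h = Dom C f \<Longrightarrow> Cmp C (inv_ar C f) (Cmp C f h) = h"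
    "Cod C h = Cod C f \<Longrightarrow> Cmp C f (Cmp C (inv_ar C f) h) = h"
  using reassoc1 [OF inv_ar_simps(4) [OF assms(1)], of h]
    reassoc1 [OF inv_ar_simps(5) [OF assms(1)], of h] assms is_iso_Ar by auto

lemma is_isoI:
  "\<lbrakk>f \<in> Ar C; g \<in> Ar C; Dom C g = Cod C f; Cod C g = Dom C f; Cmp C g f = Id C (Dom C f);
    Cmp C f g = Id C (Cod C f)\<rbrakk> \<Longrightarrow> is_iso C f"
  by (auto simp: is_iso_def is_inverse_def hom_def)

lemma is_iso_inv_ar: "is_iso C f \<Longrightarrow> is_iso C (inv_ar C f)"
  by (rule is_isoI [of _ f]) (auto simp: is_iso_Ar)

lemma is_iso_Cmp:
  assumes "is_iso C f" "is_iso C g" "Cod C f = Dom C g"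
  shows "is_iso C (Cmp C g f)"
  by (rule is_isoI [of _ "Cmp C (inv_ar C f) (inv_ar C g)"]) (use assms in \<open>simp_all add: is_iso_Ar\<close>)

lemma iso_cancel_left:
  assumes "Cmp C f g = Cmp C f h" "is_iso C f" "g \<in> Ar C" "h \<in> Ar C" "Cod C g = Dom C f"
    "Cod C h = Dom C f"
  shows "g = h"
  by (metis assms inv_ar_assoc(1))

lemma iso_cancel_right:
  assumes "Cmp C g f = Cmp C h f" "is_iso C f" "g \<in> Ar C" "h \<in> Ar C" "Dom C g = Cod C f"
    "Dom C h = Cod C f"
  shows "g = h"
proof -
  have "Cmp C (Cmp C g f) (inv_ar C f) = Cmp C (Cmp C h f) (inv_ar C f)" using assms by simp
  then show ?thesis using assms(2-) by (simp add: is_iso_Ar)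
qed

text \<open>It suffices that \<open>Hom(X, f)\<close> is bijective for \<open>X\<close> the source and the target of \<open>f\<close>.\<close>

lemma is_iso_if_postcomposition_bijective:
  assumes f: "f \<in> Ar C"
    and surj: "\<exists>g. g \<in> Ar C \<and> Dom C g = Cod C f \<and> Cod C g = Dom C f \<and> Cmp C f g = Id C (Cod C f)"
    and inj: "\<And>g h. \<lbrakk>g \<in> Ar C; h \<in> Ar C; Dom C g = Dom C f; Dom C h = Dom C f; Cod C g = Dom C f;
      Cod C h = Dom C f; Cmp C f g = Cmp C f h\<rbrakk> \<Longrightarrow> g = h"
  shows "is_iso C f"
proof -
  obtain g where g: "g \<in> Ar C" "Dom C g = Cod C f" "Cod C g = Dom C f" "Cmp C f g = Id C (Cod C f)"
    using surj by blast
  have "Cmp C f (Cmp C g f) = Cmp C f (Id C (Dom C f))"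
    using reassoc1 [OF g(4)] f g by simp
  then have "Cmp C g f = Id C (Dom C f)" by (rule inj [rotated -1]) (use f g in auto)
  then show ?thesis using f g by (intro is_isoI [of f g]) auto
qed

end

lemma (in linear_category) is_category: "category C"
  by unfold_locales
    (use Dom_in Cod_in Id_in Cmp_in Cmp_Id Id_Cmp Cmp_assoc in \<open>auto simp: hom_def\<close>)

lemma fcomp_simps [simp]:
  "FO (G \<odot> F) X = FO G (FO F X)" "FA (G \<odot> F) f = FA G (FA F f)"
  by (auto simp: fcomp_def)

lemma id_fctr_simps [simp]: "FO id_fctr X = X" "FA id_fctr f = f"
  by (auto simp: id_fctr_def)

section \<open>Functors, natural transformations, adjunctions and universal arrows\<close>

locale cat_functor = source: category C + target: category D
  for C :: "('k1, 'o1, 'a1) lcat" and D :: "('k2, 'o2, 'a2) lcat" +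
  fixes F :: "('o1, 'a1, 'o2, 'a2) fctr"
  assumes is_functor: "is_functor C D F"
begin

lemma FO_Ob [simp]: "X \<in> Ob C \<Longrightarrow> FO F X \<in> Ob D"
  and FA_Id [simp]: "X \<in> Ob C \<Longrightarrow> FA F (Id C X) = Id D (FO F X)"
  and FA_Ar [simp]: "f \<in> Ar C \<Longrightarrow> FA F f \<in> Ar D"
  and Dom_FA [simp]: "f \<in> Ar C \<Longrightarrow> Dom D (FA F f) = FO F (Dom C f)"
  and Cod_FA [simp]: "f \<in> Ar C \<Longrightarrow> Cod D (FA F f) = FO F (Cod C f)"
  and FA_Cmp [simp]: "\<lbrakk>f \<in> Ar C; g \<in> Ar C; Cod C f = Dom C g\<rbrakk>
    \<Longrightarrow> FA F (Cmp C g f) = Cmp D (FA F g) (FA F f)"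
  using is_functor by (auto simp: is_functor_def hom_def)

lemma is_iso_FA: "is_iso C f \<Longrightarrow> is_iso D (FA F f)"
  by (rule target.is_isoI [of _ "FA F (inv_ar C f)"])
    (auto simp: source.is_iso_Ar simp flip: FA_Cmp)

end

lemma cat_functor_fcomp:
  assumes "cat_functor C D F" "cat_functor D E G"
  shows "cat_functor C E (G \<odot> F)"
proof -
  interpret F: cat_functor C D F by fact
  interpret G: cat_functor D E G by fact
  show ?thesis by unfold_locales (auto simp: is_functor_def hom_def)
qed

lemma cat_functor_id: "category C \<Longrightarrow> cat_functor C C id_fctr"
  by (simp add: cat_functor_def cat_functor_axioms_def is_functor_def hom_def category.Dom_Ob
      category.Cod_Ob)

locale cat_trans = source: cat_functor C D F + target: cat_functor C D G
  for C :: "('k1, 'o1, 'a1) lcat" and D :: "('k2, 'o2, 'a2) lcat" and F G +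
  fixes t :: "'o1 \<Rightarrow> 'a2"
  assumes nat_trans: "nat_trans C D F G t"
begin

lemma Ar [simp]: "X \<in> Ob C \<Longrightarrow> t X \<in> Ar D"
  and Dom [simp]: "X \<in> Ob C \<Longrightarrow> Dom D (t X) = FO F X"
  and Cod [simp]: "X \<in> Ob C \<Longrightarrow> Cod D (t X) = FO G X"
  and naturality: "f \<in> Ar C \<Longrightarrow> Cmp D (t (Cod C f)) (FA F f) = Cmp D (FA G f) (t (Dom C f))"
  using nat_trans by (auto simp: nat_trans_def hom_def)

lemma naturality_assoc:
  "\<lbrakk>f \<in> Ar C; h \<in> Ar D; Cod D h = FO F (Dom C f)\<rbrakk>
    \<Longrightarrow> Cmp D (t (Cod C f)) (Cmp D (FA F f) h) = Cmp D (FA G f) (Cmp D (t (Dom C f)) h)"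
  using source.target.reassoc [OF naturality] by simp

end

lemma nat_transI:
  assumes "\<And>X. X \<in> Ob C \<Longrightarrow> t X \<in> Ar D"
    and "\<And>X. X \<in> Ob C \<Longrightarrow> Dom D (t X) = FO F X" "\<And>X. X \<in> Ob C \<Longrightarrow> Cod D (t X) = FO G X"
    and "\<And>f. f \<in> Ar C \<Longrightarrow> Cmp D (t (Cod C f)) (FA F f) = Cmp D (FA G f) (t (Dom C f))"
  shows "nat_trans C D F G t"
  using assms by (auto simp: nat_trans_def hom_def)

lemma nat_trans_cong:
  assumes "nat_trans C D F G t" "category C"
    and "\<And>X. X \<in> Ob C \<Longrightarrow> FO F X = FO F' X" and "\<And>f. f \<in> Ar C \<Longrightarrow> FA F f = FA F' f"
    and "\<And>X. X \<in> Ob C \<Longrightarrow> FO G X = FO G' X" and "\<And>f. f \<in> Ar C \<Longrightarrow> FA G f = FA G' f"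
    and "\<And>X. X \<in> Ob C \<Longrightarrow> t X = t' X"
  shows "nat_trans C D F' G' t'"
proof -
  interpret category C by fact
  show ?thesis using assms(1) by (auto simp: nat_trans_def simp flip: assms(3-))
qed

lemma nat_iso_cong:
  assumes "nat_iso C D F G t" "category C"
    and "\<And>X. X \<in> Ob C \<Longrightarrow> FO F X = FO F' X" and "\<And>f. f \<in> Ar C \<Longrightarrow> FA F f = FA F' f"
    and "\<And>X. X \<in> Ob C \<Longrightarrow> FO G X = FO G' X" and "\<And>f. f \<in> Ar C \<Longrightarrow> FA G f = FA G' f"
    and "\<And>X. X \<in> Ob C \<Longrightarrow> t X = t' X"
  shows "nat_iso C D F' G' t'"
  using nat_trans_cong [of C D F G t F' G' t'] assms by (auto simp: nat_iso_def)

locale cat_iso = cat_trans +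
  assumes iso: "X \<in> Ob C \<Longrightarrow> is_iso D (t X)"
begin

lemma nat_iso: "nat_iso C D F G t"
  using nat_trans iso by (simp add: nat_iso_def)

lemma inverse: "cat_iso C D G F (\<lambda>X. inv_ar D (t X))"
proof unfold_locales
  show "nat_trans C D G F (\<lambda>X. inv_ar D (t X))"
  proof (rule nat_transI)
    fix f assume f: "f \<in> Ar C"
    show "Cmp D (inv_ar D (t (Cod C f))) (FA G f) = Cmp D (FA F f) (inv_ar D (t (Dom C f)))"
    proof (rule source.target.iso_cancel_left)
      show "Cmp D (t (Cod C f)) (Cmp D (inv_ar D (t (Cod C f))) (FA G f)) =
        Cmp D (t (Cod C f)) (Cmp D (FA F f) (inv_ar D (t (Dom C f))))"
        using f by (simp add: iso naturality_assoc)
    qed (use f in \<open>simp_all add: iso\<close>)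
  qed (simp_all add: iso)
qed (simp add: iso source.target.is_iso_inv_ar)

end

lemma cat_isoI:
  "\<lbrakk>cat_functor C D F; cat_functor C D G; nat_iso C D F G t\<rbrakk> \<Longrightarrow> cat_iso C D F G t"
  by (simp add: cat_iso_def cat_trans_def cat_trans_axioms_def cat_iso_axioms_def nat_iso_def)

locale cat_adj = source: category C + target: category D
  for C :: "('k, 'o1, 'a1) lcat" and D :: "('k, 'o2, 'a2) lcat" +
  fixes A :: "('o1, 'a1, 'o2, 'a2) adjn"
  assumes adjunction: "adjunction C D A"
begin

sublocale LF: cat_functor C D "LF A"
  using adjunction by unfold_locales (simp add: adjunction_def)

sublocale RF: cat_functor D C "RF A"
  using adjunction by unfold_locales (simp add: adjunction_def)

sublocale unit: cat_trans C C id_fctr "RF A \<odot> LF A" "Unit A"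
  using adjunction LF.cat_functor_axioms RF.cat_functor_axioms source.category_axioms
  by (simp add: cat_trans_def cat_trans_axioms_def adjunction_def cat_functor_fcomp cat_functor_id)

sublocale counit: cat_trans D D "LF A \<odot> RF A" id_fctr "Counit A"
  using adjunction LF.cat_functor_axioms RF.cat_functor_axioms target.category_axioms
  by (simp add: cat_trans_def cat_trans_axioms_def adjunction_def cat_functor_fcomp cat_functor_id)

lemma triangle_LF: "X \<in> Ob C \<Longrightarrow>
    Cmp D (Counit A (FO (LF A) X)) (FA (LF A) (Unit A X)) = Id D (FO (LF A) X)"
  and triangle_RF: "Y \<in> Ob D \<Longrightarrow>
    Cmp C (FA (RF A) (Counit A Y)) (Unit A (FO (RF A) Y)) = Id C (FO (RF A) Y)"
  using adjunction by (auto simp: adjunction_def)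

lemma transpose_transpose:
  assumes "g \<in> Ar C" "Y \<in> Ob D" "Cod C g = FO (RF A) Y"
  shows "Cmp C (FA (RF A) (Cmp D (Counit A Y) (FA (LF A) g))) (Unit A (Dom C g)) = g"
proof -
  have "Cmp C (FA (RF A) (Cmp D (Counit A Y) (FA (LF A) g))) (Unit A (Dom C g))
      = Cmp C (FA (RF A) (Counit A Y)) (Cmp C (Unit A (FO (RF A) Y)) g)"
    using assms unit.naturality [of g] by simp
  also have "\<dots> = g" using source.reassoc1 [OF triangle_RF [of Y]] assms by simp
  finally show ?thesis .
qed

lemma transpose_transpose':
  assumes "f \<in> Ar D" "X \<in> Ob C" "Dom D f = FO (LF A) X"
  shows "Cmp D (Counit A (Cod D f)) (FA (LF A) (Cmp C (FA (RF A) f) (Unit A X))) = f"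
proof -
  have "Cmp D (Counit A (Cod D f)) (FA (LF A) (Cmp C (FA (RF A) f) (Unit A X)))
      = Cmp D f (Cmp D (Counit A (FO (LF A) X)) (FA (LF A) (Unit A X)))"
    using assms counit.naturality_assoc [of f "FA (LF A) (Unit A X)"] by simp
  then show ?thesis using triangle_LF assms by simp
qed

end

text \<open>An initial object of the comma category of \<open>X\<close> over \<open>G\<close>, that
  is, a left adjoint of \<open>G\<close> defined at the single object \<open>X\<close>.\<close>

definition univ_arrow :: "('k1, 'o1, 'a1) lcat \<Rightarrow> ('k2, 'o2, 'a2) lcat
    \<Rightarrow> ('o2, 'a2, 'o1, 'a1) fctr \<Rightarrow> 'o1 \<Rightarrow> 'o2 \<Rightarrow> 'a1 \<Rightarrow> bool" where
  "univ_arrow C D G X B u \<longleftrightarrow> B \<in> Ob D \<and> u \<in> Ar C \<and> Dom C u = X \<and> Cod C u = FO G B \<and>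
     (\<forall>Y \<in> Ob D. \<forall>g \<in> hom C X (FO G Y). \<exists>!f. f \<in> hom D B Y \<and> Cmp C (FA G f) u = g)"

lemma univ_arrowD:
  assumes "univ_arrow C D G X B u"
  shows "B \<in> Ob D" "u \<in> Ar C" "Dom C u = X" "Cod C u = FO G B"
  using assms by (auto simp: univ_arrow_def)

lemma univ_arrow_ex:
  assumes "univ_arrow C D G X B u" "g \<in> Ar C" "Dom C g = X" "Cod C g = FO G Y" "Y \<in> Ob D"
  obtains f where "f \<in> Ar D" "Dom D f = B" "Cod D f = Y" "Cmp C (FA G f) u = g"
  using assms unfolding univ_arrow_def hom_def by blast

lemma univ_arrow_eq:
  assumes "univ_arrow C D G X B u" "f \<in> Ar D" "f' \<in> Ar D" "Dom D f = B" "Dom D f' = B"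
    "Cod D f = Cod D f'" "Cmp C (FA G f) u = Cmp C (FA G f') u" "cat_functor D C G"
  shows "f = f'"
proof -
  interpret G: cat_functor D C G by fact
  have "Cmp C (FA G f) u \<in> hom C X (FO G (Cod D f))"
    using assms(2-6) univ_arrowD [OF assms(1)] by (simp add: hom_def)
  moreover have "Cod D f \<in> Ob D" using assms(2) by simp
  ultimately show ?thesis
    using assms unfolding univ_arrow_def hom_def by (metis (mono_tags, lifting) mem_Collect_eq)
qed

lemma univ_arrowI:
  assumes "B \<in> Ob D" "u \<in> Ar C" "Dom C u = X" "Cod C u = FO G B"
    and "\<And>Y g. \<lbrakk>Y \<in> Ob D; g \<in> Ar C; Dom C g = X; Cod C g = FO G Y\<rbrakk> \<Longrightarrow>
      \<exists>f. f \<in> Ar D \<and> Dom D f = B \<and> Cod D f = Y \<and> Cmp C (FA G f) u = g"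
    and "\<And>f f'. \<lbrakk>f \<in> Ar D; f' \<in> Ar D; Dom D f = B; Dom D f' = B; Cod D f = Cod D f';
      Cmp C (FA G f) u = Cmp C (FA G f') u\<rbrakk> \<Longrightarrow> f = f'"
  shows "univ_arrow C D G X B u"
proof -
  have "\<exists>!f. f \<in> hom D B Y \<and> Cmp C (FA G f) u = g" if Yg: "Y \<in> Ob D" "g \<in> hom C X (FO G Y)" for Y g
  proof -
    obtain f where "f \<in> Ar D" "Dom D f = B" "Cod D f = Y" "Cmp C (FA G f) u = g"
      using assms(5) [of Y g] Yg by (auto simp: hom_def)
    then show ?thesis by (intro ex1I [of _ f]) (auto simp: hom_def intro: assms(6))
  qed
  then show ?thesis using assms(1-4) by (auto simp: univ_arrow_def)
qed

lemma (in cat_adj) univ_arrow_unit: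
  assumes X: "X \<in> Ob C"
  shows "univ_arrow C D (RF A) X (FO (LF A) X) (Unit A X)"
proof (rule univ_arrowI)
  fix Y g assume "Y \<in> Ob D" "g \<in> Ar C" "Dom C g = X" "Cod C g = FO (RF A) Y"
  then show "\<exists>f. f \<in> Ar D \<and> Dom D f = FO (LF A) X \<and> Cod D f = Y \<and>
      Cmp C (FA (RF A) f) (Unit A X) = g"
    using transpose_transpose [of g Y]
    by (intro exI [of _ "Cmp D (Counit A Y) (FA (LF A) g)"]) auto
next
  fix f f' assume "f \<in> Ar D" "f' \<in> Ar D" "Dom D f = FO (LF A) X" "Dom D f' = FO (LF A) X"
    "Cod D f = Cod D f'" "Cmp C (FA (RF A) f) (Unit A X) = Cmp C (FA (RF A) f') (Unit A X)"
  then show "f = f'" using transpose_transpose' [of f X] transpose_transpose' [of f' X] X by metis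
qed (use X in simp_all)

text \<open>Pointwise form of the fact that left adjoints compose: the bijections belonging to
  \<open>u\<close> and \<open>w\<close> are composed.\<close>

lemma univ_arrow_fcomp:
  assumes "cat_functor D C G" "cat_functor E D K"
    and u: "univ_arrow C D G X B u" and w: "univ_arrow D E K B Z w"
  shows "univ_arrow C E (G \<odot> K) X Z (Cmp C (FA G w) u)"
proof -
  interpret G: cat_functor D C G by fact
  interpret K: cat_functor E D K by fact
  note D [simp] = univ_arrowD [OF u] univ_arrowD [OF w]
  show ?thesis
  proof (rule univ_arrowI)
    fix Y g assume Y: "Y \<in> Ob E" "g \<in> Ar C" "Dom C g = X" "Cod C g = FO (G \<odot> K) Y"
    obtain f where f: "f \<in> Ar D" "Dom D f = B" "Cod D f = FO K Y" "Cmp C (FA G f) u = g"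
      using univ_arrow_ex [OF u, of g "FO K Y"] Y by auto
    obtain h where "h \<in> Ar E" "Dom E h = Z" "Cod E h = Y" "Cmp D (FA K h) w = f"
      using univ_arrow_ex [OF w f(1,2,3)] Y by auto
    then show "\<exists>h. h \<in> Ar E \<and> Dom E h = Z \<and> Cod E h = Y \<and>
        Cmp C (FA (G \<odot> K) h) (Cmp C (FA G w) u) = g"
      using f by (intro exI [of _ h]) auto
  next
    fix f f' assume a: "f \<in> Ar E" "f' \<in> Ar E" "Dom E f = Z" "Dom E f' = Z" "Cod E f = Cod E f'"
      "Cmp C (FA (G \<odot> K) f) (Cmp C (FA G w) u) = Cmp C (FA (G \<odot> K) f') (Cmp C (FA G w) u)"
    have "Cmp D (FA K f) w = Cmp D (FA K f') w"
      by (rule univ_arrow_eq [OF u]) (use a G.cat_functor_axioms in simp_all)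
    then show "f = f'"
      using univ_arrow_eq [OF w] a K.cat_functor_axioms by blast
  qed simp_all
qed

lemma univ_arrow_nat_iso:
  assumes "cat_iso D C G G' \<tau>" and u: "univ_arrow C D G X B u"
  shows "univ_arrow C D G' X B (Cmp C (\<tau> B) u)"
proof -
  interpret \<tau>: cat_iso D C G G' \<tau> by fact
  note D [simp] = univ_arrowD [OF u]
  have nat: "Cmp C (FA G' f) (Cmp C (\<tau> B) u) = Cmp C (\<tau> (Cod D f)) (Cmp C (FA G f) u)"
    if "f \<in> Ar D" "Dom D f = B" for f
    using that \<tau>.naturality_assoc [of f u] by simp
  show ?thesis
  proof (rule univ_arrowI)
    fix Y g assume Y: "Y \<in> Ob D" "g \<in> Ar C" "Dom C g = X" "Cod C g = FO G' Y"
    obtain f where f: "f \<in> Ar D" "Dom D f = B" "Cod D f = Y"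
        "Cmp C (FA G f) u = Cmp C (inv_ar C (\<tau> Y)) g"
      by (rule univ_arrow_ex [OF u, of "Cmp C (inv_ar C (\<tau> Y)) g" Y]) (use Y \<tau>.iso in auto)
    then show "\<exists>f. f \<in> Ar D \<and> Dom D f = B \<and> Cod D f = Y \<and> Cmp C (FA G' f) (Cmp C (\<tau> B) u) = g"
      using Y \<tau>.iso by (intro exI [of _ f]) (simp add: nat)
  next
    fix f f' assume a: "f \<in> Ar D" "f' \<in> Ar D" "Dom D f = B" "Dom D f' = B" "Cod D f = Cod D f'"
      "Cmp C (FA G' f) (Cmp C (\<tau> B) u) = Cmp C (FA G' f') (Cmp C (\<tau> B) u)"
    have "Cmp C (\<tau> (Cod D f)) (Cmp C (FA G f) u) = Cmp C (\<tau> (Cod D f)) (Cmp C (FA G f') u)"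
      using a nat [of f] nat [of f'] by simp
    then have "Cmp C (FA G f) u = Cmp C (FA G f') u"
      by (rule \<tau>.source.target.iso_cancel_left) (use a \<tau>.iso in simp_all)
    then show "f = f'"
      using univ_arrow_eq [OF u] a \<tau>.source.cat_functor_axioms by blast
  qed simp_all
qed

text \<open>Converse of \<open>univ_arrow_fcomp\<close>: composing with \<open>u\<close> identifies
  arrows \<open>Z -> M Y\<close> with arrows \<open>X -> P (M Y)\<close>, so the bijection belonging
  to the composite factors through that of \<open>v\<close>. It removes the equivalences
  \<open>p i\<close> in \<open>univ_v\<close>.\<close>

lemma univ_arrow_cancel:
  assumes "cat_functor D C P" "cat_functor E D M"
    and u: "univ_arrow C D P X Z u" and v: "v \<in> Ar D" "Dom D v = Z" "Cod D v = FO M B"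
    and w: "univ_arrow C E (P \<odot> M) X B (Cmp C (FA P v) u)"
  shows "univ_arrow D E M Z B v"
proof -
  interpret P: cat_functor D C P by fact
  interpret M: cat_functor E D M by fact
  note D [simp] = univ_arrowD [OF u] v univ_arrowD(1) [OF w]
  show ?thesis
  proof (rule univ_arrowI)
    fix Y g assume Y: "Y \<in> Ob E" "g \<in> Ar D" "Dom D g = Z" "Cod D g = FO M Y"
    obtain f where f: "f \<in> Ar E" "Dom E f = B" "Cod E f = Y"
        "Cmp C (FA (P \<odot> M) f) (Cmp C (FA P v) u) = Cmp C (FA P g) u"
      by (rule univ_arrow_ex [OF w, of "Cmp C (FA P g) u" Y]) (use Y in auto)
    have "Cmp D (FA M f) v = g"
      by (rule univ_arrow_eq [OF u]) (use f Y P.cat_functor_axioms in simp_all)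
    then show "\<exists>f. f \<in> Ar E \<and> Dom E f = B \<and> Cod E f = Y \<and> Cmp D (FA M f) v = g"
      using f by blast
  next
    fix f f' assume a: "f \<in> Ar E" "f' \<in> Ar E" "Dom E f = B" "Dom E f' = B" "Cod E f = Cod E f'"
      "Cmp D (FA M f) v = Cmp D (FA M f') v"
    have "Cmp C (FA P (Cmp D (FA M f) v)) u = Cmp C (FA P (Cmp D (FA M f') v)) u"
      using a(6) by simp
    then show "f = f'"
      by (intro univ_arrow_eq [OF w a(1-5)]) (use a(1-5) assms(1,2) in \<open>simp_all add: cat_functor_fcomp [of E D M]\<close>)
  qed simp_all
qed

lemma univ_arrow_iso_source:
  assumes "cat_functor D C G" and u: "univ_arrow C D G X B u" and i: "is_iso C i" "Cod C i = X"
  shows "univ_arrow C D G (Dom C i) B (Cmp C u i)"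
proof -
  interpret G: cat_functor D C G by fact
  note D [simp] = univ_arrowD [OF u]
  have i' [simp]: "i \<in> Ar C" using i G.target.is_iso_Ar by blast
  show ?thesis
  proof (rule univ_arrowI)
    fix Y g assume Y: "Y \<in> Ob D" "g \<in> Ar C" "Dom C g = Dom C i" "Cod C g = FO G Y"
    obtain f where f: "f \<in> Ar D" "Dom D f = B" "Cod D f = Y" "Cmp C (FA G f) u = Cmp C g (inv_ar C i)"
      by (rule univ_arrow_ex [OF u, of "Cmp C g (inv_ar C i)" Y]) (use Y i in auto)
    have "Cmp C (Cmp C (FA G f) u) i = g" unfolding f(4) using Y i by simp
    then show "\<exists>f. f \<in> Ar D \<and> Dom D f = B \<and> Cod D f = Y \<and> Cmp C (FA G f) (Cmp C u i) = g"
      using Y f(1-3) i by (intro exI [of _ f]) simp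
  next
    fix f f' assume a: "f \<in> Ar D" "f' \<in> Ar D" "Dom D f = B" "Dom D f' = B" "Cod D f = Cod D f'"
      "Cmp C (FA G f) (Cmp C u i) = Cmp C (FA G f') (Cmp C u i)"
    have "Cmp C (FA G f) u = Cmp C (FA G f') u"
      by (rule G.target.iso_cancel_right [of _ i]) (use a i in simp_all)
    then show "f = f'"
      using univ_arrow_eq [OF u] a G.cat_functor_axioms by blast
  qed (use i in simp_all)
qed

lemma univ_arrow_iso_target:
  assumes "cat_functor D C G" and u: "univ_arrow C D G X B u" and \<theta>: "is_iso D \<theta>" "Dom D \<theta> = B"
  shows "univ_arrow C D G X (Cod D \<theta>) (Cmp C (FA G \<theta>) u)"
proof -
  interpret G: cat_functor D C G by fact
  note D [simp] = univ_arrowD [OF u]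
  have \<theta>' [simp]: "\<theta> \<in> Ar D" using \<theta> G.source.is_iso_Ar by blast
  show ?thesis
  proof (rule univ_arrowI)
    fix Y g assume Y: "Y \<in> Ob D" "g \<in> Ar C" "Dom C g = X" "Cod C g = FO G Y"
    obtain f where f: "f \<in> Ar D" "Dom D f = B" "Cod D f = Y" "Cmp C (FA G f) u = g"
      by (rule univ_arrow_ex [OF u, of g Y]) (use Y in auto)
    have "Cmp C (FA G (Cmp D f (inv_ar D \<theta>))) (Cmp C (FA G \<theta>) u)
        = Cmp C (FA G (Cmp D (Cmp D f (inv_ar D \<theta>)) \<theta>)) u"
      using f \<theta> by (simp del: G.source.assoc)
    also have "\<dots> = g" using f \<theta> by simp
    finally show "\<exists>f. f \<in> Ar D \<and> Dom D f = Cod D \<theta> \<and> Cod D f = Y \<and>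
        Cmp C (FA G f) (Cmp C (FA G \<theta>) u) = g"
      using f \<theta> by (intro exI [of _ "Cmp D f (inv_ar D \<theta>)"]) simp
  next
    fix f f' assume a: "f \<in> Ar D" "f' \<in> Ar D" "Dom D f = Cod D \<theta>" "Dom D f' = Cod D \<theta>"
      "Cod D f = Cod D f'" "Cmp C (FA G f) (Cmp C (FA G \<theta>) u) = Cmp C (FA G f') (Cmp C (FA G \<theta>) u)"
    have "Cmp D f \<theta> = Cmp D f' \<theta>"
      by (rule univ_arrow_eq [OF u]) (use a \<theta> G.cat_functor_axioms in simp_all)
    then show "f = f'"
      by (rule G.source.iso_cancel_right [of _ \<theta>]) (use a \<theta> in simp_all)
  qed (use \<theta> in simp_all)
qed

lemma univ_arrow_unique:
  assumes G: "cat_functor D C G" and u: "univ_arrow C D G X B u" and u': "univ_arrow C D G X B' u'"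
  obtains \<theta> where "is_iso D \<theta>" "Dom D \<theta> = B" "Cod D \<theta> = B'" "Cmp C (FA G \<theta>) u = u'"
proof -
  interpret G: cat_functor D C G by fact
  note D [simp] = univ_arrowD [OF u] univ_arrowD [OF u']
  obtain f where f: "f \<in> Ar D" "Dom D f = B" "Cod D f = B'" "Cmp C (FA G f) u = u'"
    by (rule univ_arrow_ex [OF u, of u' B']) auto
  obtain g where g: "g \<in> Ar D" "Dom D g = B'" "Cod D g = B" "Cmp C (FA G g) u' = u"
    by (rule univ_arrow_ex [OF u', of u B]) auto
  have "Cmp D g f = Id D B"
    by (rule univ_arrow_eq [OF u]) (use f g G in simp_all)
  moreover have "Cmp D f g = Id D B'"
    by (rule univ_arrow_eq [OF u']) (use f g G in simp_all)
  ultimately have "is_iso D f" using f g by (intro G.source.is_isoI [of f g]) auto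
  then show ?thesis using that f by blast
qed

section \<open>Right mates\<close>

locale mate_square = left: cat_adj A C af + right: cat_adj B D ah + top: cat_functor A B g +
  bottom: cat_functor C D i + cell: cat_trans A D "LF ah \<odot> g" "i \<odot> LF af" \<alpha>
  for A :: "('k, 'oA, 'aA) lcat" and B :: "('k, 'oB, 'aB) lcat" and C :: "('k, 'oC, 'aC) lcat"
    and D :: "('k, 'oD, 'aD) lcat" and g i af ah \<alpha>
begin

abbreviation "mate \<equiv> right_mate B g i af ah \<alpha>"

lemma mate_simps [simp]:
  assumes "Y \<in> Ob C"
  shows "mate Y \<in> Ar B" "Dom B (mate Y) = FO g (FO (RF af) Y)" "Cod B (mate Y) = FO (RF ah) (FO i Y)"
  using assms by (simp_all add: right_mate_def)

lemma nat_trans_mate: "nat_trans C B (g \<odot> RF af) (RF ah \<odot> i) mate"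
proof (rule nat_transI)
  fix f assume f: "f \<in> Ar C"
  have 1: "Cmp B (Unit ah (FO g (FO (RF af) (Cod C f)))) (FA g (FA (RF af) f)) =
      Cmp B (FA (RF ah) (FA (LF ah) (FA g (FA (RF af) f)))) (Unit ah (FO g (FO (RF af) (Dom C f))))"
    using right.unit.naturality [of "FA g (FA (RF af) f)"] f by simp
  have "Cmp D (\<alpha> (FO (RF af) (Cod C f))) (FA (LF ah) (FA g (FA (RF af) f))) =
      Cmp D (FA i (FA (LF af) (FA (RF af) f))) (\<alpha> (FO (RF af) (Dom C f)))"
    using cell.naturality [of "FA (RF af) f"] f by simp
  then have 2: "Cmp B (FA (RF ah) (\<alpha> (FO (RF af) (Cod C f))))
        (FA (RF ah) (FA (LF ah) (FA g (FA (RF af) f)))) =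
      Cmp B (FA (RF ah) (FA i (FA (LF af) (FA (RF af) f)))) (FA (RF ah) (\<alpha> (FO (RF af) (Dom C f))))"
    using f by (simp flip: right.RF.FA_Cmp)
  have "Cmp C (Counit af (Cod C f)) (FA (LF af) (FA (RF af) f)) = Cmp C f (Counit af (Dom C f))"
    using left.counit.naturality [of f] f by simp
  then have 3: "Cmp B (FA (RF ah) (FA i (Counit af (Cod C f))))
        (FA (RF ah) (FA i (FA (LF af) (FA (RF af) f)))) =
      Cmp B (FA (RF ah) (FA i f)) (FA (RF ah) (FA i (Counit af (Dom C f))))"
    using f by (simp flip: right.RF.FA_Cmp bottom.FA_Cmp)
  show "Cmp B (mate (Cod C f)) (FA (g \<odot> RF af) f) = Cmp B (FA (RF ah \<odot> i) f) (mate (Dom C f))"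
    using f by (simp add: right_mate_def 1 right.source.reassoc [OF 2] right.source.reassoc [OF 3])
qed simp_all

text \<open>The mate is the transpose, under \<open>ah\<close>, of \<alpha> followed by the image
  under \<open>i\<close> of the counit of \<open>af\<close>. Transposing back with an arbitrary
  arrow \<open>a\<close> in front keeps the unit of \<open>ah\<close> out of later
  computations.\<close>

lemma transpose_mate:
  assumes Y: "Y \<in> Ob C" and a: "a \<in> Ar B" "Cod B a = FO g (FO (RF af) Y)"
  shows "Cmp D (Counit ah (FO i Y)) (FA (LF ah) (Cmp B (mate Y) a)) =
    Cmp D (FA i (Counit af Y)) (Cmp D (\<alpha> (FO (RF af) Y)) (FA (LF ah) a))"
proof -
  let ?r = "FO (RF af) Y"
  let ?k = "Cmp D (FA i (Counit af Y)) (Cmp D (\<alpha> ?r) (FA (LF ah) a))"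
  have "Cmp B (Unit ah (FO g ?r)) a = Cmp B (FA (RF ah) (FA (LF ah) a)) (Unit ah (Dom B a))"
    using right.unit.naturality [of a] a by simp
  then have "Cmp B (mate Y) a = Cmp B (FA (RF ah) ?k) (Unit ah (Dom B a))"
    using Y a by (simp add: right_mate_def)
  then show ?thesis
    using right.transpose_transpose' [of ?k "Dom B a"] Y a by simp
qed

text \<open>The universality of \<open>\<alpha> \<circ> h(unit)\<close> says that the left mate is invertible, without requiring a left
  adjoint of \<open>i\<close>.\<close>

lemma is_iso_mate_if_univ_arrow:
  assumes "cat_adj B A al" and g: "RF al = g"
    and univ: "\<And>X. X \<in> Ob B \<Longrightarrow> univ_arrow D C i (FO (LF ah) X) (FO (LF af) (FO (LF al) X))
      (Cmp D (\<alpha> (FO (LF al) X)) (FA (LF ah) (Unit al X)))"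
    and Y: "Y \<in> Ob C"
  shows "is_iso B (mate Y)"
proof -
  interpret al: cat_adj B A al by fact
  \<comment> \<open>\<open>T\<close> is transposition along \<open>af\<close>; it is injective,
    since \<open>b\<close> is recovered from \<open>T b\<close> with the unit.\<close>
  define T where "T b = Cmp C (Counit af Y) (FA (LF af) b)" for b
  define u where "u X = Cmp D (\<alpha> (FO (LF al) X)) (FA (LF ah) (Unit al X))" for X
  \<comment> \<open>Every arrow from \<open>X\<close> to the source of the mate is
    \<open>FA g b\<close> after the unit of \<open>al\<close>, for a unique \<open>b\<close>. In
    terms of \<open>b\<close>, postcomposition with the mate becomes composition with the universal
    arrow \<open>u X\<close>, up to transposition along \<open>af\<close> and
    \<open>ah\<close>.\<close>
  have key: "Cmp D (Counit ah (FO i Y)) (FA (LF ah) (Cmp B (mate Y) (Cmp B (FA g b) (Unit al X)))) =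
      Cmp D (FA i (T b)) (u X)"
    if "b \<in> Ar A" "Dom A b = FO (LF al) X" "Cod A b = FO (RF af) Y" "X \<in> Ob B" for b X
    using transpose_mate [OF Y, of "Cmp B (FA g b) (Unit al X)"] that Y
      cell.naturality_assoc [of b "FA (LF ah) (Unit al X)"]
      al.unit.Cod [unfolded g] al.unit.Ar al.unit.Dom
    by (simp add: u_def T_def)
  show ?thesis
  proof (rule right.source.is_iso_if_postcomposition_bijective)
    \<comment> \<open>A right inverse of the mate comes from the identity of its target, whose
      transpose under \<open>ah\<close> is the counit; the counit is factored through the universal
      arrow and transposed back to \<open>a\<close>.\<close>
    let ?X = "FO (RF ah) (FO i Y)"
    have X: "?X \<in> Ob B" using Y by simp
    obtain k where k: "k \<in> Ar C" "Dom C k = FO (LF af) (FO (LF al) ?X)" "Cod C k = Y"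
        "Cmp D (FA i k) (u ?X) = Counit ah (FO i Y)"
      using univ_arrow_ex [OF univ [OF X], of "Counit ah (FO i Y)" Y] Y X unfolding u_def by auto
    define b where "b = Cmp A (FA (RF af) k) (Unit af (FO (LF al) ?X))"
    have b: "b \<in> Ar A" "Dom A b = FO (LF al) ?X" "Cod A b = FO (RF af) Y"
      using k X by (simp_all add: b_def)
    have "T b = k"
      using left.transpose_transpose' [of k "FO (LF al) ?X"] k X by (simp add: b_def T_def)
    define a where "a = Cmp B (FA g b) (Unit al ?X)"
    have a: "a \<in> Ar B" "Dom B a = ?X" "Cod B a = FO g (FO (RF af) Y)"
      using b X al.unit.Cod [unfolded g] by (simp_all add: a_def)
    have 1: "Cmp D (Counit ah (FO i Y)) (FA (LF ah) (Cmp B (mate Y) a)) = Counit ah (FO i Y)"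
      using key [OF b X] k \<open>T b = k\<close> by (simp add: a_def)
    have "Cmp B (FA (RF ah) (Cmp D (Counit ah (FO i Y)) (FA (LF ah) (Cmp B (mate Y) a)))) (Unit ah ?X)
       = Cmp B (mate Y) a"
      using right.transpose_transpose [of "Cmp B (mate Y) a" "FO i Y"] a Y by simp
    then have "Cmp B (mate Y) a = Id B ?X" unfolding 1 using Y by (simp add: right.triangle_RF)
    then show "\<exists>a. a \<in> Ar B \<and> Dom B a = Cod B (mate Y) \<and> Cod B a = Dom B (mate Y) \<and>
        Cmp B (mate Y) a = Id B (Cod B (mate Y))"
      using a Y by auto
  next
    let ?X = "FO g (FO (RF af) Y)"
    fix a a' assume asm: "a \<in> Ar B" "a' \<in> Ar B" "Dom B a = Dom B (mate Y)" "Dom B a' = Dom B (mate Y)"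
      "Cod B a = Dom B (mate Y)" "Cod B a' = Dom B (mate Y)" "Cmp B (mate Y) a = Cmp B (mate Y) a'"
    have X: "?X \<in> Ob B" using Y by simp
    have al: "univ_arrow B A g ?X (FO (LF al) ?X) (Unit al ?X)"
      using al.univ_arrow_unit [OF X] unfolding g .
    obtain b where b: "b \<in> Ar A" "Dom A b = FO (LF al) ?X" "Cod A b = FO (RF af) Y"
        "Cmp B (FA g b) (Unit al ?X) = a"
      using univ_arrow_ex [OF al, of a "FO (RF af) Y"] asm Y by auto
    obtain b' where b': "b' \<in> Ar A" "Dom A b' = FO (LF al) ?X" "Cod A b' = FO (RF af) Y"
        "Cmp B (FA g b') (Unit al ?X) = a'"
      using univ_arrow_ex [OF al, of a' "FO (RF af) Y"] asm Y by auto
    have "Cmp D (FA i (T b)) (u ?X) = Cmp D (FA i (T b')) (u ?X)"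
      using key [OF b(1-3) X] key [OF b'(1-3) X] asm(7) b(4) b'(4) by simp
    then have T: "T b = T b'"
      using b b' Y X
      by (intro univ_arrow_eq [OF univ [OF X]]) (simp_all add: u_def T_def bottom.cat_functor_axioms)
    have "c = Cmp A (FA (RF af) (T c)) (Unit af (Dom A c))" if "c \<in> Ar A" "Cod A c = FO (RF af) Y" for c
      using left.transpose_transpose [OF that(1) Y that(2)] by (simp add: T_def)
    then have "b = b'" using b b' T by metis
    then show "a = a'" using b(4) b'(4) by simp
  qed (use Y in simp)
qed

end

text \<open>Both sides are the same string of units, cells and counits up to sliding
  \<open>Unit ah'\<close> past \<alpha> and past \<open>Counit af\<close>, and \<beta> past
  \<open>Counit af\<close>; \<open>e1\<close>, \<open>e2\<close> and \<open>e3\<close> are these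
  naturality squares.\<close>

lemma right_mate_paste:
  assumes "mate_square A B C D g i af ah \<alpha>" "mate_square C D E G i i' af' ah' \<beta>" and Y: "Y \<in> Ob E"
  shows "right_mate B g i' (adj_comp A E af' af) (adj_comp B G ah' ah)
      (\<lambda>X. Cmp G (\<beta> (FO (LF af) X)) (FA (LF ah') (\<alpha> X))) Y =
    Cmp B (FA (RF ah) (right_mate D i i' af' ah' \<beta> Y)) (right_mate B g i af ah \<alpha> (FO (RF af') Y))"
proof -
  interpret p: mate_square A B C D g i af ah \<alpha> by fact
  interpret q: mate_square C D E G i i' af' ah' \<beta> by fact
  define W Z where "W = FO (RF af') Y" and "Z = FO (RF af) W"
  have W: "W \<in> Ob C" and Z: "Z \<in> Ob A" using Y by (simp_all add: W_def Z_def)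
  have W': "FO (RF af') Y = W" and Z': "FO (RF af) W = Z" by (simp_all add: W_def Z_def)
  note [simp] = Y W Z W' Z'
  have e1: "Cmp D (FA (RF ah') (FA (LF ah') (\<alpha> Z))) (Unit ah' (FO (LF ah) (FO g Z))) =
      Cmp D (Unit ah' (FO i (FO (LF af) Z))) (\<alpha> Z)"
    using q.right.unit.naturality [of "\<alpha> Z"] by simp
  have e2: "Cmp D (Unit ah' (FO i W)) (FA i (Counit af W)) =
      Cmp D (FA (RF ah') (FA (LF ah') (FA i (Counit af W)))) (Unit ah' (FO i (FO (LF af) Z)))"
    using q.right.unit.naturality [of "FA i (Counit af W)"] by simp
  have "Cmp G (\<beta> W) (FA (LF ah') (FA i (Counit af W))) =
      Cmp G (FA i' (FA (LF af') (Counit af W))) (\<beta> (FO (LF af) Z))"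
    using q.cell.naturality [of "Counit af W"] by simp
  then have e3: "Cmp D (FA (RF ah') (\<beta> W)) (FA (RF ah') (FA (LF ah') (FA i (Counit af W)))) =
      Cmp D (FA (RF ah') (FA i' (FA (LF af') (Counit af W)))) (FA (RF ah') (\<beta> (FO (LF af) Z)))"
    by (simp flip: q.right.RF.FA_Cmp)
  have key: "Cmp D (FA (RF ah') (FA i' (FA (LF af') (Counit af W))))
        (Cmp D (FA (RF ah') (\<beta> (FO (LF af) Z)))
          (Cmp D (FA (RF ah') (FA (LF ah') (\<alpha> Z))) (Unit ah' (FO (LF ah) (FO g Z))))) =
      Cmp D (FA (RF ah') (\<beta> W)) (Cmp D (Unit ah' (FO i W)) (Cmp D (FA i (Counit af W)) (\<alpha> Z)))"
    by (simp add: e1 p.right.target.reassoc [OF e2] p.right.target.reassoc [OF e3])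
  have "Cmp B (FA (RF ah) (FA (RF ah') (FA i' (FA (LF af') (Counit af W)))))
        (Cmp B (FA (RF ah) (FA (RF ah') (\<beta> (FO (LF af) Z))))
          (Cmp B (FA (RF ah) (FA (RF ah') (FA (LF ah') (\<alpha> Z))))
            (FA (RF ah) (Unit ah' (FO (LF ah) (FO g Z)))))) =
      Cmp B (FA (RF ah) (FA (RF ah') (\<beta> W))) (Cmp B (FA (RF ah) (Unit ah' (FO i W)))
        (Cmp B (FA (RF ah) (FA i (Counit af W))) (FA (RF ah) (\<alpha> Z))))"
    using arg_cong [OF key, of "FA (RF ah)"] by simp
  from arg_cong [OF this, of "\<lambda>x. Cmp B (FA (RF ah) (FA (RF ah') (FA i' (Counit af' Y))))
      (Cmp B x (Unit ah (FO g Z)))"]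
  show ?thesis by (simp add: right_mate_def adj_comp_def)
qed

section \<open>Universal arrows along an extension of a left adjoint\<close>

text \<open>In the application \<open>c\<close> and \<open>d\<close> are the images of
  \<open>c_ar\<close> and \<open>cbar_ar\<close>, \<open>M\<close> is multiplication on both
  factors, \<open>D\<close> its left adjoint with unit \<open>u\<close> and counit \<open>k\<close>,
  and \<open>L\<close> the extension of \<open>d \<odot> D\<close> along \<open>c\<close>. The
  equations \<open>\<eta>_c\<close> and \<open>\<epsilon>_d\<close> fix the intended unit and counit
  of \<open>L \<stileturn> n\<close> on external products only; \<open>faithful\<close> says that
  natural endomorphisms of \<open>n\<close> are determined there.\<close>

locale extended_left_adjoint = c: cat_functor P C c + d: cat_functor Q E d + M: cat_functor Q P M +
  D: cat_functor P Q D + n: cat_functor E C n + L: cat_functor C E L +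
  u: cat_trans P P id_fctr "M \<odot> D" u + \<sigma>: cat_iso Q C "c \<odot> M" "n \<odot> d" \<sigma> +
  t: cat_iso P E "L \<odot> c" "d \<odot> D" t + \<eta>: cat_trans C C id_fctr "n \<odot> L" \<eta> +
  \<epsilon>: cat_trans E E "L \<odot> n" id_fctr \<epsilon>
  for P :: "('k, 'oP, 'aP) lcat" and C :: "('k, 'oC, 'aC) lcat" and c
    and Q :: "('k, 'oQ, 'aQ) lcat" and E :: "('k, 'oE, 'aE) lcat" and d M D n L u \<sigma> t \<eta> \<epsilon> +
  fixes k :: "'oQ \<Rightarrow> 'aQ"
  assumes univ_u: "A \<in> Ob P \<Longrightarrow> univ_arrow P Q M A (FO D A) (u A)"
    and k [simp]: "B \<in> Ob Q \<Longrightarrow> k B \<in> Ar Q" "B \<in> Ob Q \<Longrightarrow> Dom Q (k B) = FO D (FO M B)"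
      "B \<in> Ob Q \<Longrightarrow> Cod Q (k B) = B"
    and k_u: "B \<in> Ob Q \<Longrightarrow> Cmp P (FA M (k B)) (u (FO M B)) = Id P (FO M B)"
    and \<eta>_c: "A \<in> Ob P \<Longrightarrow>
      \<eta> (FO c A) = Cmp C (FA n (inv_ar E (t A))) (Cmp C (\<sigma> (FO D A)) (FA c (u A)))"
    and \<epsilon>_d: "B \<in> Ob Q \<Longrightarrow>
      \<epsilon> (FO d B) = Cmp E (FA d (k B)) (Cmp E (t (FO M B)) (FA L (inv_ar C (\<sigma> B))))"
    and faithful: "\<lbrakk>nat_trans E C n n s; nat_trans E C n n s'; \<And>B. B \<in> Ob Q \<Longrightarrow> s (FO d B) = s' (FO d B);
      Y \<in> Ob E\<rbrakk> \<Longrightarrow> s Y = s' Y"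
begin

lemmas iso_simps [simp] = \<sigma>.iso t.iso

text \<open>By universality of \<open>u A\<close> it suffices to compare after applying
  \<open>M\<close> and composing with \<open>u A\<close>; there naturality of \<open>u\<close> and
  the triangle identity \<open>k_u\<close> finish the argument.\<close>

lemma k_D:
  assumes A: "A \<in> Ob P"
  shows "Cmp Q (k (FO D A)) (FA D (u A)) = Id Q (FO D A)"
proof (rule univ_arrow_eq [OF univ_u [OF A]])
  have "Cmp P (FA M (FA D (u A))) (u A) = Cmp P (u (FO M (FO D A))) (u A)"
    using u.naturality [of "u A"] A by simp
  then show "Cmp P (FA M (Cmp Q (k (FO D A)) (FA D (u A)))) (u A) =
      Cmp P (FA M (Id Q (FO D A))) (u A)"
    using A c.source.reassoc1 [OF k_u [of "FO D A"], of "u A"] by simp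
qed (use A M.cat_functor_axioms in simp_all)

text \<open>Both sides are natural endomorphisms of \<open>n\<close>, so it suffices to take
  \<open>Y = d B\<close>. After composing with the isomorphism \<open>\<sigma> B\<close>, naturality
  moves \<eta> to \<open>c (M B)\<close>, the isomorphisms \<open>t\<close> and \<sigma> meet their
  inverses, and \<open>k_u\<close> remains.\<close>

lemma triangle_n:
  assumes Y: "Y \<in> Ob E"
  shows "Cmp C (FA n (\<epsilon> Y)) (\<eta> (FO n Y)) = Id C (FO n Y)"
proof -
  let ?s = "\<lambda>Y. Cmp C (FA n (\<epsilon> Y)) (\<eta> (FO n Y))"
  show ?thesis
  proof (rule faithful [of ?s "\<lambda>Y. Id C (FO n Y)"])
    show "nat_trans E C n n ?s"
    proof (rule nat_transI)
      fix f assume f: "f \<in> Ar E"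
      have 1: "Cmp C (\<eta> (FO n (Cod E f))) (FA n f) = Cmp C (FA n (FA L (FA n f))) (\<eta> (FO n (Dom E f)))"
        using \<eta>.naturality [of "FA n f"] f by simp
      have "Cmp E (\<epsilon> (Cod E f)) (FA L (FA n f)) = Cmp E f (\<epsilon> (Dom E f))"
        using \<epsilon>.naturality [of f] f by simp
      then have 2: "Cmp C (FA n (\<epsilon> (Cod E f))) (FA n (FA L (FA n f))) = Cmp C (FA n f) (FA n (\<epsilon> (Dom E f)))"
        using f by (simp flip: n.FA_Cmp)
      show "Cmp C (?s (Cod E f)) (FA n f) = Cmp C (FA n f) (?s (Dom E f))"
        using f by (simp add: 1 c.target.reassoc [OF 2])
    qed simp_all
    show "nat_trans E C n n (\<lambda>Y. Id C (FO n Y))"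
      by (rule nat_transI) simp_all
  next
    fix B assume B: "B \<in> Ob Q"
    have 1: "Cmp C (\<eta> (FO n (FO d B))) (\<sigma> B) = Cmp C (FA n (FA L (\<sigma> B))) (\<eta> (FO c (FO M B)))"
      using \<eta>.naturality [of "\<sigma> B"] B by simp
    have 2: "Cmp C (FA n (FA d (k B))) (\<sigma> (FO D (FO M B))) = Cmp C (\<sigma> B) (FA c (FA M (k B)))"
      using \<sigma>.naturality [of "k B"] B by simp
    have 3: "Cmp C (FA c (FA M (k B))) (FA c (u (FO M B))) = Id C (FO c (FO M B))"
      using k_u [OF B] B by (simp flip: c.FA_Cmp)
    have 4: "Cmp C (FA n (FA L (inv_ar C (\<sigma> B)))) (FA n (FA L (\<sigma> B))) = Id C (FO n (FO L (FO c (FO M B))))"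
      using B by (simp flip: n.FA_Cmp L.FA_Cmp)
    have 5: "Cmp C (FA n (t (FO M B))) (FA n (inv_ar E (t (FO M B)))) = Id C (FO n (FO d (FO D (FO M B))))"
      using B by (simp flip: n.FA_Cmp)
    have "Cmp C (?s (FO d B)) (\<sigma> B) = Cmp C (FA n (FA d (k B))) (Cmp C (FA n (t (FO M B)))
        (Cmp C (FA n (FA L (inv_ar C (\<sigma> B)))) (Cmp C (FA n (FA L (\<sigma> B))) (\<eta> (FO c (FO M B))))))"
      using B by (simp add: 1 \<epsilon>_d)
    also have "\<dots> = Cmp C (FA n (FA d (k B))) (Cmp C (\<sigma> (FO D (FO M B))) (FA c (u (FO M B))))"
      using B by (simp add: \<eta>_c c.target.reassoc1 [OF 4] c.target.reassoc1 [OF 5])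
    also have "\<dots> = \<sigma> B"
      using B by (simp add: c.target.reassoc [OF 2] 3)
    finally have "Cmp C (?s (FO d B)) (\<sigma> B) = Cmp C (Id C (FO n (FO d B))) (\<sigma> B)"
      using B by simp
    then show "?s (FO d B) = Id C (FO n (FO d B))"
      by (rule c.target.iso_cancel_right) (use B in simp_all)
  qed (use Y in simp)
qed

text \<open>At an object \<open>c A\<close> the identity can be computed: after composing with
  \<open>t A\<close>, naturality of \<epsilon> moves it to \<open>d (D A)\<close>, where the
  prescribed values reduce to \<open>k_D\<close>.\<close>

lemma triangle_L:
  assumes A: "A \<in> Ob P"
  shows "Cmp E (\<epsilon> (FO L (FO c A))) (FA L (\<eta> (FO c A))) = Id E (FO L (FO c A))"
proof -
  have 1: "Cmp E (\<epsilon> (FO d (FO D A))) (FA L (FA n (t A))) = Cmp E (t A) (\<epsilon> (FO L (FO c A)))"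
    using \<epsilon>.naturality [of "t A"] A by simp
  have 2: "Cmp E (FA L (FA n (t A))) (FA L (FA n (inv_ar E (t A)))) = Id E (FO L (FO n (FO d (FO D A))))"
    using A by (simp flip: n.FA_Cmp L.FA_Cmp)
  have 3: "Cmp E (FA L (inv_ar C (\<sigma> (FO D A)))) (FA L (\<sigma> (FO D A))) = Id E (FO L (FO c (FO M (FO D A))))"
    using A by (simp flip: L.FA_Cmp)
  have 4: "Cmp E (t (FO M (FO D A))) (FA L (FA c (u A))) = Cmp E (FA d (FA D (u A))) (t A)"
    using t.naturality [of "u A"] A by simp
  have 5: "Cmp E (FA d (k (FO D A))) (FA d (FA D (u A))) = Id E (FO d (FO D A))"
    using k_D [OF A] A by (simp flip: d.FA_Cmp)
  have "Cmp E (t A) (Cmp E (\<epsilon> (FO L (FO c A))) (FA L (\<eta> (FO c A)))) =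
      Cmp E (\<epsilon> (FO d (FO D A))) (Cmp E (FA L (FA n (t A))) (FA L (\<eta> (FO c A))))"
    using A by (simp add: d.target.reassoc [OF 1])
  also have "\<dots> = Cmp E (\<epsilon> (FO d (FO D A))) (Cmp E (FA L (\<sigma> (FO D A))) (FA L (FA c (u A))))"
    using A by (simp add: \<eta>_c d.target.reassoc1 [OF 2])
  also have "\<dots> = t A"
    using A by (simp add: \<epsilon>_d d.target.reassoc1 [OF 3] 4 d.target.reassoc1 [OF 5])
  finally have "Cmp E (t A) (Cmp E (\<epsilon> (FO L (FO c A))) (FA L (\<eta> (FO c A)))) =
      Cmp E (t A) (Id E (FO L (FO c A)))"
    using A by simp
  then show ?thesis
    by (rule d.target.iso_cancel_left) (use A in simp_all)
qed

text \<open>Existence uses \<open>triangle_n\<close> at the arbitrary target \<open>Y\<close>,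
  uniqueness uses \<open>triangle_L\<close> at \<open>A\<close> alone.\<close>

lemma univ_arrow_\<eta>:
  assumes A: "A \<in> Ob P"
  shows "univ_arrow C E n (FO c A) (FO L (FO c A)) (\<eta> (FO c A))"
proof (rule univ_arrowI)
  fix Y g assume Y: "Y \<in> Ob E" "g \<in> Ar C" "Dom C g = FO c A" "Cod C g = FO n Y"
  have "Cmp C (\<eta> (FO n Y)) g = Cmp C (FA n (FA L g)) (\<eta> (FO c A))"
    using \<eta>.naturality [of g] Y by simp
  then have "Cmp C (FA n (Cmp E (\<epsilon> Y) (FA L g))) (\<eta> (FO c A)) = g"
    using Y A c.target.reassoc1 [OF triangle_n [of Y], of g] by simp
  then show "\<exists>f. f \<in> Ar E \<and> Dom E f = FO L (FO c A) \<and> Cod E f = Y \<and> Cmp C (FA n f) (\<eta> (FO c A)) = g"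
    using Y by (intro exI [of _ "Cmp E (\<epsilon> Y) (FA L g)"]) simp
next
  have *: "f = Cmp E (\<epsilon> (Cod E f)) (FA L (Cmp C (FA n f) (\<eta> (FO c A))))"
    if "f \<in> Ar E" "Dom E f = FO L (FO c A)" for f
    using \<epsilon>.naturality_assoc [of f "FA L (\<eta> (FO c A))"] that A by (simp add: triangle_L)
  fix f f' assume "f \<in> Ar E" "f' \<in> Ar E" "Dom E f = FO L (FO c A)" "Dom E f' = FO L (FO c A)"
    "Cod E f = Cod E f'" "Cmp C (FA n f) (\<eta> (FO c A)) = Cmp C (FA n f') (\<eta> (FO c A))"
  then show "f = f'" using * by metis
qed (use A in simp_all)

text \<open>The unit \<open>u A\<close> and the given \<open>v\<close> differ by an isomorphism
  \<theta> of their targets. Composing \<open>\<eta> (c A)\<close> with the image under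
  \<open>n\<close> of the isomorphism \<open>d \<theta>\<close> after \<open>t A\<close> yields the
  stated arrow, and this preserves universality.\<close>

lemma univ_arrow_extension:
  assumes A: "A \<in> Ob P" and v: "univ_arrow P Q M A B v"
  shows "univ_arrow C E n (FO c A) (FO d B) (Cmp C (\<sigma> B) (FA c v))"
proof -
  obtain \<theta> where \<theta>: "is_iso Q \<theta>" "Dom Q \<theta> = FO D A" "Cod Q \<theta> = B" "Cmp P (FA M \<theta>) (u A) = v"
    using univ_arrow_unique [OF M.cat_functor_axioms univ_u [OF A] v] by blast
  note B [simp] = univ_arrowD(1) [OF v]
  have [simp]: "\<theta> \<in> Ar Q" using \<theta>(1) d.source.is_iso_Ar by blast
  have iso: "is_iso E (Cmp E (FA d \<theta>) (t A))"
    using A \<theta> by (intro d.target.is_iso_Cmp d.is_iso_FA) simp_all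
  have 1: "Cmp C (FA n (t A)) (FA n (inv_ar E (t A))) = Id C (FO n (FO d (FO D A)))"
    using A by (simp flip: n.FA_Cmp)
  have 2: "Cmp C (FA n (FA d \<theta>)) (\<sigma> (FO D A)) = Cmp C (\<sigma> B) (FA c (FA M \<theta>))"
    using \<sigma>.naturality [of \<theta>] \<theta> by simp
  have "Cmp C (FA n (Cmp E (FA d \<theta>) (t A))) (\<eta> (FO c A)) = Cmp C (\<sigma> B) (FA c v)"
    using A \<theta>(2,3) by (simp add: \<eta>_c c.target.reassoc1 [OF 1] c.target.reassoc [OF 2] flip: \<theta>(4))
  then show ?thesis
    using univ_arrow_iso_target [OF n.cat_functor_axioms univ_arrow_\<eta> [OF A] iso] A \<theta> by simp
qed

end

section \<open>Products and total categories\<close>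

lemma prodc_simps [simp]:
  "Ob (prodc I C) = (\<Pi>\<^sub>E i\<in>I. Ob (C i))" "Ar (prodc I C) = (\<Pi>\<^sub>E i\<in>I. Ar (C i))"
  "Dom (prodc I C) f = (\<lambda>i\<in>I. Dom (C i) (f i))" "Cod (prodc I C) f = (\<lambda>i\<in>I. Cod (C i) (f i))"
  "Id (prodc I C) X = (\<lambda>i\<in>I. Id (C i) (X i))"
  "Cmp (prodc I C) g f = (\<lambda>i\<in>I. Cmp (C i) (g i) (f i))"
  by (simp_all add: prodc_def)

lemma restrict_eq_iff: "restrict u I = restrict v I \<longleftrightarrow> (\<forall>i\<in>I. u i = v i)"
  by (metis restrict_apply' restrict_ext)

lemma restrict_eq_extensional_iff: "v \<in> extensional I \<Longrightarrow> restrict u I = v \<longleftrightarrow> (\<forall>i\<in>I. u i = v i)"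
  by (metis extensional_restrict restrict_eq_iff)

lemma category_prodc:
  assumes "\<And>i. i \<in> I \<Longrightarrow> category (C i)"
  shows "category (prodc I C)"
proof -
  note rules = category.Dom_Ob category.Cod_Ob category.Id_Ar category.Dom_Id category.Cod_Id
    category.Cmp_Ar category.Dom_Cmp category.Cod_Cmp category.right_unit category.left_unit
    category.assoc
  show ?thesis
    by unfold_locales
      (simp_all add: PiE_iff rules [OF assms] restrict_eq_iff restrict_eq_extensional_iff)
qed

definition prodf :: "'i set \<Rightarrow> ('i \<Rightarrow> ('o1, 'a1, 'o2, 'a2) fctr)
    \<Rightarrow> ('i \<Rightarrow> 'o1, 'i \<Rightarrow> 'a1, 'i \<Rightarrow> 'o2, 'i \<Rightarrow> 'a2) fctr" where
  "prodf I F = \<lparr>FO = (\<lambda>X. \<lambda>i\<in>I. FO (F i) (X i)), FA = (\<lambda>f. \<lambda>i\<in>I. FA (F i) (f i))\<rparr>"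

lemma prodf_simps [simp]:
  "FO (prodf I F) X = (\<lambda>i\<in>I. FO (F i) (X i))" "FA (prodf I F) f = (\<lambda>i\<in>I. FA (F i) (f i))"
  by (simp_all add: prodf_def)

lemma cat_functor_prodf:
  assumes F: "\<And>i. i \<in> I \<Longrightarrow> cat_functor (C i) (D i) (F i)"
  shows "cat_functor (prodc I C) (prodc I D) (prodf I F)"
proof -
  have cats: "category (prodc I C)" "category (prodc I D)"
    using F by (auto intro!: category_prodc simp: cat_functor_def)
  note rules = cat_functor.FO_Ob [OF F] cat_functor.FA_Id [OF F] cat_functor.FA_Ar [OF F]
    cat_functor.Dom_FA [OF F] cat_functor.Cod_FA [OF F] cat_functor.FA_Cmp [OF F]
  have "is_functor (prodc I C) (prodc I D) (prodf I F)"
    unfolding is_functor_def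
  proof (intro conjI ballI impI)
    fix f g assume "f \<in> Ar (prodc I C)" "g \<in> Ar (prodc I C)" "Cod (prodc I C) f = Dom (prodc I C) g"
    then show "FA (prodf I F) (Cmp (prodc I C) g f) =
        Cmp (prodc I D) (FA (prodf I F) g) (FA (prodf I F) f)"
      by (simp add: rules restrict_eq_iff PiE_iff)
  qed (auto simp: hom_def rules restrict_eq_iff PiE_iff)
  then show ?thesis using cats by (simp add: cat_functor_def cat_functor_axioms_def)
qed

lemma nat_trans_prodc:
  assumes "\<And>i. i \<in> I \<Longrightarrow> nat_trans (C i) (D i) (F i) (G i) (t i)"
  shows "nat_trans (prodc I C) (prodc I D) (prodf I F) (prodf I G) (\<lambda>X. \<lambda>i\<in>I. t i (X i))"
  using assms by (simp add: nat_trans_def hom_def restrict_eq_iff PiE_iff)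

lemma univ_arrow_prodc:
  assumes G: "\<And>i. i \<in> I \<Longrightarrow> cat_functor (D i) (C i) (G i)"
    and univ: "\<And>i. i \<in> I \<Longrightarrow> univ_arrow (C i) (D i) (G i) (X i) (B i) (u i)"
  shows "univ_arrow (prodc I C) (prodc I D) (prodf I G) (\<lambda>i\<in>I. X i) (\<lambda>i\<in>I. B i) (\<lambda>i\<in>I. u i)"
proof (rule univ_arrowI)
  note D = univ_arrowD [OF univ]
  show "(\<lambda>i\<in>I. B i) \<in> Ob (prodc I D)" "(\<lambda>i\<in>I. u i) \<in> Ar (prodc I C)"
    "Dom (prodc I C) (\<lambda>i\<in>I. u i) = (\<lambda>i\<in>I. X i)"
    "Cod (prodc I C) (\<lambda>i\<in>I. u i) = FO (prodf I G) (\<lambda>i\<in>I. B i)"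
    using D by (auto intro!: ext)
next
  fix Y g assume Y: "Y \<in> Ob (prodc I D)" and g: "g \<in> Ar (prodc I C)"
    "Dom (prodc I C) g = (\<lambda>i\<in>I. X i)" "Cod (prodc I C) g = FO (prodf I G) Y"
  have "\<exists>f. f \<in> Ar (D i) \<and> Dom (D i) f = B i \<and> Cod (D i) f = Y i \<and> Cmp (C i) (FA (G i) f) (u i) = g i"
    if i: "i \<in> I" for i
  proof (rule univ_arrow_ex [OF univ [OF i], of "g i" "Y i"])
    show "g i \<in> Ar (C i)" "Y i \<in> Ob (D i)" using Y g i by auto
    show "Dom (C i) (g i) = X i" "Cod (C i) (g i) = FO (G i) (Y i)"
      using fun_cong [OF g(2), of i] fun_cong [OF g(3), of i] i by auto
  qed blast
  then obtain f where f: "\<And>i. i \<in> I \<Longrightarrow> f i \<in> Ar (D i) \<and> Dom (D i) (f i) = B i \<and>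
      Cod (D i) (f i) = Y i \<and> Cmp (C i) (FA (G i) (f i)) (u i) = g i"
    by metis
  have "restrict f I \<in> Ar (prodc I D) \<and> Dom (prodc I D) (restrict f I) = restrict B I \<and>
      Cod (prodc I D) (restrict f I) = Y \<and>
      Cmp (prodc I C) (FA (prodf I G) (restrict f I)) (restrict u I) = g"
    using f Y g(1) by (auto intro!: ext simp: PiE_iff extensional_def)
  then show "\<exists>f. f \<in> Ar (prodc I D) \<and> Dom (prodc I D) f = restrict B I \<and> Cod (prodc I D) f = Y \<and>
      Cmp (prodc I C) (FA (prodf I G) f) (restrict u I) = g"
    by blast
next
  fix f f' assume a: "f \<in> Ar (prodc I D)" "f' \<in> Ar (prodc I D)" "Dom (prodc I D) f = restrict B I"
    "Dom (prodc I D) f' = restrict B I" "Cod (prodc I D) f = Cod (prodc I D) f'"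
    "Cmp (prodc I C) (FA (prodf I G) f) (restrict u I) =
      Cmp (prodc I C) (FA (prodf I G) f') (restrict u I)"
  have "f i = f' i" if i: "i \<in> I" for i
  proof (rule univ_arrow_eq [OF univ [OF i] _ _ _ _ _ _ G [OF i]])
    show "f i \<in> Ar (D i)" "f' i \<in> Ar (D i)" using a(1,2) i by auto
    show "Dom (D i) (f i) = B i" "Dom (D i) (f' i) = B i" "Cod (D i) (f i) = Cod (D i) (f' i)"
      "Cmp (C i) (FA (G i) (f i)) (u i) = Cmp (C i) (FA (G i) (f' i)) (u i)"
      using fun_cong [OF a(3), of i] fun_cong [OF a(4), of i] fun_cong [OF a(5), of i]
        fun_cong [OF a(6), of i] i by auto
  qed
  then show "f = f'" using a(1,2) by (auto intro: PiE_ext)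
qed

section \<open>Total categories of graded categories\<close>

lemma tot_simps [simp]:
  "X \<in> Ob (tot C) \<longleftrightarrow> (\<forall>n. X n \<in> Ob (C n)) \<and> finite (supp C X)"
  "f \<in> Ar (tot C) \<longleftrightarrow> (\<forall>n. f n \<in> Ar (C n)) \<and> (\<lambda>n. Dom (C n) (f n)) \<in> Ob (tot C) \<and>
     (\<lambda>n. Cod (C n) (f n)) \<in> Ob (tot C)"
  "Dom (tot C) f = (\<lambda>n. Dom (C n) (f n))" "Cod (tot C) f = (\<lambda>n. Cod (C n) (f n))"
  "Id (tot C) X = (\<lambda>n. Id (C n) (X n))" "Cmp (tot C) g f = (\<lambda>n. Cmp (C n) (g n) (f n))"
  "Zero (tot C) X Y = (\<lambda>n. Zero (C n) (X n) (Y n))" "Add (tot C) f g = (\<lambda>n. Add (C n) (f n) (g n))"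
  "Scl (tot C) a f = (\<lambda>n. Scl (C n) a (f n))"
  by (simp_all add: tot_def Let_def)

declare tot_simps [simp del]

lemma category_tot:
  assumes "\<And>n. category (C n)"
  shows "category (tot C)"
proof -
  note rules = category.Dom_Ob category.Cod_Ob category.Id_Ar category.Dom_Id category.Cod_Id
    category.Cmp_Ar category.Dom_Cmp category.Cod_Cmp category.right_unit category.left_unit
    category.assoc
  show ?thesis
    by unfold_locales (simp_all add: rules [OF assms] fun_eq_iff tot_simps)
qed

section \<open>Degrees\<close>

context linear_category
begin

interpretation category C by (rule is_category)

lemma hom_Ob: "f \<in> hom C X Y \<Longrightarrow> X \<in> Ob C" "f \<in> hom C X Y \<Longrightarrow> Y \<in> Ob C"
  by (auto simp: hom_def)

lemma Scl_0: "f \<in> hom C X Y \<Longrightarrow> Scl C 0 f = Zero C X Y"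
proof -
  assume f: "f \<in> hom C X Y"
  let ?z = "Scl C 0 f"
  have z: "?z \<in> hom C X Y" using f by (rule Scl_in)
  have "X \<in> Ob C" "Y \<in> Ob C" using f by (auto simp: hom_def)
  then have Z: "Zero C X Y \<in> hom C X Y" by (rule Zero_in)
  obtain w where w: "w \<in> hom C X Y" "Add C ?z w = Zero C X Y" using Add_inverse [OF z] by blast
  have zz: "Add C ?z ?z = ?z" using Scl_plus [OF f, of 0 0] by simp
  have "?z = Add C ?z (Add C ?z w)" using Add_Zero [OF z] w by simp
  also have "\<dots> = Add C (Add C ?z ?z) w" using Add_assoc [OF z z w(1)] by simp
  also have "\<dots> = Zero C X Y" using zz w by simp
  finally show ?thesis .
qed

lemma Zero_Cmp:
  assumes "f \<in> hom C X Y" "Z \<in> Ob C"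
  shows "Cmp C (Zero C Y Z) f = Zero C X Z"
proof -
  have z: "Zero C Y Z \<in> hom C Y Z" using assms by (intro Zero_in) (auto simp: hom_def)
  show ?thesis
    using Cmp_Scl_left [OF assms(1) z, of 0] Scl_0 [OF z] Scl_0 [OF Cmp_in [OF assms(1) z]] by simp
qed

lemma Cmp_Zero:
  assumes "f \<in> hom C Y Z" "X \<in> Ob C"
  shows "Cmp C f (Zero C X Y) = Zero C X Z"
proof -
  have z: "Zero C X Y \<in> hom C X Y" using assms by (intro Zero_in) (auto simp: hom_def)
  show ?thesis
    using Cmp_Scl_right [OF z assms(1), of 0] Scl_0 [OF z] Scl_0 [OF Cmp_in [OF z assms(1)]] by simp
qed

lemma zero_object_iff_Id: "zero_object C X \<longleftrightarrow> X \<in> Ob C \<and> Id C X = Zero C X X"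
proof
  assume "zero_object C X"
  then show "X \<in> Ob C \<and> Id C X = Zero C X X"
    unfolding zero_object_def using Id_in Zero_in by blast
next
  assume X: "X \<in> Ob C \<and> Id C X = Zero C X X"
  have "f = Zero C Y X" if "f \<in> hom C Y X" for f Y
    using Id_Cmp [OF that] Zero_Cmp [OF that, of X] X by simp
  moreover have "f = Zero C X Y" if "f \<in> hom C X Y" for f Y
    using Cmp_Id [OF that] Cmp_Zero [OF that, of X] X by simp
  ultimately show "zero_object C X"
    unfolding zero_object_def using X Zero_in by metis
qed

lemma factors_through_zero_object:
  assumes "zero_object C Z" "f \<in> hom C X Z" "g \<in> hom C Z Y"
  shows "Cmp C g f = Zero C X Y"
proof -
  have XY: "X \<in> Ob C" "Y \<in> Ob C" "Z \<in> Ob C" using assms by (auto simp: hom_def zero_object_def)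
  then have "f = Zero C X Z" using assms Zero_in unfolding zero_object_def by blast
  then show ?thesis using Cmp_Zero [OF assms(3)] XY by simp
qed

end

section \<open>Zero objects of 2-vector spaces\<close>

lemma module_fscale: "module (fscale :: 'k::field \<Rightarrow> _)"
  by unfold_locales (auto simp: fscale_def fun_eq_iff algebra_simps)

text \<open>Zero objects will fill the remaining degrees of homogeneous objects. By essential
  surjectivity some \<open>X\<close> has image isomorphic to the family of zero spaces; then all
  spaces \<open>F X i\<close> are trivial, any two endomorphisms of \<open>F X\<close> agree, and
  faithfulness of \<open>F\<close> makes the identity of \<open>X\<close> zero.\<close>

lemma two_vect_zero_object:
  assumes C: "two_vect C"
  obtains Z where "zero_object C Z"
proof -
  interpret linear_category C using C by (simp add: two_vect_def)
  interpret category C by (rule is_category)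
  obtain r :: nat and F where F: "linear_equivalence C (prodc {..<r} (\<lambda>_. Vect)) F"
    using C by (auto simp: two_vect_def)
  let ?D = "prodc {..<r} (\<lambda>_. Vect)"
  define Z :: "nat \<Rightarrow> (nat \<Rightarrow> 'a) set" where "Z = (\<lambda>i\<in>{..<r}. {0})"
  have span: "module.span fscale {} = {0 :: nat \<Rightarrow> 'a}"
    by (rule module.span_empty [OF module_fscale])
  have "Z \<in> Ob ?D"
    unfolding Z_def by (auto simp: Vect_def span intro!: exI [of _ "{}"])
  then obtain X f where X: "X \<in> Ob C" and f: "f \<in> hom ?D (FO F X) Z" "is_iso ?D f"
    using F unfolding linear_equivalence_def by blast
  obtain g where g: "g \<in> hom ?D Z (FO F X)" "Cmp ?D g f = Id ?D (FO F X)"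
    using f by (auto simp: is_iso_def is_inverse_def hom_def)
  \<comment> \<open>The identity of \<open>F X i\<close> factors through the zero space.\<close>
  have trivial: "FO F X i \<subseteq> {0}" if i: "i < r" for i
  proof
    fix x assume x: "x \<in> FO F X i"
    have fi: "f i \<in> Ar Vect" "Dom Vect (f i) = FO F X i" "Cod Vect (f i) = {0}"
      using f(1) i by (auto simp: hom_def Z_def dest!: fun_cong [of _ _ i])
    have gi: "g i \<in> Ar Vect" "Dom Vect (g i) = {0}" "Cod Vect (g i) = FO F X i"
      using g(1) i by (auto simp: hom_def Z_def dest!: fun_cong [of _ _ i])
    have gf: "Cmp Vect (g i) (f i) = Id Vect (FO F X i)"
      using fun_cong [OF g(2), of i] i by simp
    obtain p where p: "f i = (FO F X i, p, {0})" "p \<in> FO F X i \<rightarrow>\<^sub>E {0}"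
      using fi by (auto simp: Vect_def)
    obtain q where q: "g i = ({0}, q, FO F X i)" "\<forall>x\<in>{0}. \<forall>y\<in>{0}. q (x + y) = q x + q y"
      using gi by (auto simp: Vect_def)
    have "compose (FO F X i) q p = (\<lambda>x\<in>FO F X i. x)"
      using gf unfolding p(1) q(1) by (simp add: Vect_def)
    then have "q (p x) = x" using x by (auto simp: compose_def dest!: fun_cong [of _ _ x])
    moreover have "p x = 0" using p(2) x by auto
    moreover have "q 0 = 0" using q(2) by simp
    ultimately show "x \<in> {0}" by simp
  qed
  have eq: "h = h'" if "h \<in> hom ?D (FO F X) (FO F X)" "h' \<in> hom ?D (FO F X) (FO F X)" for h h'
  proof (rule PiE_ext)
    show "h \<in> (\<Pi>\<^sub>E i\<in>{..<r}. Ar Vect)" "h' \<in> (\<Pi>\<^sub>E i\<in>{..<r}. Ar Vect)"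
      using that by (auto simp: hom_def)
    fix i assume i: "i \<in> {..<r}"
    have "h i \<in> Ar Vect" "Dom Vect (h i) = FO F X i" "Cod Vect (h i) = FO F X i"
      using that(1) i by (auto simp: hom_def dest!: fun_cong [of _ _ i])
    then obtain p where p: "h i = (FO F X i, p, FO F X i)" "p \<in> FO F X i \<rightarrow>\<^sub>E FO F X i"
      by (auto simp: Vect_def)
    have "h' i \<in> Ar Vect" "Dom Vect (h' i) = FO F X i" "Cod Vect (h' i) = FO F X i"
      using that(2) i by (auto simp: hom_def dest!: fun_cong [of _ _ i])
    then obtain q where q: "h' i = (FO F X i, q, FO F X i)" "q \<in> FO F X i \<rightarrow>\<^sub>E FO F X i"
      by (auto simp: Vect_def)
    have "p = q"
    proof (rule PiE_ext [OF p(2) q(2)])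
      fix x assume "x \<in> FO F X i"
      then have "p x \<in> {0}" "q x \<in> {0}"
        using PiE_mem [OF p(2)] PiE_mem [OF q(2)] trivial [of i] i by blast+
      then show "p x = q x" by simp
    qed
    then show "h i = h' i" using p q by simp
  qed
  have F_functor: "is_functor C ?D F" and inj: "inj_on (FA F) (hom C X X)"
    using F X by (auto simp: linear_equivalence_def linear_functor_def bij_betw_def)
  have *: "FA F h \<in> hom ?D (FO F X) (FO F X)" if "h \<in> hom C X X" for h
    using F_functor that by (auto simp: is_functor_def hom_def)
  have "Id C X = Zero C X X"
    by (rule inj_onD [OF inj]) (use * eq X Id_in Zero_in in blast)+
  then show ?thesis using that X zero_object_iff_Id by blast
qed

section \<open>Homogeneous components of objects of the total category\<close>

locale graded =
  fixes C :: "('k::field, 'o, 'a) grcat"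
  assumes two_vect: "two_vect (C n)"
begin

sublocale linear: linear_category "C n" for n
  using two_vect by (simp add: two_vect_def)

sublocale component: category "C n" for n
  by (rule linear.is_category)

sublocale total: category "tot C"
  by (rule category_tot) (rule component.category_axioms)

definition zob :: "nat \<Rightarrow> 'o" where
  "zob n = (SOME Z. zero_object (C n) Z)"

lemma zero_object_zob: "zero_object (C n) (zob n)"
  unfolding zob_def using two_vect_zero_object [OF two_vect] by (metis someI_ex)

lemma zob_Ob [simp]: "zob n \<in> Ob (C n)"
  using zero_object_zob by (simp add: zero_object_def)

lemma Zero_simps [simp]:
  assumes "X \<in> Ob (C n)" "Y \<in> Ob (C n)"
  shows "Zero (C n) X Y \<in> Ar (C n)" "Dom (C n) (Zero (C n) X Y) = X" "Cod (C n) (Zero (C n) X Y) = Y"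
  using linear.Zero_in [OF assms] by (auto simp: hom_def)

text \<open>The homogeneous part of degree \<open>d\<close>, with \<open>proj_trunc\<close> and
  \<open>incl_trunc\<close> as its retraction and section. An object of the total category has an
  entry in every degree, so the other entries are chosen zero objects.\<close>

definition trunc :: "nat \<Rightarrow> (nat \<Rightarrow> 'o) \<Rightarrow> nat \<Rightarrow> 'o" where
  "trunc d X = (\<lambda>n. if n = d then X n else zob n)"

definition proj_trunc :: "nat \<Rightarrow> (nat \<Rightarrow> 'o) \<Rightarrow> nat \<Rightarrow> 'a" where
  "proj_trunc d X = (\<lambda>n. if n = d then Id (C n) (X n) else Zero (C n) (X n) (zob n))"

definition incl_trunc :: "nat \<Rightarrow> (nat \<Rightarrow> 'o) \<Rightarrow> nat \<Rightarrow> 'a" where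
  "incl_trunc d X = (\<lambda>n. if n = d then Id (C n) (X n) else Zero (C n) (zob n) (X n))"

lemma supp_trunc: "supp C (trunc d X) \<subseteq> {d}"
  using zero_object_zob by (auto simp: supp_def trunc_def)

lemma trunc_Ob [simp]: "X \<in> Ob (tot C) \<Longrightarrow> trunc d X \<in> Ob (tot C)"
  using finite_subset [OF supp_trunc] by (auto simp: tot_simps trunc_def)

lemma zob_Ob_tot: "zob \<in> Ob (tot C)"
  using zero_object_zob by (auto simp: tot_simps supp_def)

lemma tot_ArI:
  assumes "X \<in> Ob (tot C)" "Y \<in> Ob (tot C)" "\<And>n. f n \<in> hom (C n) (X n) (Y n)"
  shows "f \<in> hom (tot C) X Y"
  using assms by (auto simp: tot_simps hom_def)

lemma proj_trunc_in: "X \<in> Ob (tot C) \<Longrightarrow> proj_trunc d X \<in> hom (tot C) X (trunc d X)"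
  by (rule tot_ArI, assumption, erule trunc_Ob)
    (auto simp: proj_trunc_def trunc_def hom_def tot_simps)

lemma incl_trunc_in: "X \<in> Ob (tot C) \<Longrightarrow> incl_trunc d X \<in> hom (tot C) (trunc d X) X"
  by (rule tot_ArI, erule trunc_Ob, assumption)
    (auto simp: incl_trunc_def trunc_def hom_def tot_simps)

text \<open>In every degree the source or the target is a zero object.\<close>

lemma hom_disjoint_supp_unique:
  assumes "f \<in> hom (tot C) X Y" "g \<in> hom (tot C) X Y" "supp C X \<inter> supp C Y = {}"
  shows "f = g"
proof
  fix n
  have fg: "f n \<in> hom (C n) (X n) (Y n)" "g n \<in> hom (C n) (X n) (Y n)"
    using assms(1,2) by (simp_all add: hom_def tot_simps fun_eq_iff)
  then have "X n \<in> Ob (C n)" "Y n \<in> Ob (C n)"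
    using linear.hom_Ob by blast+
  moreover have "zero_object (C n) (X n) \<or> zero_object (C n) (Y n)"
    using assms(3) by (auto simp: supp_def)
  ultimately show "f n = g n" using fg unfolding zero_object_def by blast
qed

end

text \<open>If \<open>B\<close> had a nonzero component in a degree \<open>n\<close> other than
  \<open>d\<close>, the projection of \<open>B\<close> to that component and the zero arrow would be
  distinct. But their composites with \<open>u\<close> run from \<open>A\<close>, which lives in
  degree \<open>d\<close>, to an object in degree \<open>n\<close>, so they agree, against
  uniqueness.\<close>

lemma univ_arrow_degree_zero:
  assumes "graded C" "graded D" "cat_functor (tot D) (tot C) M"
    and deg: "\<And>X d. \<lbrakk>X \<in> Ob (tot D); supp D X \<subseteq> {d}\<rbrakk> \<Longrightarrow> supp C (FO M X) \<subseteq> {d}"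
    and u: "univ_arrow (tot C) (tot D) M A B u" and A: "supp C A \<subseteq> {d}"
  shows "supp D B \<subseteq> {d}"
proof (rule ccontr)
  interpret C: graded C by fact
  interpret D: graded D by fact
  interpret M: cat_functor "tot D" "tot C" M by fact
  note U [simp] = univ_arrowD [OF u]
  assume "\<not> supp D B \<subseteq> {d}"
  then obtain n where n: "n \<in> supp D B" "n \<noteq> d" by auto
  let ?r = "D.proj_trunc n B" and ?z = "Zero (tot D) B (D.trunc n B)"
  have r: "?r \<in> Ar (tot D)" "Dom (tot D) ?r = B" "Cod (tot D) ?r = D.trunc n B"
    using D.proj_trunc_in [of B n] by (simp_all add: hom_def)
  have "?z \<in> hom (tot D) B (D.trunc n B)"
  proof (rule D.tot_ArI)
    fix l
    have "B l \<in> Ob (D l)" "D.trunc n B l \<in> Ob (D l)"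
      using D.trunc_Ob [OF U(1), of n] U(1) by (simp_all add: tot_simps)
    then show "?z l \<in> hom (D l) (B l) (D.trunc n B l)" by (simp add: hom_def tot_simps)
  qed simp_all
  then have z: "?z \<in> Ar (tot D)" "Dom (tot D) ?z = B" "Cod (tot D) ?z = D.trunc n B"
    by (simp_all add: hom_def)
  have "Cmp (tot C) (FA M ?r) u = Cmp (tot C) (FA M ?z) u"
  proof (rule C.hom_disjoint_supp_unique)
    show "Cmp (tot C) (FA M ?r) u \<in> hom (tot C) A (FO M (D.trunc n B))"
      "Cmp (tot C) (FA M ?z) u \<in> hom (tot C) A (FO M (D.trunc n B))"
      using r z by (simp_all add: hom_def)
    show "supp C A \<inter> supp C (FO M (D.trunc n B)) = {}"
      using A deg [OF _ D.supp_trunc [of n B]] n(2) by auto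
  qed
  then have "?r = ?z"
    using univ_arrow_eq [OF u r(1) z(1)] r z M.cat_functor_axioms by simp
  then have "?r n = ?z n" by simp
  then have "Id (D n) (B n) = Zero (D n) (B n) (B n)"
    by (simp add: D.proj_trunc_def D.trunc_def tot_simps)
  moreover have "B n \<in> Ob (D n)" using U(1) by (simp add: tot_simps)
  ultimately show False using n(1) D.linear.zero_object_iff_Id by (simp add: supp_def)
qed

text \<open>The identity of \<open>Y\<close> is the sum of the idempotents onto its homogeneous components.\<close>

lemma supp_linear_functor:
  assumes "graded C" "graded D" and F: "linear_functor (tot C) (tot D) F"
    and deg: "\<And>X d. \<lbrakk>X \<in> Ob (tot C); supp C X \<subseteq> {d}\<rbrakk> \<Longrightarrow> supp D (FO F X) \<subseteq> {d..d + N}"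
    and Y: "Y \<in> Ob (tot C)"
  shows "supp D (FO F Y) \<subseteq> (\<Union>d\<in>supp C Y. {d..d + N})"
proof (rule ccontr)
  interpret C: graded C by fact
  interpret D: graded D by fact
  interpret F: cat_functor "tot C" "tot D" F
    using F by unfold_locales (simp add: linear_functor_def)
  have Yn [simp]: "Y n \<in> Ob (C n)" for n using Y by (simp add: tot_simps)
  have FY: "FO F Y \<in> Ob (tot D)" using Y by simp
  then have FYn [simp]: "FO F Y n \<in> Ob (D n)" for n by (simp add: tot_simps)
  assume "\<not> supp D (FO F Y) \<subseteq> (\<Union>d\<in>supp C Y. {d..d + N})"
  then obtain k where k: "k \<in> supp D (FO F Y)" "\<And>d. d \<in> supp C Y \<Longrightarrow> k \<notin> {d..d + N}" by blast
  \<comment> \<open>The idempotent of \<open>Y\<close> that projects to the degrees in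
    \<open>S\<close>.\<close>
  define e where "e S = (\<lambda>n. if n \<in> S then Id (C n) (Y n) else Zero (C n) (Y n) (Y n))" for S
  have e: "e S \<in> hom (tot C) Y Y" for S
    by (rule C.tot_ArI) (use Y in \<open>auto simp: e_def hom_def\<close>)
  then have e': "e S \<in> Ar (tot C)" "Dom (tot C) (e S) = Y" "Cod (tot C) (e S) = Y" for S
    by (auto simp: hom_def)
  have zz: "Add (C n) (Zero (C n) (Y n) (Y n)) (Zero (C n) (Y n) (Y n)) = Zero (C n) (Y n) (Y n)" for n
    by (rule C.linear.Add_Zero) (simp add: hom_def)
  \<comment> \<open>Each \<open>e {d}\<close> factors through the homogeneous part of degree
    \<open>d\<close>, whose image vanishes in degree \<open>k\<close>; additivity extends this to
    \<open>e S\<close>, and \<open>e (supp C Y)\<close> is the identity.\<close>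
  have "FA F (e S) k = Zero (D k) (FO F Y k) (FO F Y k)" if "finite S" "S \<subseteq> supp C Y" for S
    using that
  proof (induction S)
    case empty
    \<comment> \<open>\<open>linear_functor\<close> speaks of sums and scalar multiples, so the zero
      arrow is written as 0 times the identity.\<close>
    have "Scl (C n) 0 (Id (C n) (Y n)) = Zero (C n) (Y n) (Y n)" for n
      by (rule C.linear.Scl_0) (simp add: hom_def)
    then have "e {} = Scl (tot C) 0 (Id (tot C) Y)" by (simp add: e_def tot_simps)
    moreover have "FA F (Scl (tot C) 0 (Id (tot C) Y)) = Scl (tot D) 0 (FA F (Id (tot C) Y))"
      using F Y C.total.Id_Ar unfolding linear_functor_def by blast
    ultimately have "FA F (e {}) = Scl (tot D) 0 (Id (tot D) (FO F Y))" using Y by simp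
    moreover have "Scl (D k) 0 (Id (D k) (FO F Y k)) = Zero (D k) (FO F Y k) (FO F Y k)"
      by (rule D.linear.Scl_0) (simp add: hom_def)
    ultimately show ?case by (simp add: tot_simps)
  next
    case (insert d S)
    have "e (insert d S) = Add (tot C) (e S) (e {d})"
    proof
      fix n
      have z: "Zero (C n) (Y n) (Y n) \<in> hom (C n) (Y n) (Y n)"
        and i: "Id (C n) (Y n) \<in> hom (C n) (Y n) (Y n)" by (simp_all add: hom_def)
      show "e (insert d S) n = Add (tot C) (e S) (e {d}) n"
        using insert.hyps(2) C.linear.Add_Zero [OF i] C.linear.Add_comm [OF z i] zz
        by (auto simp: e_def tot_simps)
    qed
    moreover have "FA F (Add (tot C) (e S) (e {d})) = Add (tot D) (FA F (e S)) (FA F (e {d}))"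
      using F e [of "{d}"] e' [of S] unfolding linear_functor_def by (metis (no_types, lifting))
    moreover have "FA F (e S) k = Zero (D k) (FO F Y k) (FO F Y k)" using insert by simp
    moreover have "FA F (e {d}) k = Zero (D k) (FO F Y k) (FO F Y k)"
    proof -
      let ?p = "C.proj_trunc d Y" and ?i = "C.incl_trunc d Y" and ?T = "C.trunc d Y"
      have p: "?p \<in> Ar (tot C)" "Dom (tot C) ?p = Y" "Cod (tot C) ?p = ?T"
        and i: "?i \<in> Ar (tot C)" "Dom (tot C) ?i = ?T" "Cod (tot C) ?i = Y"
        using C.proj_trunc_in [OF Y, of d] C.incl_trunc_in [OF Y, of d] by (simp_all add: hom_def)
      have "Cmp (C n) (Zero (C n) (C.zob n) (Y n)) (Zero (C n) (Y n) (C.zob n)) =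
          Zero (C n) (Y n) (Y n)" for n
        by (rule C.linear.Zero_Cmp) (simp_all add: hom_def)
      then have "e {d} = Cmp (tot C) ?i ?p"
        by (auto simp: e_def C.proj_trunc_def C.incl_trunc_def tot_simps)
      then have "FA F (e {d}) = Cmp (tot D) (FA F ?i) (FA F ?p)" using p i by simp
      then have eq: "FA F (e {d}) k = Cmp (D k) (FA F ?i k) (FA F ?p k)" by (simp add: tot_simps)
      have "FA F ?p \<in> hom (tot D) (FO F Y) (FO F ?T)" "FA F ?i \<in> hom (tot D) (FO F ?T) (FO F Y)"
        using p i by (simp_all add: hom_def)
      then have "FA F ?p k \<in> hom (D k) (FO F Y k) (FO F ?T k)"
        "FA F ?i k \<in> hom (D k) (FO F ?T k) (FO F Y k)"
        by (auto simp: hom_def tot_simps fun_eq_iff)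
      moreover have "zero_object (D k) (FO F ?T k)"
        using deg [OF _ C.supp_trunc [of d Y]] Y k(2) [of d] insert.prems by (auto simp: supp_def)
      ultimately show ?thesis
        unfolding eq by (intro D.linear.factors_through_zero_object)
    qed
    moreover have "Add (D k) (Zero (D k) (FO F Y k) (FO F Y k)) (Zero (D k) (FO F Y k) (FO F Y k)) =
        Zero (D k) (FO F Y k) (FO F Y k)"
      by (rule D.linear.Add_Zero) (simp add: hom_def)
    ultimately show ?case by (simp add: tot_simps)
  qed
  moreover have "e (supp C Y) = Id (tot C) Y"
    using C.linear.zero_object_iff_Id by (auto simp: e_def supp_def tot_simps)
  moreover have "finite (supp C Y)" using Y by (simp add: tot_simps)
  ultimately have "Id (tot D) (FO F Y) k = Zero (D k) (FO F Y k) (FO F Y k)"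
    using Y by (metis F.FA_Id order_refl)
  then have "zero_object (D k) (FO F Y k)"
    using D.linear.zero_object_iff_Id by (simp add: tot_simps)
  then show False using k(1) by (simp add: supp_def)
qed

declare One_nat_def [simp del]

section \<open>Exact functors of bounded nonnegative degree\<close>

text \<open>The one-variable form of \<open>multi_mor\<close>: degrees lie between 0 and
  \<open>N\<close>, whereas \<open>gr_mor\<close> allows them between \<open>-N\<close> and
  \<open>N\<close>.\<close>

definition bounded_exact :: "('k, 'o, 'a) grcat \<Rightarrow> ('k, 'o, 'a) grcat \<Rightarrow> ('o, 'a) gfun \<Rightarrow> bool" where
  "bounded_exact C D F \<longleftrightarrow> exact_functor (tot C) (tot D) F \<and>
     (\<exists>N. \<forall>X \<in> Ob (tot C). \<forall>d. supp C X \<subseteq> {d} \<longrightarrow> supp D (FO F X) \<subseteq> {d..d + N})"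

lemma exact_functor_is_functor: "exact_functor C D F \<Longrightarrow> is_functor C D F"
  by (simp add: exact_functor_def linear_functor_def)

lemma exact_functor_fcomp:
  assumes "category C" "category D" "category E" "exact_functor C D F" "exact_functor D E G"
  shows "exact_functor C E (G \<odot> F)"
proof -
  interpret F: cat_functor C D F
    using assms by (simp add: cat_functor_def cat_functor_axioms_def exact_functor_is_functor)
  interpret G: cat_functor D E G
    using assms by (simp add: cat_functor_def cat_functor_axioms_def exact_functor_is_functor)
  have "is_functor C E (G \<odot> F)"
    using cat_functor_fcomp [OF F.cat_functor_axioms G.cat_functor_axioms]
    by (simp add: cat_functor_def cat_functor_axioms_def)
  moreover have "FA F g \<in> hom D (Dom D (FA F f)) (Cod D (FA F f))"
    if "f \<in> Ar C" "g \<in> hom C (Dom C f) (Cod C f)" for f g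
    using that by (simp add: hom_def)
  ultimately show ?thesis
    using assms(4,5) by (simp add: exact_functor_def linear_functor_def)
qed

lemma exact_functor_id: "category C \<Longrightarrow> exact_functor C C id_fctr"
  using cat_functor_id [of C]
  by (simp add: exact_functor_def linear_functor_def cat_functor_def cat_functor_axioms_def)

lemma bounded_exact_id: "graded C \<Longrightarrow> bounded_exact C C id_fctr"
  using exact_functor_id [of "tot C"] graded_def [of C] category_tot [of C]
  by (auto simp: bounded_exact_def two_vect_def linear_category.is_category intro!: exI [of _ 0])

lemma category_tot_graded: "graded C \<Longrightarrow> category (tot C)"
  by (rule category_tot) (simp add: graded_def two_vect_def linear_category.is_category)

text \<open>The image under \<open>F\<close> of an object of degree \<open>d\<close> is spread over
  the degrees \<open>d\<close> to \<open>d + N\<close>, so the degree bound of \<open>G\<close> has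
  to be applied to its components, by \<open>supp_linear_functor\<close>.\<close>

lemma bounded_exact_fcomp:
  assumes C: "graded C" and D: "graded D" and E: "graded E"
    and F: "bounded_exact C D F" and G: "bounded_exact D E G"
  shows "bounded_exact C E (G \<odot> F)"
proof -
  obtain N where N: "\<And>X d. \<lbrakk>X \<in> Ob (tot C); supp C X \<subseteq> {d}\<rbrakk> \<Longrightarrow> supp D (FO F X) \<subseteq> {d..d + N}"
    using F unfolding bounded_exact_def by blast
  obtain M where M: "\<And>X d. \<lbrakk>X \<in> Ob (tot D); supp D X \<subseteq> {d}\<rbrakk> \<Longrightarrow> supp E (FO G X) \<subseteq> {d..d + M}"
    using G unfolding bounded_exact_def by blast
  have "supp E (FO G (FO F X)) \<subseteq> {d..d + (N + M)}" if X: "X \<in> Ob (tot C)" "supp C X \<subseteq> {d}" for X d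
  proof -
    have "FO F X \<in> Ob (tot D)"
      using F X by (simp add: bounded_exact_def exact_functor_def linear_functor_def is_functor_def)
    then have "supp E (FO G (FO F X)) \<subseteq> (\<Union>d\<in>supp D (FO F X). {d..d + M})"
      using G M by (intro supp_linear_functor [OF D E]) (auto simp: bounded_exact_def exact_functor_def)
    with N [OF X] show ?thesis by fastforce
  qed
  moreover have "exact_functor (tot C) (tot E) (G \<odot> F)"
    using F G assms(1-3) [THEN category_tot_graded]
    by (intro exact_functor_fcomp [of "tot C" "tot D" "tot E"]) (simp_all add: bounded_exact_def)
  ultimately show ?thesis unfolding bounded_exact_def fcomp_simps by blast
qed

section \<open>Functors of one variable as functors on one-factor products\<close>

lemma unary_simps [simp]:
  "FO (unary i F) X = FO F (\<lambda>k\<in>{i}. X)" "FA (unary i F) f = FA F (\<lambda>k\<in>{i}. f)"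
  by (simp_all add: unary_def)

definition single :: "nat \<Rightarrow> ('o, 'a) gfun \<Rightarrow> ('o, 'a) mfun" where
  "single i F = \<lparr>FO = (\<lambda>X. FO F (X i)), FA = (\<lambda>f. FA F (f i))\<rparr>"

lemma single_simps [simp]: "FO (single i F) X = FO F (X i)" "FA (single i F) f = FA F (f i)"
  by (simp_all add: single_def)

lemma unary_single [simp]: "unary i (single i F) = F"
  by (simp add: unary_def single_def)

lemma is_functor_unary:
  assumes "is_functor (mdom {i} C) D F"
  shows "is_functor (tot (C i)) D (unary i F)"
proof -
  show ?thesis
    unfolding is_functor_def
  proof (intro conjI ballI impI)
    fix X assume X: "X \<in> Ob (tot (C i))"
    then have "(\<lambda>k\<in>{i}. X) \<in> Ob (mdom {i} C)" by simp
    then have "FO F (\<lambda>k\<in>{i}. X) \<in> Ob D \<and>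
        FA F (Id (mdom {i} C) (\<lambda>k\<in>{i}. X)) = Id D (FO F (\<lambda>k\<in>{i}. X))"
      using assms unfolding is_functor_def by blast
    moreover have "Id (mdom {i} C) (\<lambda>k\<in>{i}. X) = (\<lambda>k\<in>{i}. Id (tot (C i)) X)"
      by (simp add: restrict_eq_iff)
    ultimately show "FO (unary i F) X \<in> Ob D" "FA (unary i F) (Id (tot (C i)) X) = Id D (FO (unary i F) X)"
      by simp_all
  next
    fix f assume f: "f \<in> Ar (tot (C i))"
    then have "(\<lambda>k\<in>{i}. f) \<in> Ar (mdom {i} C)" by simp
    then have "FA F (\<lambda>k\<in>{i}. f) \<in> hom D (FO F (Dom (mdom {i} C) (\<lambda>k\<in>{i}. f)))
        (FO F (Cod (mdom {i} C) (\<lambda>k\<in>{i}. f)))"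
      using assms unfolding is_functor_def by blast
    moreover have "Dom (mdom {i} C) (\<lambda>k\<in>{i}. f) = (\<lambda>k\<in>{i}. Dom (tot (C i)) f)"
      "Cod (mdom {i} C) (\<lambda>k\<in>{i}. f) = (\<lambda>k\<in>{i}. Cod (tot (C i)) f)"
      by (simp_all add: restrict_eq_iff)
    ultimately show "FA (unary i F) f \<in> hom D (FO (unary i F) (Dom (tot (C i)) f))
        (FO (unary i F) (Cod (tot (C i)) f))"
      by simp
  next
    fix f g assume fg: "f \<in> Ar (tot (C i))" "g \<in> Ar (tot (C i))" "Cod (tot (C i)) f = Dom (tot (C i)) g"
    then have "(\<lambda>k\<in>{i}. f) \<in> Ar (mdom {i} C)" "(\<lambda>k\<in>{i}. g) \<in> Ar (mdom {i} C)"
      "Cod (mdom {i} C) (\<lambda>k\<in>{i}. f) = Dom (mdom {i} C) (\<lambda>k\<in>{i}. g)"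
      by (simp_all add: restrict_eq_iff)
    then have "FA F (Cmp (mdom {i} C) (\<lambda>k\<in>{i}. g) (\<lambda>k\<in>{i}. f)) =
        Cmp D (FA F (\<lambda>k\<in>{i}. g)) (FA F (\<lambda>k\<in>{i}. f))"
      using assms unfolding is_functor_def by blast
    moreover have "Cmp (mdom {i} C) (\<lambda>k\<in>{i}. g) (\<lambda>k\<in>{i}. f) = (\<lambda>k\<in>{i}. Cmp (tot (C i)) g f)"
      by (simp add: restrict_eq_iff)
    ultimately show "FA (unary i F) (Cmp (tot (C i)) g f) = Cmp D (FA (unary i F) g) (FA (unary i F) f)"
      by simp
  qed
qed

lemma nat_trans_unary:
  assumes "nat_trans (mdom {i} C) D F G t"
  shows "nat_trans (tot (C i)) D (unary i F) (unary i G) (\<lambda>X. t (\<lambda>k\<in>{i}. X))"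
  unfolding nat_trans_def
proof (intro conjI ballI)
  fix X assume "X \<in> Ob (tot (C i))"
  then have "(\<lambda>k\<in>{i}. X) \<in> Ob (mdom {i} C)" by simp
  then show "t (\<lambda>k\<in>{i}. X) \<in> hom D (FO (unary i F) X) (FO (unary i G) X)"
    using assms unfolding nat_trans_def unary_simps by blast
next
  fix f assume "f \<in> Ar (tot (C i))"
  then have "(\<lambda>k\<in>{i}. f) \<in> Ar (mdom {i} C)" by simp
  then have "Cmp D (t (Cod (mdom {i} C) (\<lambda>k\<in>{i}. f))) (FA F (\<lambda>k\<in>{i}. f)) =
      Cmp D (FA G (\<lambda>k\<in>{i}. f)) (t (Dom (mdom {i} C) (\<lambda>k\<in>{i}. f)))"
    using assms unfolding nat_trans_def by blast
  moreover have "Dom (mdom {i} C) (\<lambda>k\<in>{i}. f) = (\<lambda>k\<in>{i}. Dom (tot (C i)) f)"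
    "Cod (mdom {i} C) (\<lambda>k\<in>{i}. f) = (\<lambda>k\<in>{i}. Cod (tot (C i)) f)"
    by (simp_all add: restrict_eq_iff)
  ultimately show "Cmp D (t (\<lambda>k\<in>{i}. Cod (tot (C i)) f)) (FA (unary i F) f) =
      Cmp D (FA (unary i G) f) (t (\<lambda>k\<in>{i}. Dom (tot (C i)) f))"
    by simp
qed

lemma nat_iso_unary:
  assumes "nat_iso (mdom {i} C) D F G t"
  shows "nat_iso (tot (C i)) D (unary i F) (unary i G) (\<lambda>X. t (\<lambda>k\<in>{i}. X))"
proof -
  have "(\<lambda>k\<in>{i}. X) \<in> Ob (mdom {i} C)" if "X \<in> Ob (tot (C i))" for X
    using that by simp
  then show ?thesis
    using assms nat_trans_unary [of i C D F G t] unfolding nat_iso_def by blast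
qed

lemma nat_trans_single:
  assumes "nat_trans (tot (C i)) D F G t"
  shows "nat_trans (mdom {i} C) D (single i F) (single i G) (\<lambda>X. t (X i))"
  using assms by (simp add: nat_trans_def PiE_iff)

lemma is_functor_single:
  assumes "is_functor (tot (C i)) D F"
  shows "is_functor (mdom {i} C) D (single i F)"
  using assms unfolding is_functor_def by (simp add: PiE_iff restrict_eq_iff)

lemma multi_mor_single:
  assumes F: "bounded_exact (C i) D F"
  shows "multi_mor {i} C D (single i F)"
proof -
  obtain N where N: "\<And>X d. \<lbrakk>X \<in> Ob (tot (C i)); supp (C i) X \<subseteq> {d}\<rbrakk> \<Longrightarrow> supp D (FO F X) \<subseteq> {d..d + N}"
    using F unfolding bounded_exact_def by blast
  have "has_degrees {i} C D {0..N} (single i F)"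
    unfolding has_degrees_def
  proof (intro ballI allI impI)
    fix X d assume X: "X \<in> Ob (mdom {i} C)" "\<forall>k\<in>{i}. supp (C k) (X k) \<subseteq> {d k}"
    have "{d i..d i + N} \<subseteq> {(\<Sum>k\<in>{i}. d k) + e | e. e \<in> {0..N}}"
      by (auto simp: le_iff_add)
    then show "supp D (FO (single i F) X) \<subseteq> {(\<Sum>k\<in>{i}. d k) + e | e. e \<in> {0..N}}"
      using N [of "X i" "d i"] X by auto
  qed
  moreover have "in_variable {i} C (single i F) X i = F" if "X \<in> Ob (mdom {i} C)" for X
    by (simp add: in_variable_def)
  moreover have "is_functor (mdom {i} C) (tot D) (single i F)"
    using F by (intro is_functor_single) (simp add: bounded_exact_def exact_functor_is_functor)
  ultimately show ?thesis
    using F unfolding multi_mor_def multi_exact_def bounded_exact_def by auto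
qed

lemma bounded_exact_unary:
  assumes C: "graded (C i)" and F: "multi_mor {i} C D F"
  shows "bounded_exact (C i) D (unary i F)"
proof -
  \<comment> \<open>\<open>multi_exact\<close> lets one entry of a given object of the product vary,
    so some object has to be exhibited; with a single factor its entry is overwritten.\<close>
  define X where "X = (\<lambda>k\<in>{i}. graded.zob (C i))"
  have X: "X \<in> Ob (mdom {i} C)"
    using graded.zob_Ob_tot [OF C] by (simp add: X_def)
  have up: "x(i := y) = (\<lambda>k\<in>{i}. y)" if "x \<in> extensional {i}" for x :: "nat \<Rightarrow> 'z" and y
    using that by (auto simp: extensional_def fun_eq_iff)
  have "in_variable {i} C F X i = unary i F"
    using up [of X] up [of "Id (mdom {i} C) X"] by (simp add: in_variable_def unary_def X_def)
  then have "exact_functor (tot (C i)) (tot D) (unary i F)"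
    using F X unfolding multi_mor_def multi_exact_def by (metis singletonI)
  moreover obtain N where N: "has_degrees {i} C D {0..N} F"
    using F unfolding multi_mor_def by blast
  have "supp D (FO (unary i F) Y) \<subseteq> {d..d + N}" if Y: "Y \<in> Ob (tot (C i))" "supp (C i) Y \<subseteq> {d}" for Y d
  proof -
    have "(\<lambda>k\<in>{i}. Y) \<in> Ob (mdom {i} C)" using Y by simp
    then have "supp D (FO F (\<lambda>k\<in>{i}. Y)) \<subseteq> {(\<Sum>k\<in>{i}. d) + e | e. e \<in> {0..N}}"
      by (rule N [unfolded has_degrees_def, THEN bspec, THEN spec [of _ "\<lambda>_. d"], THEN mp])
        (use Y in simp)
    then show ?thesis by fastforce
  qed
  ultimately show ?thesis unfolding bounded_exact_def by blast
qed

section \<open>Extension along coCartesian arrows\<close>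

lemma fib_simps [simp]:
  "fib [i \<mapsto> j] j = {i}" "fib [1 \<mapsto> 1, 2 \<mapsto> 1] 1 = {1,2}"
  "fib [1 \<mapsto> 1, 2 \<mapsto> 2] 1 = {1}" "fib [1 \<mapsto> 1, 2 \<mapsto> 2] 2 = {2}"
  by (auto simp: fib_def split: if_splits)

lemma map_comp_active: "[1 \<mapsto> 1] \<circ>\<^sub>m [1 \<mapsto> 1, 2 \<mapsto> 1] = [1 \<mapsto> 1::nat, 2::nat \<mapsto> 1]"
  by (auto simp: map_comp_def fun_eq_iff)

text \<open>The coCartesian property is applied to targets with one component, over the identity of
  the one-element index set. There it becomes a statement about functors and natural transformations
  on total categories: \<open>extension\<close>, \<open>cell_extension\<close> and
  \<open>cell_unique\<close>.\<close>

locale cocartesian_pair =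
  fixes P :: "nat \<Rightarrow> ('k::field, 'o, 'a) grcat" and K :: "nat \<Rightarrow> ('k, 'o, 'a) grcat" and c
  assumes coc: "tv_cocartesian ({1,2}, P) ({1}, K) [1 \<mapsto> 1, 2 \<mapsto> 1] c"
    and graded_P: "i \<in> {1,2} \<Longrightarrow> graded (P i)" and graded_K: "graded (K 1)"
begin

lemma category_P: "category (mdom {1,2} P)"
  using graded_P by (intro category_prodc category_tot_graded) auto

lemma category_K: "category (tot (K 1))"
  using graded_K by (rule category_tot_graded)

lemma multi_mor_c: "multi_mor {1,2} P (K 1) (c 1)"
  using coc by (simp add: tv_cocartesian_def tv_mor_def)

lemma functor_c: "cat_functor (mdom {1,2} P) (tot (K 1)) (c 1)"
  using category_P category_K multi_mor_c
  by (simp add: cat_functor_def cat_functor_axioms_def multi_mor_def multi_exact_def)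

lemma tv_comp_active:
  assumes "A \<in> Ob (mdom {1,2} P)"
  shows "FO (tv_comp [1 \<mapsto> 1, 2 \<mapsto> 1] [1 \<mapsto> 1] g c 1) A = FO (unary 1 (g 1) \<odot> c 1) A"
proof -
  have "restrict A {1,2} = A" using assms by (simp add: PiE_iff extensional_restrict)
  then have "(\<lambda>j\<in>{1}. FO (c j) (restrict A (fib [1 \<mapsto> 1, 2 \<mapsto> 1] j))) = (\<lambda>k\<in>{1}. FO (c 1) A)"
    by (simp add: restrict_eq_iff)
  then show ?thesis by (simp add: tv_comp_def spread_ob_def)
qed

lemma tv_comp_active_ar:
  assumes "h \<in> Ar (mdom {1,2} P)"
  shows "FA (tv_comp [1 \<mapsto> 1, 2 \<mapsto> 1] [1 \<mapsto> 1] g c 1) h = FA (unary 1 (g 1) \<odot> c 1) h"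
proof -
  have "restrict h {1,2} = h" using assms by (simp add: PiE_iff extensional_restrict)
  then have "(\<lambda>j\<in>{1}. FA (c j) (restrict h (fib [1 \<mapsto> 1, 2 \<mapsto> 1] j))) = (\<lambda>k\<in>{1}. FA (c 1) h)"
    by (simp add: restrict_eq_iff)
  then show ?thesis by (simp add: tv_comp_def spread_ar_def)
qed

lemma whisker_active:
  assumes "A \<in> Ob (mdom {1,2} P)"
  shows "whisker_right [1 \<mapsto> 1, 2 \<mapsto> 1] [1 \<mapsto> 1] t c 1 A = t 1 (\<lambda>k\<in>{1}. FO (c 1) A)"
proof -
  have "restrict A {1,2} = A" using assms by (simp add: PiE_iff extensional_restrict)
  then have "(\<lambda>j\<in>{1}. FO (c j) (restrict A (fib [1 \<mapsto> 1, 2 \<mapsto> 1] j))) = (\<lambda>k\<in>{1}. FO (c 1) A)"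
    by (simp add: restrict_eq_iff)
  then show ?thesis by (simp add: whisker_right_def spread_ob_def)
qed

context
  fixes E :: "('k, 'o, 'a) grcat"
  assumes E: "graded E"
begin

lemma target: "tv_ob ({1}, \<lambda>_. E)" "ptd_map {1} {1} [1 \<mapsto> 1]"
  using E by (auto simp: tv_ob_def graded_def ptd_map_def)

lemmas precomposition = coc [unfolded tv_cocartesian_def, THEN conjunct2,
  THEN spec [of _ "({1}, \<lambda>_. E)"], THEN spec [of _ "[1 \<mapsto> 1]"], THEN mp, unfolded fst_conv,
  OF conjI [OF target]]

lemma extension:
  assumes h: "multi_mor {1,2} P E h"
  obtains L t where "bounded_exact (K 1) E L" "nat_iso (mdom {1,2} P) (tot E) (L \<odot> c 1) h t"
proof -
  let ?\<phi> = "[1 \<mapsto> 1, 2 \<mapsto> 1] :: nat \<rightharpoonup> nat" and ?\<psi> = "[1 \<mapsto> 1] :: nat \<rightharpoonup> nat"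
  have "tv_mor ({1,2}, P) ({1}, \<lambda>_. E) (?\<psi> \<circ>\<^sub>m ?\<phi>) (\<lambda>_. h)"
    using h unfolding map_comp_active by (auto simp: tv_mor_def ptd_map_def)
  from precomposition [THEN conjunct1, THEN spec, THEN mp, OF this]
  obtain g t where g: "tv_mor ({1}, K) ({1}, \<lambda>_. E) [1 \<mapsto> 1] g"
    and t: "tv_iso ({1,2}, P) ({1}, \<lambda>_. E) (?\<psi> \<circ>\<^sub>m ?\<phi>)
      (tv_comp [1 \<mapsto> 1, 2 \<mapsto> 1] [1 \<mapsto> 1] g c) (\<lambda>_. h) t"
    by blast
  have "bounded_exact (K 1) E (unary 1 (g 1))"
    using g by (intro bounded_exact_unary graded_K) (simp add: tv_mor_def)
  moreover have "nat_iso (mdom {1,2} P) (tot E) (tv_comp [1 \<mapsto> 1, 2 \<mapsto> 1] [1 \<mapsto> 1] g c 1) h (t 1)"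
    using t unfolding map_comp_active by (simp add: tv_iso_def)
  then have "nat_iso (mdom {1,2} P) (tot E) (unary 1 (g 1) \<odot> c 1) h (t 1)"
    by (rule nat_iso_cong [OF _ category_P]) (auto simp only: tv_comp_active tv_comp_active_ar)
  ultimately show ?thesis using that by blast
qed

text \<open>Full faithfulness of precomposition with \<open>c 1\<close>. Existence and uniqueness
  stay in one statement because both come from the same instance of the coCartesian
  property.\<close>

lemma extension_of_cells:
  assumes G: "bounded_exact (K 1) E G" and G': "bounded_exact (K 1) E G'"
    and s: "nat_trans (mdom {1,2} P) (tot E) (G \<odot> c 1) (G' \<odot> c 1) s"
  shows "\<exists>t. nat_trans (tot (K 1)) (tot E) G G' t \<and> (\<forall>A \<in> Ob (mdom {1,2} P). t (FO (c 1) A) = s A) \<and>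
    (\<forall>t'. nat_trans (tot (K 1)) (tot E) G G' t' \<and> (\<forall>A \<in> Ob (mdom {1,2} P). t' (FO (c 1) A) = s A) \<longrightarrow>
       (\<forall>X \<in> Ob (tot (K 1)). t' X = t X))"
proof -
  let ?X = "({1::nat,2}, P)" and ?Y = "({1::nat}, K)" and ?Z = "({1::nat}, \<lambda>_::nat. E)"
  let ?\<phi> = "[1 \<mapsto> 1, 2 \<mapsto> 1] :: nat \<rightharpoonup> nat" and ?\<psi> = "[1 \<mapsto> 1] :: nat \<rightharpoonup> nat"
  let ?g = "\<lambda>_::nat. single 1 G" and ?g' = "\<lambda>_::nat. single 1 G'"
  have mor: "tv_mor ?Y ?Z ?\<psi> ?g" "tv_mor ?Y ?Z ?\<psi> ?g'"
    using G G' multi_mor_single [of K 1 E] by (auto simp: tv_mor_def ptd_map_def)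
  have "nat_trans (mdom {1,2} P) (tot E) (tv_comp ?\<phi> ?\<psi> ?g c 1) (tv_comp ?\<phi> ?\<psi> ?g' c 1) s"
    by (rule nat_trans_cong [OF s category_P]) (simp_all only: tv_comp_active tv_comp_active_ar unary_single)
  then have "tv_nat ?X ?Z (?\<psi> \<circ>\<^sub>m ?\<phi>) (tv_comp ?\<phi> ?\<psi> ?g c) (tv_comp ?\<phi> ?\<psi> ?g' c) (\<lambda>_. s)"
    unfolding map_comp_active by (simp add: tv_nat_def)
  with mor have "tv_mor ?Y ?Z ?\<psi> ?g \<and> tv_mor ?Y ?Z ?\<psi> ?g' \<and>
      tv_nat ?X ?Z (?\<psi> \<circ>\<^sub>m ?\<phi>) (tv_comp ?\<phi> ?\<psi> ?g c) (tv_comp ?\<phi> ?\<psi> ?g' c) (\<lambda>_. s)"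
    by blast
  from precomposition [THEN conjunct2, THEN spec, THEN spec, THEN spec, THEN mp, OF this]
  obtain t where t: "tv_nat ?Y ?Z ?\<psi> ?g ?g' t"
      "tv_eq ?X ?Z (?\<psi> \<circ>\<^sub>m ?\<phi>) (whisker_right ?\<phi> ?\<psi> t c) (\<lambda>_. s)"
    and unique: "\<And>t'. \<lbrakk>tv_nat ?Y ?Z ?\<psi> ?g ?g' t';
      tv_eq ?X ?Z (?\<psi> \<circ>\<^sub>m ?\<phi>) (whisker_right ?\<phi> ?\<psi> t' c) (\<lambda>_. s)\<rbrakk> \<Longrightarrow> tv_eq ?Y ?Z ?\<psi> t' t"
    by blast
  let ?t = "\<lambda>X. t 1 (\<lambda>k\<in>{1}. X)"
  have "nat_trans (mdom {1} K) (tot E) (single 1 G) (single 1 G') (t 1)"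
    using t(1) by (simp add: tv_nat_def)
  then have "nat_trans (tot (K 1)) (tot E) G G' ?t"
    using nat_trans_unary [of 1 K "tot E" "single 1 G" "single 1 G'" "t 1"] by simp
  moreover have "?t (FO (c 1) A) = s A" if "A \<in> Ob (mdom {1,2} P)" for A
  proof -
    have "whisker_right ?\<phi> ?\<psi> t c 1 A = s A"
      using t(2) that unfolding map_comp_active by (simp add: tv_eq_def)
    then show ?thesis unfolding whisker_active [OF that] .
  qed
  moreover have "t' X = ?t X"
    if t': "nat_trans (tot (K 1)) (tot E) G G' t'" "\<And>A. A \<in> Ob (mdom {1,2} P) \<Longrightarrow> t' (FO (c 1) A) = s A"
      and X: "X \<in> Ob (tot (K 1))" for t' X
  proof -
    have "tv_nat ?Y ?Z ?\<psi> ?g ?g' (\<lambda>_ A. t' (A 1))"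
      using nat_trans_single [of K 1, OF t'(1)] by (simp add: tv_nat_def)
    moreover have "tv_eq ?X ?Z (?\<psi> \<circ>\<^sub>m ?\<phi>) (whisker_right ?\<phi> ?\<psi> (\<lambda>_ A. t' (A 1)) c) (\<lambda>_. s)"
      unfolding tv_eq_def
    proof (intro ballI)
      fix j A assume "j \<in> fst ?Z" "A \<in> Ob (mdom (fib (?\<psi> \<circ>\<^sub>m ?\<phi>) j) (snd ?X))"
      then have j: "j = 1" and A: "A \<in> Ob (mdom {1,2} P)"
        unfolding map_comp_active by simp_all
      show "whisker_right ?\<phi> ?\<psi> (\<lambda>_ A. t' (A 1)) c j A = s A"
        unfolding j whisker_active [OF A] using t'(2) [OF A] by simp
    qed
    ultimately have "tv_eq ?Y ?Z ?\<psi> (\<lambda>_ A. t' (A 1)) t" by (rule unique)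
    then have "\<forall>A \<in> Ob (mdom {1} K). t' (A 1) = t 1 A" by (simp add: tv_eq_def)
    moreover have "(\<lambda>k\<in>{1}. X) \<in> Ob (mdom {1} K)" using X by simp
    ultimately show ?thesis by fastforce
  qed
  ultimately show ?thesis by blast
qed

lemma cell_extension:
  assumes "bounded_exact (K 1) E G" "bounded_exact (K 1) E G'"
    and "nat_trans (mdom {1,2} P) (tot E) (G \<odot> c 1) (G' \<odot> c 1) s"
  obtains t where "nat_trans (tot (K 1)) (tot E) G G' t"
    "\<And>A. A \<in> Ob (mdom {1,2} P) \<Longrightarrow> t (FO (c 1) A) = s A"
  using extension_of_cells [OF assms] by blast

text \<open>Both \<open>t\<close> and \<open>t'\<close> extend the cell that \<open>t\<close>
  induces along \<open>c 1\<close>.\<close>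

lemma cell_unique:
  assumes G: "bounded_exact (K 1) E G" "bounded_exact (K 1) E G'"
    and t: "nat_trans (tot (K 1)) (tot E) G G' t" and t': "nat_trans (tot (K 1)) (tot E) G G' t'"
    and eq: "\<And>A. A \<in> Ob (mdom {1,2} P) \<Longrightarrow> t (FO (c 1) A) = t' (FO (c 1) A)"
    and X: "X \<in> Ob (tot (K 1))"
  shows "t X = t' X"
proof -
  interpret c: cat_functor "mdom {1,2} P" "tot (K 1)" "c 1" by (rule functor_c)
  have "nat_trans (mdom {1,2} P) (tot E) (G \<odot> c 1) (G' \<odot> c 1) (\<lambda>A. t (FO (c 1) A))"
    using t unfolding nat_trans_def fcomp_simps
    by (metis c.FO_Ob c.FA_Ar c.Dom_FA c.Cod_FA)
  from extension_of_cells [OF G this] show ?thesis using t t' eq X by metis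
qed

end

end

section \<open>Arrows of families of finite sets\<close>

lemma sing_simps [simp]: "fst (sing S) = {1}" "snd (sing S) = (\<lambda>i\<in>{1}. S)"
  by (simp_all add: sing_def)

lemma pair_simps [simp]: "fst (pair S T) = {1,2}" "snd (pair S T) = (\<lambda>i\<in>{1,2}. if i = 1 then S else T)"
  by (simp_all add: pair_def)

lemma fs_ob_sing [simp]: "finite S \<Longrightarrow> fs_ob (sing S)"
  by (simp add: fs_ob_def)

lemma fs_ob_pair [simp]: "finite S \<Longrightarrow> finite T \<Longrightarrow> fs_ob (pair S T)"
  by (auto simp: fs_ob_def)

lemma fs_ar_fs_map: "\<lbrakk>finite S; finite T; f \<in> S \<rightarrow> T\<rbrakk> \<Longrightarrow> fs_ar (fs_map S T f)"
  by (auto simp: fs_ar_def fs_map_def ptd_map_def)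

lemma fs_ar_join_ar:
  assumes "finite S" "finite T" "finite U" "s 1 \<in> S \<rightarrow> U" "s 2 \<in> T \<rightarrow> U"
  shows "fs_ar (join_ar S T U s)"
  using assms by (auto simp: fs_ar_def join_ar_def ptd_map_def PiE_iff split: if_splits)

lemma fs_ar_proj_ar:
  assumes "finite S" "finite T" "finite U" "i \<in> {1,2}" "b \<in> (if i = 1 then S else T) \<rightarrow> U"
  shows "fs_ar (proj_ar i S T U b)"
  using assms by (auto simp: fs_ar_def proj_ar_def ptd_map_def PiE_iff split: if_splits)

lemma fs_ar_mm_ar: "fs_ar mm_ar"
  by (auto simp: fs_ar_def mm_ar_def ptd_map_def PiE_iff split: if_splits)

lemma fs_arE:
  assumes "fs_ar u"
  shows "Maps u \<in> extensional (dom (Base u))"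
    "\<And>i k. Base u i = Some k \<Longrightarrow> Maps u i \<in> snd (Src u) i \<rightarrow>\<^sub>E snd (Tgt u) k"
    "\<And>i k. Base u i = Some k \<Longrightarrow> i \<in> fst (Src u) \<and> k \<in> fst (Tgt u)"
  using assms by (force simp: fs_ar_def ptd_map_def PiE_iff dom_def ran_def)+

lemma fsar_eqI:
  assumes "fs_ar u" "fs_ar v" "Src u = Src v" "Tgt u = Tgt v" "Base u = Base v"
    and "\<And>i x. \<lbrakk>i \<in> dom (Base v); x \<in> snd (Src v) i\<rbrakk> \<Longrightarrow> Maps u i x = Maps v i x"
  shows "u = v"
proof -
  have "Maps u = Maps v"
  proof (rule extensionalityI [of _ "dom (Base v)"])
    show "Maps u \<in> extensional (dom (Base v))" "Maps v \<in> extensional (dom (Base v))"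
      using fs_arE(1) [OF assms(1)] fs_arE(1) [OF assms(2)] assms(5) by auto
    fix i assume i: "i \<in> dom (Base v)"
    then obtain k where "Base v i = Some k" by auto
    then have "Maps u i \<in> extensional (snd (Src v) i)" "Maps v i \<in> extensional (snd (Src v) i)"
      using fs_arE(2) [OF assms(1)] fs_arE(2) [OF assms(2)] assms(3,5) by (auto simp: PiE_iff)
    then show "Maps u i = Maps v i"
      by (rule extensionalityI) (use assms(6) i in blast)
  qed
  then show ?thesis using assms(3-5) by (intro fsar.equality) simp_all
qed

lemma Maps_fs_comp:
  "\<lbrakk>Base u i = Some k; Base v k = Some l; x \<in> snd (Src u) i\<rbrakk> \<Longrightarrow>
    Maps (v \<cdot> u) i x = Maps v k (Maps u i x)"
  by (simp add: fs_comp_def compose_def dom_def)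

lemma fs_comp_simps [simp]:
  "Src (v \<cdot> u) = Src u" "Tgt (v \<cdot> u) = Tgt v" "Base (v \<cdot> u) = Base v \<circ>\<^sub>m Base u"
  by (simp_all add: fs_comp_def)

lemma fs_ar_comp:
  assumes u: "fs_ar u" and v: "fs_ar v" and uv: "Src v = Tgt u"
  shows "fs_ar (v \<cdot> u)"
proof -
  have "Maps (v \<cdot> u) i \<in> snd (Src u) i \<rightarrow>\<^sub>E snd (Tgt v) l"
    if l: "(Base v \<circ>\<^sub>m Base u) i = Some l" for i l
  proof -
    obtain k where k: "Base u i = Some k" "Base v k = Some l"
      using l by (auto simp: map_comp_def split: option.splits)
    have "Maps (v \<cdot> u) i = compose (snd (Src u) i) (Maps v k) (Maps u i)"
      using k by (simp add: fs_comp_def dom_def)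
    moreover have "Maps u i \<in> snd (Src u) i \<rightarrow> snd (Tgt u) k" "Maps v k \<in> snd (Tgt u) k \<rightarrow> snd (Tgt v) l"
      using fs_arE(2) [OF u k(1)] fs_arE(2) [OF v k(2)] uv by (auto simp: PiE_iff)
    ultimately show ?thesis by (auto simp: compose_def)
  qed
  moreover have "ptd_map (fst (Src u)) (fst (Tgt v)) (Base v \<circ>\<^sub>m Base u)"
    unfolding ptd_map_def
  proof (intro conjI subsetI)
    show "i \<in> fst (Src u)" if "i \<in> dom (Base v \<circ>\<^sub>m Base u)" for i
      using that fs_arE(3) [OF u, of i] by (auto simp: map_comp_def dom_def split: option.splits)
    show "l \<in> fst (Tgt v)" if "l \<in> ran (Base v \<circ>\<^sub>m Base u)" for l
      using that fs_arE(3) [OF v, of _ l] by (auto simp: map_comp_def ran_def split: option.splits)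
  qed
  moreover have "Maps (v \<cdot> u) \<in> extensional (dom (Base v \<circ>\<^sub>m Base u))"
    by (simp add: fs_comp_def)
  ultimately show ?thesis
    using u v by (auto simp: fs_ar_def PiE_iff)
qed

lemma join_ar_simps [simp]:
  "Src (join_ar S T U s) = pair S T" "Tgt (join_ar S T U s) = sing U"
  "Base (join_ar S T U s) = [1 \<mapsto> 1, 2 \<mapsto> 1]"
  "x \<in> S \<Longrightarrow> Maps (join_ar S T U s) 1 x = s 1 x" "x \<in> T \<Longrightarrow> Maps (join_ar S T U s) 2 x = s 2 x"
  by (simp_all add: join_ar_def)

text \<open>The images of \<open>s 1\<close> and \<open>s 2\<close> partition \<open>U\<close>, so a
  map out of \<open>U\<close> amounts to a pair of maps out of \<open>S\<close> and
  \<open>T\<close>. If \<psi> sends 1 to the base point, there are no maps to compare on either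
  side.\<close>

lemma fs_cocartesian_join_ar:
  assumes fin: "finite S" "finite T" "finite U" and s: "s 1 ` S \<union> s 2 ` T = U"
    and inj: "inj_on (s 1) S" "inj_on (s 2) T" "s 1 ` S \<inter> s 2 ` T = {}"
  shows "fs_cocartesian (join_ar S T U s)"
  unfolding fs_cocartesian_def
proof (intro conjI allI impI)
  let ?u = "join_ar S T U s"
  show u: "fs_ar ?u" using fin s by (intro fs_ar_join_ar) auto
  fix Z \<psi> w assume Z: "fs_ob Z \<and> ptd_map (fst (Tgt ?u)) (fst Z) \<psi>"
    and w: "fs_ar w \<and> Src w = Src ?u \<and> Tgt w = Z \<and> Base w = \<psi> \<circ>\<^sub>m Base ?u"
  have dom\<psi>: "dom \<psi> \<subseteq> {1}" "ran \<psi> \<subseteq> fst Z" using Z by (auto simp: ptd_map_def)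
  have Bw: "Base w i = (if i \<in> {1,2} then \<psi> 1 else None)" for i
    using w by (auto simp: map_comp_def)
  \<comment> \<open>The map on \<open>U\<close> glued from the two components of
    \<open>w\<close>.\<close>
  define f where "f y = (if y \<in> s 1 ` S then Maps w 1 (inv_into S (s 1) y)
    else Maps w 2 (inv_into T (s 2) y))" for y
  have f: "f (s 1 x) = Maps w 1 x" if "x \<in> S" for x
    using that inj by (simp add: f_def)
  have f': "f (s 2 x) = Maps w 2 x" if "x \<in> T" for x
    using that inj by (auto simp: f_def)
  define v where "v = \<lparr>Src = sing U, Tgt = Z, Base = \<psi>, Maps = (\<lambda>i\<in>dom \<psi>. \<lambda>y\<in>U. f y)\<rparr>"
  have fU: "f y \<in> snd Z k" if "y \<in> U" "\<psi> 1 = Some k" for y k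
  proof -
    have "Maps w 1 \<in> S \<rightarrow>\<^sub>E snd Z k" "Maps w 2 \<in> T \<rightarrow>\<^sub>E snd Z k"
      using fs_arE(2) [of w 1 k] fs_arE(2) [of w 2 k] w that(2) Bw [of 1] Bw [of 2] by auto
    then show ?thesis using that(1) s f f' by auto
  qed
  have v: "fs_ar v"
    using fin Z dom\<psi> fU by (auto simp: fs_ar_def v_def PiE_iff)
  have Maps_comp: "Maps (v' \<cdot> ?u) i x = Maps v' 1 (s i x)"
    if "\<psi> 1 = Some k" "i \<in> {1,2}" "x \<in> snd (pair S T) i" "Base v' = \<psi>" for v' i x k
    using that Maps_fs_comp [of ?u i 1 v' k x] by auto
  have eq: "v' \<cdot> ?u = w \<longleftrightarrow> v' = v"
    if v': "fs_ar v'" "Src v' = sing U" "Tgt v' = Z" "Base v' = \<psi>" for v'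
  proof -
    \<comment> \<open>Existence and uniqueness of the factorization both follow from this
      equivalence.\<close>
    have agree: "(\<forall>y\<in>U. Maps v' 1 y = f y) \<longleftrightarrow>
        (\<forall>x\<in>S. Maps v' 1 (s 1 x) = Maps w 1 x) \<and> (\<forall>x\<in>T. Maps v' 1 (s 2 x) = Maps w 2 x)"
      unfolding s [symmetric] ball_Un using f f' by simp
    show ?thesis
    proof (intro iffI)
      assume vw: "v' \<cdot> ?u = w"
      show "v' = v"
      proof (rule fsar_eqI [OF v'(1) v])
        fix i y assume "i \<in> dom (Base v)" and y: "y \<in> snd (Src v) i"
        then obtain k where i: "i = 1" and k: "\<psi> 1 = Some k" using dom\<psi>(1) by (auto simp: v_def)
        have "\<forall>y\<in>U. Maps v' 1 y = f y"
          unfolding agree vw [symmetric]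
          using Maps_comp [OF k _ _ v'(4), of 1] Maps_comp [OF k _ _ v'(4), of 2] by simp
        then show "Maps v' i y = Maps v i y" using y k i by (simp add: v_def dom_def)
      qed (use v' in \<open>simp_all add: v_def\<close>)
    next
      assume vv: "v' = v"
      show "v' \<cdot> ?u = w"
      proof (rule fsar_eqI)
        show "fs_ar (v' \<cdot> ?u)" by (rule fs_ar_comp [OF u v'(1)]) (simp add: v'(2))
        fix i x assume i: "i \<in> dom (Base w)" and x: "x \<in> snd (Src w) i"
        obtain k where k: "\<psi> 1 = Some k" "i \<in> {1,2}" using i Bw by (auto split: if_splits)
        then have "\<forall>y\<in>U. Maps v' 1 y = f y" unfolding vv by (simp add: v_def dom_def)
        then have "Maps v' 1 (s i x) = Maps w i x"
          unfolding agree using x w k(2) by auto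
        then show "Maps (v' \<cdot> ?u) i x = Maps w i x"
          using Maps_comp [OF k _ v'(4)] x w by simp
      qed (use w v' in simp_all)
    qed
  qed
  show "\<exists>!v. fs_ar v \<and> Src v = Tgt ?u \<and> Tgt v = Z \<and> Base v = \<psi> \<and> v \<cdot> ?u = w"
  proof (rule ex1I [of _ v])
    show "fs_ar v \<and> Src v = Tgt ?u \<and> Tgt v = Z \<and> Base v = \<psi> \<and> v \<cdot> ?u = w"
      using v eq [of v] by (simp add: v_def)
  qed (use eq in auto)
qed

section \<open>The arrows of the statement and their commuting squares\<close>

lemma fs_cocartesian_c_ar: "fs_cocartesian c_ar"
  unfolding c_ar_def by (rule fs_cocartesian_join_ar) auto

lemma atLeast1_atMost4: "{1..4} = {1,2,3,4::nat}"
  by auto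

lemma fs_cocartesian_cbar_ar: "fs_cocartesian cbar_ar"
  unfolding cbar_ar_def atLeast1_atMost4 by (rule fs_cocartesian_join_ar) auto

lemma fs_ar_simps [simp]:
  "fs_ar c_ar" "fs_ar cbar_ar" "fs_ar mm_ar" "fs_ar m_ar" "fs_ar m2_ar" "fs_ar n_ar"
  using fs_cocartesian_c_ar fs_cocartesian_cbar_ar fs_ar_mm_ar
  unfolding fs_cocartesian_def m_ar_def m2_ar_def n_ar_def
  by (auto intro!: fs_ar_fs_map split: if_splits)

lemma fs_ar_p_q [simp]:
  assumes "i \<in> {1,2}"
  shows "fs_ar (p_ar i)" "fs_ar (q_ar i)"
  using assms by (auto simp: p_ar_def q_ar_def intro!: fs_ar_proj_ar)

lemma ar_simps [simp]:
  "Src c_ar = pair {1} {2}" "Tgt c_ar = sing {1,2}" "Base c_ar = [1 \<mapsto> 1, 2 \<mapsto> 1]"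
  "Src cbar_ar = pair {1,2} {1,2}" "Tgt cbar_ar = sing {1..4}" "Base cbar_ar = [1 \<mapsto> 1, 2 \<mapsto> 1]"
  "Src mm_ar = pair {1,2} {1,2}" "Tgt mm_ar = pair {1} {2}" "Base mm_ar = [1 \<mapsto> 1, 2 \<mapsto> 2]"
  "Src m_ar = sing {1,2}" "Tgt m_ar = sing {1}" "Base m_ar = [1 \<mapsto> 1]"
  "Src m2_ar = sing {1..4}" "Tgt m2_ar = sing {1,2}" "Base m2_ar = [1 \<mapsto> 1]"
  "Src n_ar = sing {1..4}" "Tgt n_ar = sing {1,2}" "Base n_ar = [1 \<mapsto> 1]"
  "Src (p_ar i) = pair {1} {2}" "Tgt (p_ar i) = sing {1}" "Base (p_ar i) = [i \<mapsto> 1]"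
  "Src (q_ar i) = pair {1,2} {1,2}" "Tgt (q_ar i) = sing {1,2}" "Base (q_ar i) = [i \<mapsto> 1]"
  by (simp_all add: c_ar_def cbar_ar_def mm_ar_def m_ar_def m2_ar_def n_ar_def fs_map_def
      p_ar_def q_ar_def proj_ar_def)

lemma Maps_simps [simp]:
  "x \<in> {1,2} \<Longrightarrow> Maps m_ar 1 x = 1"
  "x \<in> {1..4} \<Longrightarrow> Maps n_ar 1 x = (if odd x then 1 else 2)"
  "x \<in> {1..4} \<Longrightarrow> Maps m2_ar 1 x = (if x \<le> 2 then 1 else 2)"
  "x \<in> {1,2} \<Longrightarrow> Maps cbar_ar 1 x = 2 * x - 1" "x \<in> {1,2} \<Longrightarrow> Maps cbar_ar 2 x = 2 * x"
  "Maps c_ar 1 1 = 1" "Maps c_ar 2 2 = 2"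
  "\<lbrakk>i \<in> {1,2}; x \<in> {1,2}\<rbrakk> \<Longrightarrow> Maps mm_ar i x = i"
  "i \<in> {1,2} \<Longrightarrow> Maps (p_ar i) i i = 1" "\<lbrakk>i \<in> {1,2}; x \<in> {1,2}\<rbrakk> \<Longrightarrow> Maps (q_ar i) i x = x"
  unfolding c_ar_def cbar_ar_def mm_ar_def m_ar_def m2_ar_def n_ar_def fs_map_def
    p_ar_def q_ar_def proj_ar_def join_ar_def
  by auto

text \<open>The identities \<open>m_n_eq\<close>, \<open>c_mm_eq\<close> and \<open>p_mm_eq\<close>
  give rise to the cells \<beta>, \<sigma> and \<tau> respectively.\<close>

lemma m_n_eq: "m_ar \<cdot> n_ar = m_ar \<cdot> m2_ar"
proof (rule fsar_eqI)
  fix i x assume "i \<in> dom (Base (m_ar \<cdot> m2_ar))" "x \<in> snd (Src (m_ar \<cdot> m2_ar)) i"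
  then have "i = 1" "x \<in> {1..4}" by (auto simp: map_comp_def dom_def split: if_splits)
  then show "Maps (m_ar \<cdot> n_ar) i x = Maps (m_ar \<cdot> m2_ar) i x"
    using Maps_fs_comp [of n_ar 1 1 m_ar 1 x] Maps_fs_comp [of m2_ar 1 1 m_ar 1 x] by simp
qed (simp_all add: fs_ar_comp)

text \<open>\<open>cbar_ar\<close> sends the first copy of \<open>{1,2}\<close> to the odd and the
  second to the even numbers, so \<open>n_ar\<close> afterwards recovers the copy, just as
  \<open>mm_ar\<close> records it.\<close>

lemma c_mm_eq: "c_ar \<cdot> mm_ar = n_ar \<cdot> cbar_ar"
proof (rule fsar_eqI)
  fix i x assume "i \<in> dom (Base (n_ar \<cdot> cbar_ar))" "x \<in> snd (Src (n_ar \<cdot> cbar_ar)) i"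
  then have i: "i \<in> {1,2}" and x: "x \<in> {1,2}"
    by (auto simp: map_comp_def dom_def split: if_splits)
  then have "Maps cbar_ar i x \<in> {1..4}" "odd (Maps cbar_ar i x) \<longleftrightarrow> i = 1" by auto
  then show "Maps (c_ar \<cdot> mm_ar) i x = Maps (n_ar \<cdot> cbar_ar) i x"
    using Maps_fs_comp [of mm_ar i i c_ar 1 x] Maps_fs_comp [of cbar_ar i 1 n_ar 1 x] i x by auto
qed (auto simp: fs_ar_comp map_comp_def)

lemma p_mm_eq: "i \<in> {1,2} \<Longrightarrow> p_ar i \<cdot> mm_ar = m_ar \<cdot> q_ar i"
proof (rule fsar_eqI)
  assume i: "i \<in> {1,2}"
  fix j x assume "j \<in> dom (Base (m_ar \<cdot> q_ar i))" "x \<in> snd (Src (m_ar \<cdot> q_ar i)) j"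
  then have "j = i" and x: "x \<in> {1,2}"
    using i by (auto simp: map_comp_def dom_def split: if_splits)
  then show "Maps (p_ar i \<cdot> mm_ar) j x = Maps (m_ar \<cdot> q_ar i) j x"
    using Maps_fs_comp [of mm_ar i i "p_ar i" 1 x] Maps_fs_comp [of "q_ar i" i 1 m_ar 1 x] i by auto
qed (auto simp: fs_ar_comp map_comp_def)

lemma cartesian_square_m:
  "cartesian_square {1..4} {1,2} {1,2} {1} (\<lambda>x. if odd x then 1 else 2) (\<lambda>x. if x \<le> 2 then 1 else 2)
    (\<lambda>_. 1) (\<lambda>_. 1)"
  unfolding cartesian_square_def
proof (intro conjI allI impI)
  let ?g = "\<lambda>x::nat. if odd x then 1 else 2 :: nat" and ?f = "\<lambda>x::nat. if x \<le> 2 then 1 else 2 :: nat"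
  fix T :: "nat set" and p q :: "nat \<Rightarrow> nat"
  assume T: "finite T \<and> p \<in> T \<rightarrow> {1,2} \<and> q \<in> T \<rightarrow> {1,2} \<and> (\<forall>t\<in>T. (1::nat) = 1)"
  have inj: "a = b" if "a \<in> {1..4}" "b \<in> {1..4}" "?g a = ?g b" "?f a = ?f b" for a b
    using that unfolding atLeast1_atMost4 by (auto split: if_splits)
  \<comment> \<open>A number from 1 to 4 is determined by its parity and by whether it is at most 2:
    the pair \<open>(a, 1)\<close> belongs to \<open>a\<close> and the pair \<open>(a, 2)\<close> to
    \<open>a + 2\<close>.\<close>
  let ?r = "\<lambda>t\<in>T. if q t = 1 then p t else p t + 2"
  show "\<exists>!r. r \<in> T \<rightarrow>\<^sub>E {1..4} \<and> (\<forall>t\<in>T. ?g (r t) = p t \<and> ?f (r t) = q t)"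
  proof (rule ex1I [of _ ?r])
    have *: "?r t \<in> {1..4} \<and> ?g (?r t) = p t \<and> ?f (?r t) = q t" if "t \<in> T" for t
    proof -
      have "p t \<in> {1,2}" "q t \<in> {1,2}" using T that by auto
      then show ?thesis using that by auto
    qed
    show r: "?r \<in> T \<rightarrow>\<^sub>E {1..4} \<and> (\<forall>t\<in>T. ?g (?r t) = p t \<and> ?f (?r t) = q t)"
      by (intro conjI ballI PiE_I) (use * in blast | simp)+
    fix r assume r': "r \<in> T \<rightarrow>\<^sub>E {1..4} \<and> (\<forall>t\<in>T. ?g (r t) = p t \<and> ?f (r t) = q t)"
    show "r = ?r"
    proof (rule PiE_ext)
      show "r \<in> T \<rightarrow>\<^sub>E {1..4}" "?r \<in> T \<rightarrow>\<^sub>E {1..4}" using r r' by blast+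
      fix t assume t: "t \<in> T"
      show "r t = ?r t"
        by (rule inj) (use * [OF t] r' t in \<open>auto simp del: restrict_apply split del: if_split\<close>)
    qed
  qed
qed auto

section \<open>Whiskering\<close>

lemma fcomp_assoc: "(K \<odot> G) \<odot> F = K \<odot> (G \<odot> F)"
  by (simp add: fcomp_def)

lemma fcomp_id [simp]: "F \<odot> id_fctr = F" "id_fctr \<odot> F = F"
  by (simp_all add: fcomp_def id_fctr_def)

lemma cat_transI:
  "\<lbrakk>cat_functor C D F; cat_functor C D G; nat_trans C D F G t\<rbrakk> \<Longrightarrow> cat_trans C D F G t"
  by (simp add: cat_trans_def cat_trans_axioms_def)

lemma cat_trans_vcomp:
  assumes "cat_trans C D F G s" "cat_trans C D G K t"
  shows "cat_trans C D F K (\<lambda>X. Cmp D (t X) (s X))"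
proof -
  interpret s: cat_trans C D F G s by fact
  interpret t: cat_trans C D G K t by fact
  show ?thesis
  proof (rule cat_transI)
    show "nat_trans C D F K (\<lambda>X. Cmp D (t X) (s X))"
    proof (rule nat_transI)
      fix f assume f: "f \<in> Ar C"
      then show "Cmp D (Cmp D (t (Cod C f)) (s (Cod C f))) (FA F f) =
          Cmp D (FA K f) (Cmp D (t (Dom C f)) (s (Dom C f)))"
        using t.naturality_assoc [of f "s (Dom C f)"] by (simp add: s.naturality)
    qed simp_all
  qed unfold_locales
qed

lemma cat_trans_whisker_left:
  assumes "cat_trans C D F G s" "cat_functor D E K"
  shows "cat_trans C E (K \<odot> F) (K \<odot> G) (\<lambda>X. FA K (s X))"
proof -
  interpret s: cat_trans C D F G s by fact
  interpret K: cat_functor D E K by fact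
  show ?thesis
  proof (rule cat_transI)
    show "nat_trans C E (K \<odot> F) (K \<odot> G) (\<lambda>X. FA K (s X))"
      by (rule nat_transI) (simp_all add: s.naturality flip: K.FA_Cmp)
  qed (use assms(2) s.source.cat_functor_axioms s.target.cat_functor_axioms cat_functor_fcomp in blast)+
qed

lemma cat_trans_whisker_right:
  assumes "cat_trans D E F G s" "cat_functor C D K"
  shows "cat_trans C E (F \<odot> K) (G \<odot> K) (\<lambda>X. s (FO K X))"
proof -
  interpret s: cat_trans D E F G s by fact
  interpret K: cat_functor C D K by fact
  show ?thesis
  proof (rule cat_transI)
    show "nat_trans C E (F \<odot> K) (G \<odot> K) (\<lambda>X. s (FO K X))"
    proof (rule nat_transI)
      fix f assume "f \<in> Ar C"
      then show "Cmp E (s (FO K (Cod C f))) (FA (F \<odot> K) f) = Cmp E (FA (G \<odot> K) f) (s (FO K (Dom C f)))"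
        using s.naturality [of "FA K f"] by simp
    qed simp_all
  qed (use assms(2) s.source.cat_functor_axioms s.target.cat_functor_axioms cat_functor_fcomp in blast)+
qed

text \<open>\<open>sq_cell\<close> has this form: both comparisons end in the image \<open>K\<close>
  of the common composite.\<close>

lemma cat_iso_quotient:
  assumes "cat_functor C D F" "cat_functor C D F'" "cat_functor C D K"
    and "nat_iso C D F K s" "nat_iso C D F' K s'"
  shows "cat_iso C D F F' (\<lambda>A. Cmp D (inv_ar D (s' A)) (s A))"
proof -
  interpret s: cat_iso C D F K s using assms by (intro cat_isoI)
  interpret s': cat_iso C D F' K s' using assms by (intro cat_isoI)
  interpret i: cat_iso C D K F' "\<lambda>A. inv_ar D (s' A)" by (rule s'.inverse)
  interpret cat_trans C D F F' "\<lambda>A. Cmp D (inv_ar D (s' A)) (s A)"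
    by (rule cat_trans_vcomp [OF s.cat_trans_axioms i.cat_trans_axioms])
  show ?thesis
    by unfold_locales (simp add: s.source.target.is_iso_Cmp s.iso i.iso s'.iso)
qed

section \<open>The functors and cells of a pseudofunctor\<close>

context pseudofunctor
begin

lemma graded_HOb: "\<lbrakk>fs_ob X; i \<in> fst X\<rbrakk> \<Longrightarrow> graded (HOb H X i)"
  using HOb by (simp add: tv_ob_def img_def graded_def)

lemma graded_HS: "finite S \<Longrightarrow> graded (HS H S)"
  by (rule graded_HOb) simp_all

lemma multi_mor_HAr:
  "\<lbrakk>fs_ar u; j \<in> fst (Tgt u)\<rbrakk> \<Longrightarrow>
    multi_mor (fib (Base u) j) (HOb H (Src u)) (HOb H (Tgt u) j) (HAr H u j)"
  using HAr by (simp add: tv_mor_def img_def)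

lemma category_mdom_fib:
  assumes "fs_ar u"
  shows "category (mdom (fib (Base u) j) (HOb H (Src u)))"
proof (intro category_prodc category_tot_graded graded_HOb)
  show "fs_ob (Src u)" using assms by (simp add: fs_ar_def)
  show "i \<in> fst (Src u)" if "i \<in> fib (Base u) j" for i
    using that assms by (auto simp: fs_ar_def ptd_map_def fib_def)
qed

lemma cat_functor_HAr:
  assumes u: "fs_ar u" and j: "j \<in> fst (Tgt u)"
  shows "cat_functor (mdom (fib (Base u) j) (HOb H (Src u))) (tot (HOb H (Tgt u) j)) (HAr H u j)"
  using category_mdom_fib [OF u, of j] category_tot_graded [OF graded_HOb, of "Tgt u" j] multi_mor_HAr [OF u j] u j
  by (simp add: cat_functor_def cat_functor_axioms_def multi_mor_def multi_exact_def fs_ar_def)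

lemma cat_functor_unary_HAr:
  assumes u: "fs_ar u" and j: "j \<in> fst (Tgt u)" and i: "fib (Base u) j = {i}"
  shows "cat_functor (tot (HOb H (Src u) i)) (tot (HOb H (Tgt u) j)) (unary i (HAr H u j))"
proof -
  have "i \<in> fst (Src u)" using u i by (auto simp: fs_ar_def ptd_map_def fib_def)
  then have "category (tot (HOb H (Src u) i))"
    using u by (intro category_tot_graded graded_HOb) (auto simp: fs_ar_def)
  then show ?thesis
    using cat_functor_HAr [OF u j] is_functor_unary [of i "HOb H (Src u)" "tot (HOb H (Tgt u) j)" "HAr H u j"]
    unfolding i by (simp add: cat_functor_def cat_functor_axioms_def)
qed

text \<open>The functors \<open>F\<close> and \<open>F'\<close> below are simplified forms of the composites of the two sides of the
  square.\<close>

lemma cat_iso_sq_cell: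
  assumes ar: "fs_ar u" "fs_ar v" "fs_ar u'" "fs_ar v'" "Src v = Tgt u" "Src v' = Tgt u'"
    and eq: "v \<cdot> u = v' \<cdot> u'" and j: "j \<in> fst (Tgt v)"
    and F: "cat_functor (mdom (fib (Base (v \<cdot> u)) j) (HOb H (Src u))) (tot (HOb H (Tgt v) j)) F"
    and F': "cat_functor (mdom (fib (Base (v \<cdot> u)) j) (HOb H (Src u))) (tot (HOb H (Tgt v) j)) F'"
    and FO: "\<And>X. X \<in> Ob (mdom (fib (Base (v \<cdot> u)) j) (HOb H (Src u))) \<Longrightarrow>
        FO (tv_comp (Base u) (Base v) (HAr H v) (HAr H u) j) X = FO F X \<and>
        FO (tv_comp (Base u') (Base v') (HAr H v') (HAr H u') j) X = FO F' X"
    and FA: "\<And>f. f \<in> Ar (mdom (fib (Base (v \<cdot> u)) j) (HOb H (Src u))) \<Longrightarrow>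
        FA (tv_comp (Base u) (Base v) (HAr H v) (HAr H u) j) f = FA F f \<and>
        FA (tv_comp (Base u') (Base v') (HAr H v') (HAr H u') j) f = FA F' f"
  shows "cat_iso (mdom (fib (Base (v \<cdot> u)) j) (HOb H (Src u))) (tot (HOb H (Tgt v) j)) F F'
    (sq_cell H v u v' u' j)"
proof -
  let ?C = "mdom (fib (Base (v \<cdot> u)) j) (HOb H (Src u))" and ?D = "tot (HOb H (Tgt v) j)"
  have vu: "fs_ar (v \<cdot> u)" using ar by (intro fs_ar_comp)
  have same: "Src u' = Src u" "Tgt v' = Tgt v" "Base v' \<circ>\<^sub>m Base u' = Base v \<circ>\<^sub>m Base u"
    using fs_comp_simps [of v u] fs_comp_simps [of v' u'] unfolding eq by simp_all
  have K: "cat_functor ?C ?D (HAr H (v \<cdot> u) j)"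
    using cat_functor_HAr [OF vu] j by simp
  note cat = category_mdom_fib [OF vu, of j, unfolded fs_comp_simps(1)]
  have "nat_iso ?C ?D (tv_comp (Base u) (Base v) (HAr H v) (HAr H u) j) (HAr H (v \<cdot> u) j) (HCmp H v u j)"
    using HCmp [OF ar(1,2,5)] j by (simp add: tv_iso_def img_def)
  then have s: "nat_iso ?C ?D F (HAr H (v \<cdot> u) j) (HCmp H v u j)"
    by (rule nat_iso_cong [OF _ cat]) (use FO FA in auto)
  have "nat_iso ?C ?D (tv_comp (Base u') (Base v') (HAr H v') (HAr H u') j) (HAr H (v \<cdot> u) j) (HCmp H v' u' j)"
    using HCmp [OF ar(3,4,6)] j same by (simp add: tv_iso_def img_def eq)
  then have s': "nat_iso ?C ?D F' (HAr H (v \<cdot> u) j) (HCmp H v' u' j)"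
    by (rule nat_iso_cong [OF _ cat]) (use FO FA in auto)
  show ?thesis
    using cat_iso_quotient [OF F F' K s s'] by (simp add: sq_cell_def [abs_def] Let_def)
qed

text \<open>The case in which each side of the square passes through a single index. The cell is
  moved from the one-factor product to the total category, where adjoints and mates are
  formed.\<close>

lemma cat_iso_unary_sq_cell:
  assumes ar: "fs_ar u" "fs_ar v" "fs_ar u'" "fs_ar v'" "Src v = Tgt u" "Src v' = Tgt u'"
    and eq: "v \<cdot> u = v' \<cdot> u'" and j: "j \<in> fst (Tgt v)"
    and b: "Base u = [i \<mapsto> k]" "fib (Base v) j = {k}" "fib (Base u') k' = {i}" "fib (Base v') j = {k'}"
  shows "cat_iso (tot (HOb H (Src u) i)) (tot (HOb H (Tgt v) j))
    (unary k (HAr H v j) \<odot> unary i (HAr H u k)) (unary k' (HAr H v' j) \<odot> unary i (HAr H u' k'))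
    (\<lambda>X. sq_cell H v u v' u' j (\<lambda>l\<in>{i}. X))"
proof -
  let ?C = "mdom {i} (HOb H (Src u))" and ?D = "tot (HOb H (Tgt v) j)"
  have same: "Src u' = Src u" "Tgt v' = Tgt v"
    using fs_comp_simps [of v u] fs_comp_simps [of v' u'] unfolding eq by simp_all
  have "k \<in> fst (Tgt u)" "k' \<in> fst (Tgt u')"
    using fs_arE(3) [OF ar(1), of i k] fs_arE(3) [OF ar(3), of i k'] b by (auto simp: fib_def)
  then have F: "cat_functor (tot (HOb H (Src u) i)) ?D (unary k (HAr H v j) \<odot> unary i (HAr H u k))"
    and F': "cat_functor (tot (HOb H (Src u) i)) ?D (unary k' (HAr H v' j) \<odot> unary i (HAr H u' k'))"
    using cat_functor_unary_HAr [OF ar(1), of k i] cat_functor_unary_HAr [OF ar(2) j b(2)]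
      cat_functor_unary_HAr [OF ar(3), of k' i] cat_functor_unary_HAr [OF ar(4), of j k'] b j ar same
    by (auto intro!: cat_functor_fcomp)
  have vu: "fs_ar (v \<cdot> u)" using ar by (intro fs_ar_comp)
  have fib: "fib (Base (v \<cdot> u)) j = {i}"
    using b by (auto simp: fib_def map_comp_def split: if_splits)
  have K: "cat_functor (tot (HOb H (Src u) i)) ?D (unary i (HAr H (v \<cdot> u) j))"
    using cat_functor_unary_HAr [OF vu _ fib] j by simp
  have cat: "category (tot (HOb H (Src u) i))" using F by (simp add: cat_functor_def)
  have r: "(\<lambda>l\<in>{k}. g l (restrict (\<lambda>l\<in>{i}. x) (fib (Base u) l))) = (\<lambda>l\<in>{k}. g k (\<lambda>l\<in>{i}. x))"
    "(\<lambda>l\<in>{k'}. g l (restrict (\<lambda>l\<in>{i}. x) (fib (Base u') l))) = (\<lambda>l\<in>{k'}. g k' (\<lambda>l\<in>{i}. x))"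
    for g :: "nat \<Rightarrow> (nat \<Rightarrow> 'x) \<Rightarrow> 'y" and x
    using b by (auto simp: restrict_eq_iff)
  have comp: "FO (tv_comp (Base u) (Base v) (HAr H v) (HAr H u) j) (\<lambda>l\<in>{i}. X) =
        FO (unary k (HAr H v j) \<odot> unary i (HAr H u k)) X"
      "FA (tv_comp (Base u) (Base v) (HAr H v) (HAr H u) j) (\<lambda>l\<in>{i}. f) =
        FA (unary k (HAr H v j) \<odot> unary i (HAr H u k)) f"
      "FO (tv_comp (Base u') (Base v') (HAr H v') (HAr H u') j) (\<lambda>l\<in>{i}. X) =
        FO (unary k' (HAr H v' j) \<odot> unary i (HAr H u' k')) X"
      "FA (tv_comp (Base u') (Base v') (HAr H v') (HAr H u') j) (\<lambda>l\<in>{i}. f) =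
        FA (unary k' (HAr H v' j) \<odot> unary i (HAr H u' k')) f" for X f
    unfolding tv_comp_def spread_ob_def spread_ar_def b(2,4) fctr.simps fcomp_simps unary_simps
      r(1) [of "\<lambda>l. FO (HAr H u l)"] r(1) [of "\<lambda>l. FA (HAr H u l)"]
      r(2) [of "\<lambda>l. FO (HAr H u' l)"] r(2) [of "\<lambda>l. FA (HAr H u' l)"]
    by (rule refl)+
  have "nat_iso ?C ?D (tv_comp (Base u) (Base v) (HAr H v) (HAr H u) j) (HAr H (v \<cdot> u) j) (HCmp H v u j)"
    using HCmp [OF ar(1,2,5), unfolded tv_iso_def, THEN bspec, of j] j fib by (simp add: img_def)
  from nat_iso_unary [OF this]
  have "nat_iso (tot (HOb H (Src u) i)) ?D (unary k (HAr H v j) \<odot> unary i (HAr H u k))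
      (unary i (HAr H (v \<cdot> u) j)) (\<lambda>X. HCmp H v u j (\<lambda>l\<in>{i}. X))"
    by (rule nat_iso_cong [OF _ cat]) (simp_all only: comp unary_simps)
  moreover have "nat_iso ?C ?D (tv_comp (Base u') (Base v') (HAr H v') (HAr H u') j) (HAr H (v \<cdot> u) j) (HCmp H v' u' j)"
    using HCmp [OF ar(3,4,6), unfolded tv_iso_def, THEN bspec, of j] j same fib
    by (simp add: img_def eq)
  from nat_iso_unary [OF this]
  have "nat_iso (tot (HOb H (Src u) i)) ?D (unary k' (HAr H v' j) \<odot> unary i (HAr H u' k'))
      (unary i (HAr H (v \<cdot> u) j)) (\<lambda>X. HCmp H v' u' j (\<lambda>l\<in>{i}. X))"
    by (rule nat_iso_cong [OF _ cat]) (simp_all only: comp unary_simps)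
  ultimately show ?thesis
    using cat_iso_quotient [OF F F' K] by (simp add: sq_cell_def Let_def)
qed

section \<open>The functors and cells attached to multiplication and external products\<close>

abbreviation "C1 \<equiv> tot (HS H {1})"
abbreviation "C2 \<equiv> tot (HS H {1,2})"
abbreviation "C4 \<equiv> tot (HS H {1..4})"
abbreviation "P \<equiv> HOb H (pair {1} {2})"
abbreviation "Q \<equiv> HOb H (pair {1,2} {1,2})"
abbreviation "PP \<equiv> mdom {1,2} P"
abbreviation "QQ \<equiv> mdom {1,2} Q"
abbreviation "m \<equiv> m_fun H"
abbreviation "m2 \<equiv> m2_fun H"
abbreviation "n \<equiv> unary 1 (HAr H n_ar 1)"
abbreviation "p i \<equiv> unary i (HAr H (p_ar i) 1)"
abbreviation "q i \<equiv> unary i (HAr H (q_ar i) 1)"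
abbreviation "M i \<equiv> unary i (HAr H mm_ar i)"
abbreviation "MM \<equiv> prodf {1,2} M"
abbreviation "c \<equiv> HAr H c_ar 1"
abbreviation "d \<equiv> HAr H cbar_ar 1"
abbreviation "\<tau> i A \<equiv> sq_cell H m_ar (q_ar i) (p_ar i) mm_ar 1 (\<lambda>k\<in>{i}. A)"
abbreviation "\<sigma> \<equiv> sq_cell H c_ar mm_ar n_ar cbar_ar 1"
abbreviation "\<beta> A \<equiv> sq_cell H m_ar n_ar m_ar m2_ar 1 (\<lambda>k\<in>{1}. A)"

lemma fun_unary: "m = unary 1 (HAr H m_ar 1)" "m2 = unary 1 (HAr H m2_ar 1)"
  by (simp_all add: m_fun_def m2_fun_def HM_def m_ar_def m2_ar_def)

lemma graded_P: "i \<in> {1,2} \<Longrightarrow> graded (P i)"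
  and graded_Q: "i \<in> {1,2} \<Longrightarrow> graded (Q i)"
  by (rule graded_HOb; simp)+

lemma functor_m: "cat_functor C2 C1 m"
  and functor_n: "cat_functor C4 C2 n"
  using cat_functor_unary_HAr [of m_ar 1 1] cat_functor_unary_HAr [of n_ar 1 1]
  by (simp_all add: fun_unary)

lemma functor_p: "i \<in> {1,2} \<Longrightarrow> cat_functor (tot (P i)) C1 (p i)"
  and functor_q: "i \<in> {1,2} \<Longrightarrow> cat_functor (tot (Q i)) C2 (q i)"
  and functor_M: "i \<in> {1,2} \<Longrightarrow> cat_functor (tot (Q i)) (tot (P i)) (M i)"
  using cat_functor_unary_HAr [of "p_ar i" 1 i] cat_functor_unary_HAr [of "q_ar i" 1 i]
    cat_functor_unary_HAr [of mm_ar i i]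
  by auto

lemma functor_c: "cat_functor PP C2 c"
  and functor_d: "cat_functor QQ C4 d"
  using cat_functor_HAr [of c_ar 1] cat_functor_HAr [of cbar_ar 1] by simp_all

lemma functor_MM: "cat_functor QQ PP MM"
  by (rule cat_functor_prodf) (rule functor_M)

lemma iso_\<tau>: "i \<in> {1,2} \<Longrightarrow> cat_iso (tot (Q i)) C1 (m \<odot> q i) (p i \<odot> M i) (\<tau> i)"
  using cat_iso_unary_sq_cell [of "q_ar i" m_ar mm_ar "p_ar i" 1 i 1 i] p_mm_eq [of i]
  unfolding fun_unary by auto

lemma iso_\<beta>: "cat_iso C4 C1 (m \<odot> n) (m \<odot> m2) \<beta>"
  using cat_iso_unary_sq_cell [of n_ar m_ar m2_ar m_ar 1 1 1 1] m_n_eq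
  unfolding fun_unary by simp

lemma iso_\<sigma>: "cat_iso QQ C2 (c \<odot> MM) (n \<odot> d) \<sigma>"
proof -
  have b: "[1 \<mapsto> 1, 2 \<mapsto> 1] \<circ>\<^sub>m [1 \<mapsto> 1, 2 \<mapsto> 2] = [1 \<mapsto> 1::nat, 2::nat \<mapsto> 1]"
    by (auto simp: map_comp_def fun_eq_iff)
  have r: "(\<lambda>l\<in>{1,2}. g l (restrict A (fib [1 \<mapsto> 1, 2 \<mapsto> 2] l))) = (\<lambda>l\<in>{1,2}. g l (\<lambda>k\<in>{l}. A l))"
    "A \<in> extensional {1,2} \<Longrightarrow>
      (\<lambda>l\<in>{1}. g l (restrict A (fib [1 \<mapsto> 1, 2 \<mapsto> 1] l))) = (\<lambda>l\<in>{1}. g 1 A)"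
    for g :: "nat \<Rightarrow> (nat \<Rightarrow> 'x) \<Rightarrow> 'y" and A
    by (auto simp: restrict_eq_iff extensional_restrict intro!: arg_cong [of _ _ "g _"])
  have "cat_iso (mdom (fib (Base (c_ar \<cdot> mm_ar)) 1) (HOb H (Src mm_ar))) (tot (HOb H (Tgt c_ar) 1))
      (c \<odot> MM) (n \<odot> d) \<sigma>"
  proof (rule cat_iso_sq_cell [OF _ _ _ _ _ _ c_mm_eq])
    show "cat_functor (mdom (fib (Base (c_ar \<cdot> mm_ar)) 1) (HOb H (Src mm_ar)))
        (tot (HOb H (Tgt c_ar) 1)) (c \<odot> MM)"
      using cat_functor_fcomp [OF functor_MM functor_c] by (simp add: b)
    show "cat_functor (mdom (fib (Base (c_ar \<cdot> mm_ar)) 1) (HOb H (Src mm_ar)))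
        (tot (HOb H (Tgt c_ar) 1)) (n \<odot> d)"
      using cat_functor_fcomp [OF functor_d functor_n] by (simp add: b)
  qed (simp_all add: b tv_comp_def spread_ob_def spread_ar_def PiE_iff
      r(1) [of "\<lambda>l. FO (HAr H mm_ar l)"] r(1) [of "\<lambda>l. FA (HAr H mm_ar l)"]
      r(2) [of _ "\<lambda>l. FO (HAr H cbar_ar l)"] r(2) [of _ "\<lambda>l. FA (HAr H cbar_ar l)"])
  then show ?thesis by (simp add: b)
qed

lemma bounded_exact_n: "bounded_exact (HS H {1..4}) (HS H {1,2}) n"
  using bounded_exact_unary [of "HOb H (sing {1..4})" 1] multi_mor_HAr [of n_ar 1]
    graded_HS [of "{1..4}"]
  by simp

end

declare unary_simps [simp del]

lemma gr_adj_cat_adj: "\<lbrakk>gr_adj C D A; graded C; graded D\<rbrakk> \<Longrightarrow> cat_adj (tot C) (tot D) A"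
  by (simp add: gr_adj_def cat_adj_def cat_adj_axioms_def category_tot_graded)

lemma gr_adj_exact: "gr_adj C D A \<Longrightarrow> exact_functor (tot C) (tot D) (LF A)"
  "gr_adj C D A \<Longrightarrow> exact_functor (tot D) (tot C) (RF A)"
  by (simp_all add: gr_adj_def gr_mor_def)

section \<open>The left adjoint of the multiplication on both factors\<close>

locale ssh_identified = ssh_category H for H :: "('k::field_char_0, 'o, 'a) psdata" +
  fixes e e' :: "nat \<Rightarrow> ('o, 'a) gadj" and al :: "('o, 'a) gadj"
  assumes p_id: "p_identification H e" and q_id: "q_identification H e'"
    and al: "gr_adj (HS H {1}) (HS H {1,2}) al" and RF_al: "RF al = m_fun H"
begin

lemma gr_adj_e: "i \<in> {1,2} \<Longrightarrow> gr_adj (HS H {1}) (P i) (e i)"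
  and gr_adj_e': "i \<in> {1,2} \<Longrightarrow> gr_adj (HS H {1,2}) (Q i) (e' i)"
  and RF_e: "i \<in> {1,2} \<Longrightarrow> RF (e i) = p i"
  and RF_e': "i \<in> {1,2} \<Longrightarrow> RF (e' i) = q i"
  and iso_Counit_e: "\<lbrakk>i \<in> {1,2}; A \<in> Ob (tot (P i))\<rbrakk> \<Longrightarrow> is_iso (tot (P i)) (Counit (e i) A)"
  using p_id q_id by (auto simp: p_identification_def q_identification_def gr_adj_equiv_def)

lemma adj_e: "i \<in> {1,2} \<Longrightarrow> cat_adj C1 (tot (P i)) (e i)"
  by (intro gr_adj_cat_adj gr_adj_e graded_HS graded_P) simp_all

lemma adj_e': "i \<in> {1,2} \<Longrightarrow> cat_adj C2 (tot (Q i)) (e' i)"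
  by (intro gr_adj_cat_adj gr_adj_e' graded_HS graded_Q) simp_all

lemma adj_al: "cat_adj C1 C2 al"
  by (intro gr_adj_cat_adj al graded_HS) simp_all

sublocale al: cat_adj C1 C2 al
  by (rule adj_al)

abbreviation "tr i \<equiv> mm_transport H e e' i"

text \<open>This left mate is pasted from the unit of \<open>e' i\<close>, the cell
  \<open>\<tau> i\<close> and the counit of \<open>e i\<close>, each of them whiskered.\<close>

lemma trans_tr:
  assumes i: "i \<in> {1,2}"
  shows "cat_trans C2 (tot (P i)) (LF (e i) \<odot> m) (M i \<odot> LF (e' i)) (tr i)"
proof -
  interpret e: cat_adj C1 "tot (P i)" "e i" by (rule adj_e [OF i])
  interpret e': cat_adj C2 "tot (Q i)" "e' i" by (rule adj_e' [OF i])
  interpret \<tau>: cat_iso "tot (Q i)" C1 "m \<odot> q i" "p i \<odot> M i" "\<tau> i" by (rule iso_\<tau> [OF i])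
  have me: "cat_functor C2 (tot (P i)) (LF (e i) \<odot> m)"
    by (rule cat_functor_fcomp [OF functor_m e.LF.cat_functor_axioms])
  have Me': "cat_functor C2 (tot (P i)) (M i \<odot> LF (e' i))"
    by (rule cat_functor_fcomp [OF e'.LF.cat_functor_axioms functor_M [OF i]])
  have 1: "cat_trans C2 (tot (P i)) (LF (e i) \<odot> m) (LF (e i) \<odot> m \<odot> q i \<odot> LF (e' i))
      (\<lambda>X. FA (LF (e i)) (FA m (Unit (e' i) X)))"
    using cat_trans_whisker_left [OF e'.unit.cat_trans_axioms me]
    by (simp add: fcomp_assoc RF_e' [OF i])
  have 2: "cat_trans C2 (tot (P i)) (LF (e i) \<odot> m \<odot> q i \<odot> LF (e' i))
      (LF (e i) \<odot> p i \<odot> M i \<odot> LF (e' i)) (\<lambda>X. FA (LF (e i)) (\<tau> i (FO (LF (e' i)) X)))"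
    using cat_trans_whisker_left [OF cat_trans_whisker_right [OF \<tau>.cat_trans_axioms
      e'.LF.cat_functor_axioms] e.LF.cat_functor_axioms]
    by (simp add: fcomp_assoc)
  have 3: "cat_trans C2 (tot (P i)) (LF (e i) \<odot> p i \<odot> M i \<odot> LF (e' i)) (M i \<odot> LF (e' i))
      (\<lambda>X. Counit (e i) (FO (M i) (FO (LF (e' i)) X)))"
    using cat_trans_whisker_right [OF e.counit.cat_trans_axioms Me']
    by (simp add: fcomp_assoc RF_e [OF i])
  show ?thesis
    using cat_trans_vcomp [OF cat_trans_vcomp [OF 1 2] 3]
    by (simp add: mm_transport_def left_mate_def [abs_def])
qed

text \<open>The unit of \<open>\<Delta>\<^sup>l \<stileturn> m\<close>, transported to the
  \<open>i\<close>-th components of \<open>H({1},{2})\<close> and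
  \<open>H({1,2},{1,2})\<close>.\<close>

definition v :: "nat \<Rightarrow> (nat \<Rightarrow> 'o) \<Rightarrow> nat \<Rightarrow> 'a" where
  "v i X = Cmp (tot (P i)) (tr i (FO (LF al) X)) (FA (LF (e i)) (Unit al X))"

lemma trans_v:
  assumes i: "i \<in> {1,2}"
  shows "cat_trans C1 (tot (P i)) (LF (e i)) (M i \<odot> LF (e' i) \<odot> LF al) (v i)"
proof -
  interpret e: cat_adj C1 "tot (P i)" "e i" by (rule adj_e [OF i])
  have 1: "cat_trans C1 (tot (P i)) (LF (e i)) (LF (e i) \<odot> m \<odot> LF al)
      (\<lambda>X. FA (LF (e i)) (Unit al X))"
    using cat_trans_whisker_left [OF al.unit.cat_trans_axioms e.LF.cat_functor_axioms]
    by (simp add: fcomp_assoc RF_al)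
  have 2: "cat_trans C1 (tot (P i)) (LF (e i) \<odot> m \<odot> LF al) (M i \<odot> LF (e' i) \<odot> LF al)
      (\<lambda>X. tr i (FO (LF al) X))"
    by (rule cat_trans_whisker_right [OF trans_tr [OF i] al.LF.cat_functor_axioms])
  show ?thesis
    using cat_trans_vcomp [OF 1 2] by (simp add: v_def [abs_def])
qed

text \<open>The units of \<open>al\<close> and \<open>e' i\<close> compose to a universal arrow from
  \<open>X\<close> to \<open>m \<odot> q i\<close>, which \<open>\<tau> i\<close> turns into one to
  \<open>p i \<odot> M i\<close>. Its transpose under \<open>e i\<close> is \<open>v i X\<close>, so
  cancelling the universal unit of \<open>e i\<close> leaves the claim.\<close>

lemma univ_v:
  assumes i: "i \<in> {1,2}" and X: "X \<in> Ob C1"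
  shows "univ_arrow (tot (P i)) (tot (Q i)) (M i) (FO (LF (e i)) X) (FO (LF (e' i)) (FO (LF al) X)) (v i X)"
proof -
  interpret e: cat_adj C1 "tot (P i)" "e i" by (rule adj_e [OF i])
  interpret e': cat_adj C2 "tot (Q i)" "e' i" by (rule adj_e' [OF i])
  interpret m: cat_functor C2 C1 m by (rule functor_m)
  interpret p: cat_functor "tot (P i)" C1 "p i" by (rule functor_p [OF i])
  interpret M: cat_functor "tot (Q i)" "tot (P i)" "M i" by (rule functor_M [OF i])
  interpret \<tau>: cat_iso "tot (Q i)" C1 "m \<odot> q i" "p i \<odot> M i" "\<tau> i" by (rule iso_\<tau> [OF i])
  interpret v: cat_trans C1 "tot (P i)" "LF (e i)" "M i \<odot> LF (e' i) \<odot> LF al" "v i"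
    by (rule trans_v [OF i])
  let ?Y = "FO (LF al) X"
  let ?z = "Cmp C1 (FA m (Unit (e' i) ?Y)) (Unit al X)"
  let ?w = "Cmp C1 (\<tau> i (FO (LF (e' i)) ?Y)) ?z"
  have cod: "Cod C2 (Unit (e' i) ?Y) = FO (q i) (FO (LF (e' i)) ?Y)"
    "Cod C1 (Unit al X) = FO m ?Y"
    using X e'.unit.Cod [of ?Y] al.unit.Cod [OF X] by (simp_all add: RF_e' [OF i] RF_al)
  have "univ_arrow C1 (tot (Q i)) (m \<odot> q i) X (FO (LF (e' i)) ?Y) ?z"
    using univ_arrow_fcomp [OF functor_m functor_q [OF i] al.univ_arrow_unit [OF X, unfolded RF_al]
      e'.univ_arrow_unit [of ?Y, unfolded RF_e' [OF i]]] X by simp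
  then have w: "univ_arrow C1 (tot (Q i)) (p i \<odot> M i) X (FO (LF (e' i)) ?Y) ?w"
    by (rule univ_arrow_nat_iso [OF \<tau>.cat_iso_axioms])
  have v: "v i X = Cmp (tot (P i)) (Counit (e i) (FO (M i) (FO (LF (e' i)) ?Y))) (FA (LF (e i)) ?w)"
    using X cod e.counit.Dom by (simp add: v_def mm_transport_def left_mate_def RF_e [OF i])
  have tt: "Cmp C1 (FA (p i) (v i X)) (Unit (e i) X) = ?w"
    using e.transpose_transpose [of ?w "FO (M i) (FO (LF (e' i)) ?Y)"] univ_arrowD [OF w] X
    unfolding RF_e [OF i] v by simp
  show ?thesis
  proof (rule univ_arrow_cancel [OF p.cat_functor_axioms M.cat_functor_axioms
        e.univ_arrow_unit [OF X, unfolded RF_e [OF i]]])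
    show "univ_arrow C1 (tot (Q i)) (p i \<odot> M i) X (FO (LF (e' i)) ?Y)
        (Cmp C1 (FA (p i) (v i X)) (Unit (e i) X))"
      unfolding tt by (rule w)
  qed (use X in simp_all)
qed

text \<open>The left adjoint of \<open>M i\<close>: since \<open>p i\<close> is inverse to the
  equivalence \<open>LF (e i)\<close>, this is \<open>\<Delta>\<^sup>l\<close> as a functor between
  the components.\<close>

definition D :: "nat \<Rightarrow> ('o, 'a) gfun" where
  "D i = LF (e' i) \<odot> LF al \<odot> p i"

text \<open>\<open>v i\<close> is universal from objects of the form \<open>LF (e i) X\<close>; the
  inverse counit of the equivalence \<open>e i\<close> carries this over to an arbitrary object
  \<open>A\<close>.\<close>

definition u :: "nat \<Rightarrow> (nat \<Rightarrow> 'o) \<Rightarrow> nat \<Rightarrow> 'a" where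
  "u i A = Cmp (tot (P i)) (v i (FO (p i) A)) (inv_ar (tot (P i)) (Counit (e i) A))"

lemma functor_D: "i \<in> {1,2} \<Longrightarrow> cat_functor (tot (P i)) (tot (Q i)) (D i)"
proof -
  assume i: "i \<in> {1,2}"
  interpret e': cat_adj C2 "tot (Q i)" "e' i" by (rule adj_e' [OF i])
  show ?thesis
    unfolding D_def
    by (intro cat_functor_fcomp [OF functor_p [OF i]]
        cat_functor_fcomp [OF al.LF.cat_functor_axioms e'.LF.cat_functor_axioms])
qed

lemma exact_D:
  assumes i: "i \<in> {1,2}"
  shows "exact_functor (tot (P i)) (tot (Q i)) (D i)"
proof -
  have "exact_functor (tot (P i)) C1 (p i)"
    using gr_adj_exact(2) [OF gr_adj_e [OF i]] RF_e [OF i] by simp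
  then show ?thesis
    unfolding D_def
    using gr_adj_exact(1) [OF al] gr_adj_exact(1) [OF gr_adj_e' [OF i]]
      graded_P [OF i] graded_Q [OF i] graded_HS [of "{1}"] graded_HS [of "{1,2}"]
    by (intro exact_functor_fcomp [of "tot (P i)" C1 "tot (Q i)"]
        exact_functor_fcomp [of C1 C2 "tot (Q i)"] category_tot_graded) simp_all
qed

lemma trans_u:
  assumes i: "i \<in> {1,2}"
  shows "cat_trans (tot (P i)) (tot (P i)) id_fctr (M i \<odot> D i) (u i)"
proof -
  interpret e: cat_adj C1 "tot (P i)" "e i" by (rule adj_e [OF i])
  interpret counit: cat_iso "tot (P i)" "tot (P i)" "LF (e i) \<odot> p i" id_fctr "Counit (e i)"
    using e.counit.cat_trans_axioms iso_Counit_e [OF i]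
    by (simp add: cat_iso_def cat_iso_axioms_def RF_e [OF i])
  interpret inv: cat_iso "tot (P i)" "tot (P i)" id_fctr "LF (e i) \<odot> p i"
    "\<lambda>A. inv_ar (tot (P i)) (Counit (e i) A)"
    by (rule counit.inverse)
  show ?thesis
    using cat_trans_vcomp [OF inv.cat_trans_axioms cat_trans_whisker_right [OF trans_v [OF i] functor_p [OF i]]]
    by (simp add: u_def [abs_def] D_def fcomp_assoc)
qed

lemma univ_u:
  assumes i: "i \<in> {1,2}" and A: "A \<in> Ob (tot (P i))"
  shows "univ_arrow (tot (P i)) (tot (Q i)) (M i) A (FO (D i) A) (u i A)"
proof -
  interpret e: cat_adj C1 "tot (P i)" "e i" by (rule adj_e [OF i])
  interpret p: cat_functor "tot (P i)" C1 "p i" by (rule functor_p [OF i])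
  let ?k = "inv_ar (tot (P i)) (Counit (e i) A)"
  note iso = iso_Counit_e [OF i A]
  have "univ_arrow (tot (P i)) (tot (Q i)) (M i) (Dom (tot (P i)) ?k)
      (FO (LF (e' i)) (FO (LF al) (FO (p i) A))) (Cmp (tot (P i)) (v i (FO (p i) A)) ?k)"
    using iso A e.counit.Dom [OF A]
    by (intro univ_arrow_iso_source [OF functor_M [OF i] univ_v [OF i]] e.target.is_iso_inv_ar)
      (simp_all add: RF_e [OF i])
  moreover have "Dom (tot (P i)) ?k = A"
    using iso A e.counit.Cod [OF A] by simp
  ultimately show ?thesis by (simp add: u_def D_def)
qed

text \<open>The adjoints \<open>LF al\<close> and \<open>LF (e' i)\<close> come with a two-sided
  degree bound only, while \<open>degree_zero\<close> speaks of images of arrows such as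
  \<open>M i\<close>; so the degree of \<open>D i\<close> is read off from its right
  adjoint.\<close>

lemma degree_D:
  assumes i: "i \<in> {1,2}" and A: "A \<in> Ob (tot (P i))" "supp (P i) A \<subseteq> {k}"
  shows "supp (Q i) (FO (D i) A) \<subseteq> {k}"
proof (rule univ_arrow_degree_zero [OF graded_P [OF i] graded_Q [OF i] functor_M [OF i] _
      univ_u [OF i A(1)] A(2)])
  fix B l assume B: "B \<in> Ob (tot (Q i))" "supp (Q i) B \<subseteq> {l}"
  have "has_degrees {i} Q (P i) {0} (HAr H mm_ar i)"
    using degree_zero [of mm_ar i] i by auto
  then have "supp (P i) (FO (HAr H mm_ar i) (\<lambda>k\<in>{i}. B)) \<subseteq> {(\<Sum>k\<in>{i}. l) + e | e. e \<in> {0}}"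
    by (rule has_degrees_def [THEN iffD1, THEN bspec, THEN spec [of _ "\<lambda>_. l"], THEN mp])
      (use B in simp_all)
  then show "supp (P i) (FO (M i) B) \<subseteq> {l}" by (simp add: unary_simps)
qed

abbreviation "DD \<equiv> prodf {1,2} D"

definition uu :: "(nat \<Rightarrow> nat \<Rightarrow> 'o) \<Rightarrow> nat \<Rightarrow> nat \<Rightarrow> 'a" where
  "uu A = (\<lambda>i\<in>{1,2}. u i (A i))"

lemma functor_DD: "cat_functor PP QQ DD"
  by (rule cat_functor_prodf) (rule functor_D)

lemma prodf_extensional:
  "X \<in> Ob (prodc I C) \<Longrightarrow> FO (prodf I (\<lambda>_. id_fctr)) X = X"
  "f \<in> Ar (prodc I C) \<Longrightarrow> FA (prodf I (\<lambda>_. id_fctr)) f = f"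
  by (auto simp: PiE_iff restrict_eq_extensional_iff)

lemma trans_uu: "cat_trans PP PP id_fctr (MM \<odot> DD) uu"
proof (rule cat_transI)
  interpret P: cat_functor PP QQ DD by (rule functor_DD)
  show "cat_functor PP PP id_fctr" by (rule cat_functor_id) (rule P.source.category_axioms)
  show "cat_functor PP PP (MM \<odot> DD)" by (rule cat_functor_fcomp [OF functor_DD functor_MM])
  have "nat_trans PP PP (prodf {1,2} (\<lambda>_. id_fctr)) (prodf {1,2} (\<lambda>i. M i \<odot> D i)) uu"
    unfolding uu_def [abs_def]
    by (rule nat_trans_prodc) (rule cat_trans.nat_trans [OF trans_u])
  then show "nat_trans PP PP id_fctr (MM \<odot> DD) uu"
    by (rule nat_trans_cong [OF _ P.source.category_axioms])
      (simp_all only: prodf_extensional id_fctr_simps, auto simp: restrict_eq_iff)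
qed

lemma univ_uu:
  assumes A: "A \<in> Ob PP"
  shows "univ_arrow PP QQ MM A (FO DD A) (uu A)"
proof -
  have "univ_arrow PP QQ MM (\<lambda>i\<in>{1,2}. A i) (\<lambda>i\<in>{1,2}. FO (D i) (A i)) (\<lambda>i\<in>{1,2}. u i (A i))"
    using A by (intro univ_arrow_prodc functor_M univ_u) auto
  moreover have "(\<lambda>i\<in>{1,2}. A i) = A" using A by (auto simp: PiE_iff extensional_restrict)
  ultimately show ?thesis by (simp add: uu_def)
qed

end

section \<open>The left adjoint of \<open>n\<close> on external products\<close>

context ssh_identified
begin

text \<open>\<open>DD\<close> acts on each entry separately, so freezing all entries but one
  commutes with it, and exactness in each variable is inherited from \<open>d\<close> and
  \<open>D i\<close>. The degree bound is 0 because \<open>d\<close> and every \<open>D i\<close>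
  have degree zero.\<close>

lemma multi_mor_d_DD: "multi_mor {1,2} P (HS H {1..4}) (d \<odot> DD)"
  unfolding multi_mor_def multi_exact_def
proof (intro conjI ballI exI [of _ 0])
  interpret DD: cat_functor PP QQ DD by (rule functor_DD)
  show "is_functor PP C4 (d \<odot> DD)"
    using cat_functor_fcomp [OF functor_DD functor_d]
    by (simp add: cat_functor_def cat_functor_axioms_def)
  have md: "multi_mor {1,2} Q (HS H {1..4}) d"
    using multi_mor_HAr [of cbar_ar 1] by simp
  fix i X assume i: "i \<in> {1,2::nat}" and X: "X \<in> Ob PP"
  interpret Di: cat_functor "tot (P i)" "tot (Q i)" "D i" by (rule functor_D [OF i])
  have DX: "FO DD X \<in> Ob QQ" using X by (rule DD.FO_Ob)
  have FO: "FO DD (X(i := Y)) = (FO DD X)(i := FO (D i) Y)" for Y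
    using i by (auto simp: fun_eq_iff)
  have FA: "FA DD ((Id PP X)(i := f)) = (Id QQ (FO DD X))(i := FA (D i) f)" for f
  proof
    fix j
    have "FA (D j) (Id (tot (P j)) (X j)) = Id (tot (Q j)) (FO (D j) (X j))" if "j \<in> {1,2}"
      using cat_functor.FA_Id [OF functor_D [OF that], of "X j"] X that by auto
    then show "FA DD ((Id PP X)(i := f)) j = ((Id QQ (FO DD X))(i := FA (D i) f)) j"
      using i by auto
  qed
  have "in_variable {1,2} P (d \<odot> DD) X i = in_variable {1,2} Q d (FO DD X) i \<odot> D i"
    unfolding in_variable_def fcomp_def fctr.simps FO FA ..
  moreover have "exact_functor (tot (Q i)) C4 (in_variable {1,2} Q d (FO DD X) i)"
    using md i DX unfolding multi_mor_def multi_exact_def by blast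
  ultimately show "exact_functor (tot (P i)) C4 (in_variable {1,2} P (d \<odot> DD) X i)"
    using exact_functor_fcomp [OF _ _ _ exact_D [OF i]] Di.source.category_axioms
      Di.target.category_axioms category_tot_graded [OF graded_HS [of "{1..4}"]] by simp
next
  have deg: "has_degrees {1,2} Q (HS H {1..4}) {0} d"
    using degree_zero [of cbar_ar 1] by simp
  show "has_degrees {1,2} P (HS H {1..4}) {0..0} (d \<odot> DD)"
    unfolding has_degrees_def
  proof (intro ballI allI impI)
    fix X l assume X: "X \<in> Ob PP" and l: "\<forall>i\<in>{1,2}. supp (P i) (X i) \<subseteq> {l i}"
    have "\<forall>i\<in>{1,2}. supp (Q i) (FO DD X i) \<subseteq> {l i}"
    proof
      fix i assume i: "i \<in> {1,2::nat}"
      then have "X i \<in> Ob (tot (P i))" using X by auto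
      then show "supp (Q i) (FO DD X i) \<subseteq> {l i}" using degree_D [OF i, of "X i" "l i"] i l by auto
    qed
    moreover have "FO DD X \<in> Ob QQ" by (rule cat_functor.FO_Ob [OF functor_DD X])
    ultimately have "supp (HS H {1..4}) (FO d (FO DD X)) \<subseteq> {(\<Sum>i\<in>{1,2}. l i) + e | e. e \<in> {0}}"
      using deg [unfolded has_degrees_def, THEN bspec, THEN spec [of _ l], THEN mp] by blast
    then show "supp (HS H {1..4}) (FO (d \<odot> DD) X) \<subseteq> {(\<Sum>i\<in>{1,2}. l i) + e | e. e \<in> {0..0}}"
      by simp
  qed
qed

lemma ex_counit:
  assumes "B \<in> Ob QQ"
  shows "\<exists>f. f \<in> Ar QQ \<and> Dom QQ f = FO DD (FO MM B) \<and> Cod QQ f = B \<and>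
    Cmp PP (FA MM f) (uu (FO MM B)) = Id PP (FO MM B)"
proof -
  interpret MM: cat_functor QQ PP MM by (rule functor_MM)
  have MB: "FO MM B \<in> Ob PP" using assms by (rule MM.FO_Ob)
  show ?thesis
    using univ_arrow_ex [OF univ_uu [OF MB] MM.target.Id_Ar [OF MB] MM.target.Dom_Id [OF MB]
      MM.target.Cod_Id [OF MB] assms] by blast
qed

text \<open>The counit of \<open>DD \<stileturn> MM\<close>, chosen object by object from the
  universality of \<open>uu\<close>; its naturality is shown in \<open>trans_k\<close>.\<close>

definition k :: "(nat \<Rightarrow> nat \<Rightarrow> 'o) \<Rightarrow> nat \<Rightarrow> nat \<Rightarrow> 'a" where
  "k B = (SOME f. f \<in> Ar QQ \<and> Dom QQ f = FO DD (FO MM B) \<and> Cod QQ f = B \<and>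
    Cmp PP (FA MM f) (uu (FO MM B)) = Id PP (FO MM B))"

lemma k:
  assumes "B \<in> Ob QQ"
  shows "k B \<in> Ar QQ" "Dom QQ (k B) = FO DD (FO MM B)" "Cod QQ (k B) = B"
    "Cmp PP (FA MM (k B)) (uu (FO MM B)) = Id PP (FO MM B)"
  using someI_ex [OF ex_counit [OF assms]] unfolding k_def by auto

text \<open>Both sides of the naturality square start at \<open>DD (MM B)\<close>, so by
  universality they agree once their images under \<open>MM\<close> agree after composition with
  \<open>uu\<close>.\<close>

lemma trans_k: "cat_trans QQ QQ (DD \<odot> MM) id_fctr k"
proof -
  interpret DD: cat_functor PP QQ DD by (rule functor_DD)
  interpret MM: cat_functor QQ PP MM by (rule functor_MM)
  interpret uu: cat_trans PP PP id_fctr "MM \<odot> DD" uu by (rule trans_uu)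
  note [simp del] = prodc_simps prodf_simps
  note [simp] = k
  show ?thesis
  proof (rule cat_transI)
    show "cat_functor QQ QQ (DD \<odot> MM)" by (rule cat_functor_fcomp [OF functor_MM functor_DD])
    show "cat_functor QQ QQ id_fctr" by (rule cat_functor_id) (rule cat_functor.axioms(1) [OF functor_MM])
    show "nat_trans QQ QQ (DD \<odot> MM) id_fctr k"
    proof (rule nat_transI)
      fix f assume f: "f \<in> Ar QQ"
      let ?B = "Dom QQ f" and ?B' = "Cod QQ f"
      have B: "?B \<in> Ob QQ" "?B' \<in> Ob QQ" using f by simp_all
      have 1: "Cmp PP (FA MM (FA DD (FA MM f))) (uu (FO MM ?B)) = Cmp PP (uu (FO MM ?B')) (FA MM f)"
        using uu.naturality [of "FA MM f"] f by simp
      have "Cmp QQ (k ?B') (FA DD (FA MM f)) = Cmp QQ f (k ?B)"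
      proof (rule univ_arrow_eq [OF univ_uu [of "FO MM ?B"]])
        show "Cmp PP (FA MM (Cmp QQ (k ?B') (FA DD (FA MM f)))) (uu (FO MM ?B)) =
            Cmp PP (FA MM (Cmp QQ f (k ?B))) (uu (FO MM ?B))"
          using f B by (simp add: 1 DD.source.reassoc1 [OF k(4)])
      qed (use f B MM.cat_functor_axioms in simp_all)
      then show "Cmp QQ (k (Cod QQ f)) (FA (DD \<odot> MM) f) = Cmp QQ (FA id_fctr f) (k (Dom QQ f))"
        by simp
    qed simp_all
  qed
qed

lemma cocartesian_pair_c: "cocartesian_pair P (HOb H (sing {1,2})) (HAr H c_ar)"
  using cocartesian [OF fs_cocartesian_c_ar] graded_P graded_HS [of "{1,2}"]
  by (simp add: cocartesian_pair_def img_def)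

lemma cocartesian_pair_d: "cocartesian_pair Q (HOb H (sing {1..4})) (HAr H cbar_ar)"
  using cocartesian [OF fs_cocartesian_cbar_ar] graded_Q graded_HS [of "{1..4}"]
  by (simp add: cocartesian_pair_def img_def)

text \<open>This is the adjunction of \<open>\<Delta>\<^sup>l \<otimes> \<Delta>\<^sup>l\<close> and
  \<open>n\<close>, tested at external products. The proof supplies the data of
  \<open>extended_left_adjoint\<close>; \<open>faithful\<close> is uniqueness of cells along
  \<open>d\<close>.\<close>

lemma univ_arrow_n:
  assumes A: "A \<in> Ob PP" and w: "univ_arrow PP QQ MM A B w"
  shows "univ_arrow C2 C4 n (FO c A) (FO d B) (Cmp C2 (\<sigma> B) (FA c w))"
proof -
  interpret cP: cocartesian_pair P "HOb H (sing {1,2})" "HAr H c_ar" by (rule cocartesian_pair_c)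
  interpret cQ: cocartesian_pair Q "HOb H (sing {1..4})" "HAr H cbar_ar" by (rule cocartesian_pair_d)
  note [simp del] = prodc_simps prodf_simps
  note [simp] = k
  have gr: "graded (HS H {1,2})" "graded (HS H {1..4})" by (simp_all add: graded_HS)
  interpret c: cat_functor PP C2 c by (rule functor_c)
  interpret d: cat_functor QQ C4 d by (rule functor_d)
  interpret n: cat_functor C4 C2 n by (rule functor_n)
  interpret MM: cat_functor QQ PP MM by (rule functor_MM)
  interpret DD: cat_functor PP QQ DD by (rule functor_DD)
  interpret uu: cat_trans PP PP id_fctr "MM \<odot> DD" uu by (rule trans_uu)
  interpret k: cat_trans QQ QQ "DD \<odot> MM" id_fctr k by (rule trans_k)
  interpret \<sigma>: cat_iso QQ C2 "c \<odot> MM" "n \<odot> d" \<sigma> by (rule iso_\<sigma>)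
  obtain L t where L: "bounded_exact (HS H {1,2}) (HS H {1..4}) L"
    and t: "nat_iso PP C4 (L \<odot> c) (d \<odot> DD) t"
    by (rule cP.extension [OF gr(2) multi_mor_d_DD])
  have L_functor: "cat_functor C2 C4 L"
    using L gr [THEN category_tot_graded]
    by (simp add: cat_functor_def cat_functor_axioms_def bounded_exact_def exact_functor_is_functor)
  interpret L: cat_functor C2 C4 L by (rule L_functor)
  have Lc: "cat_functor PP C4 (L \<odot> c)" and dD: "cat_functor PP C4 (d \<odot> DD)"
    by (rule cat_functor_fcomp [OF functor_c L_functor], rule cat_functor_fcomp [OF functor_DD functor_d])
  interpret t: cat_iso PP C4 "L \<odot> c" "d \<odot> DD" t
    by (rule cat_isoI [OF Lc dD t])
  note bn = bounded_exact_n
  \<comment> \<open>Cells extend along \<open>c\<close> and \<open>d\<close> between functors of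
    nonnegative bounded degree, so both composites of \<open>n\<close> and \<open>L\<close> have to
    be of this kind.\<close>
  note bnL = bounded_exact_fcomp [OF gr gr(1) L bn] and bLn = bounded_exact_fcomp [OF gr(2,1,2) bn L]

  \<comment> \<open>The value that the unit must take on external products: the unit
    \<open>uu\<close>, then \<sigma>, then the inverse of \<open>t\<close>.\<close>
  have "cat_trans PP C2 c (n \<odot> L \<odot> c)
      (\<lambda>A. Cmp C2 (FA n (inv_ar C4 (t A))) (Cmp C2 (\<sigma> (FO DD A)) (FA c (uu A))))"
    using cat_trans_vcomp [OF cat_trans_vcomp [OF
        cat_trans_whisker_left [OF uu.cat_trans_axioms functor_c, unfolded fcomp_id]
        cat_trans_whisker_right [OF \<sigma>.cat_trans_axioms functor_DD, unfolded fcomp_assoc]]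
      cat_trans_whisker_left [OF cat_iso.axioms(1) [OF t.inverse] functor_n]]
    by (simp add: fcomp_assoc)
  then have "nat_trans PP C2 (id_fctr \<odot> c) (n \<odot> L \<odot> c)
      (\<lambda>A. Cmp C2 (FA n (inv_ar C4 (t A))) (Cmp C2 (\<sigma> (FO DD A)) (FA c (uu A))))"
    by (simp add: cat_trans.nat_trans)
  then obtain \<eta> where \<eta>: "nat_trans C2 C2 id_fctr (n \<odot> L) \<eta>"
    and \<eta>_c: "\<And>A. A \<in> Ob PP \<Longrightarrow>
      \<eta> (FO c A) = Cmp C2 (FA n (inv_ar C4 (t A))) (Cmp C2 (\<sigma> (FO DD A)) (FA c (uu A)))"
    using cP.cell_extension [OF gr(1) bounded_exact_id [OF gr(1)] bnL] by blast

  \<comment> \<open>The corresponding prescription for the counit: the inverse of \<sigma>, then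
    \<open>t\<close>, then the counit \<open>k\<close>.\<close>
  have "cat_trans QQ C4 (L \<odot> n \<odot> d) d
      (\<lambda>B. Cmp C4 (FA d (k B)) (Cmp C4 (t (FO MM B)) (FA L (inv_ar C2 (\<sigma> B)))))"
    using cat_trans_vcomp [OF cat_trans_vcomp [OF
        cat_trans_whisker_left [OF cat_iso.axioms(1) [OF \<sigma>.inverse] L_functor]
        cat_trans_whisker_right [OF t.cat_trans_axioms functor_MM, unfolded fcomp_assoc]]
      cat_trans_whisker_left [OF k.cat_trans_axioms functor_d, unfolded fcomp_id]]
    by (simp add: fcomp_assoc)
  then have "nat_trans QQ C4 (L \<odot> n \<odot> d) (id_fctr \<odot> d)
      (\<lambda>B. Cmp C4 (FA d (k B)) (Cmp C4 (t (FO MM B)) (FA L (inv_ar C2 (\<sigma> B)))))"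
    by (simp add: cat_trans.nat_trans)
  then obtain \<epsilon> where \<epsilon>: "nat_trans C4 C4 (L \<odot> n) id_fctr \<epsilon>"
    and \<epsilon>_d: "\<And>B. B \<in> Ob QQ \<Longrightarrow>
      \<epsilon> (FO d B) = Cmp C4 (FA d (k B)) (Cmp C4 (t (FO MM B)) (FA L (inv_ar C2 (\<sigma> B))))"
    using cQ.cell_extension [OF gr(2) bLn bounded_exact_id [OF gr(2)]] by blast

  have nL: "cat_functor C2 C2 (n \<odot> L)" and Ln: "cat_functor C4 C4 (L \<odot> n)"
    by (rule cat_functor_fcomp [OF L_functor functor_n], rule cat_functor_fcomp [OF functor_n L_functor])
  note id2 = cat_functor_id [OF cat_functor.axioms(2) [OF functor_c]] and id4 = cat_functor_id [OF cat_functor.axioms(2) [OF functor_d]]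
  interpret \<eta>: cat_trans C2 C2 id_fctr "n \<odot> L" \<eta> by (rule cat_transI [OF id2 nL \<eta>])
  interpret \<epsilon>: cat_trans C4 C4 "L \<odot> n" id_fctr \<epsilon> by (rule cat_transI [OF Ln id4 \<epsilon>])
  interpret X: extended_left_adjoint PP C2 c QQ C4 d MM DD n L uu \<sigma> t \<eta> \<epsilon> k
  proof unfold_locales
    show "s Y = s' Y" if "nat_trans C4 C2 n n s" "nat_trans C4 C2 n n s'"
      "\<And>B. B \<in> Ob QQ \<Longrightarrow> s (FO d B) = s' (FO d B)" "Y \<in> Ob C4" for s s' Y
      using cQ.cell_unique [OF gr(1) bn bn that] .
  qed (use univ_uu \<eta>_c \<epsilon>_d in \<open>simp_all\<close>)
  show ?thesis by (rule X.univ_arrow_extension [OF A w])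
qed

end

text \<open>The functors \<open>F \<boxtimes> -\<close> and \<open>H(cbar)(\<Phi>, -)\<close> are
  such pairings followed by \<open>c\<close> and \<open>d\<close>; in this form they can be combined
  with cells on the product categories.\<close>

definition pairing :: "('k, nat \<Rightarrow> 'o, nat \<Rightarrow> 'a) lcat \<Rightarrow> (nat \<Rightarrow> ('o, 'a) gadj) \<Rightarrow> (nat \<Rightarrow> 'o)
    \<Rightarrow> (nat \<Rightarrow> 'o, nat \<Rightarrow> 'a, nat \<Rightarrow> nat \<Rightarrow> 'o, nat \<Rightarrow> nat \<Rightarrow> 'a) fctr" where
  "pairing C a A = \<lparr>FO = (\<lambda>X. \<lambda>i\<in>{1,2}. FO (LF (a i)) (if i = 1 then A else X)),
    FA = (\<lambda>f. \<lambda>i\<in>{1,2}. FA (LF (a i)) (if i = 1 then Id C A else f))\<rparr>"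

lemma pairing_simps [simp]:
  "FO (pairing C a A) X = (\<lambda>i\<in>{1,2}. FO (LF (a i)) (if i = 1 then A else X))"
  "FA (pairing C a A) f = (\<lambda>i\<in>{1,2}. FA (LF (a i)) (if i = 1 then Id C A else f))"
  by (simp_all add: pairing_def)

lemma functor_pairing:
  assumes a: "\<And>i. i \<in> {1,2} \<Longrightarrow> cat_adj C (D i) (a i)" and A: "A \<in> Ob C"
  shows "cat_functor C (prodc {1,2} D) (pairing C a A)"
proof -
  interpret a1: cat_adj C "D 1" "a 1" by (rule a) simp
  interpret a2: cat_adj C "D 2" "a 2" by (rule a) simp
  have D: "category (D i)" if "i \<in> {1,2}" for i
    using that a1.target.category_axioms a2.target.category_axioms by auto
  have "is_functor C (prodc {1,2} D) (pairing C a A)"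
    unfolding is_functor_def using A by (auto simp: hom_def restrict_eq_iff)
  then show ?thesis
    using category_prodc [of "{1,2}" D, OF D] a1.source.category_axioms
    by (simp add: cat_functor_def cat_functor_axioms_def)
qed

section \<open>The two squares of the canonical cell and their mates\<close>

locale ssh_adjoints = ssh_identified H e e' al for H :: "('k::field_char_0, 'o, 'a) psdata" and e e' al +
  fixes F :: "nat \<Rightarrow> 'o" and ar aF ar2 a\<Phi> :: "('o, 'a) gadj"
  assumes F: "F \<in> Ob C1"
    and ar: "gr_adj (HS H {1,2}) (HS H {1}) ar" and LF_ar: "LF ar = m_fun H"
    and aF: "gr_adj (HS H {1}) (HS H {1,2}) aF" and LF_aF: "LF aF = i_fun H e F"
    and ar2: "gr_adj (HS H {1..4}) (HS H {1,2}) ar2" and LF_ar2: "LF ar2 = m2_fun H"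
    and a\<Phi>: "gr_adj (HS H {1,2}) (HS H {1..4}) a\<Phi>" and LF_a\<Phi>: "LF a\<Phi> = ibar_fun H e' (FO (LF al) F)"
begin

abbreviation "\<Phi> \<equiv> FO (LF al) F"

sublocale ar: cat_adj C2 C1 ar
  by (intro gr_adj_cat_adj ar graded_HS) simp_all

sublocale aF: cat_adj C1 C2 aF
  by (intro gr_adj_cat_adj aF graded_HS) simp_all

sublocale ar2: cat_adj C4 C2 ar2
  by (intro gr_adj_cat_adj ar2 graded_HS) simp_all

sublocale a\<Phi>: cat_adj C2 C4 a\<Phi>
  by (intro gr_adj_cat_adj a\<Phi> graded_HS) simp_all

abbreviation "R \<equiv> pairing C1 e F"
abbreviation "R' \<equiv> pairing C2 e' \<Phi>"

lemma \<Phi>: "\<Phi> \<in> Ob C2"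
  using F by simp

lemma functor_R: "cat_functor C1 PP R"
  by (rule functor_pairing [OF adj_e F])

lemma functor_R': "cat_functor C2 QQ R'"
  by (rule functor_pairing [OF adj_e' \<Phi>])

lemma LF_aF': "LF aF = c \<odot> R"
  by (simp add: LF_aF i_fun_def ext_ob_def [abs_def] ext_ar_def [abs_def] fcomp_def)

lemma LF_a\<Phi>': "LF a\<Phi> = d \<odot> R'"
  by (simp add: LF_a\<Phi> ibar_fun_def ext_ob_def [abs_def] ext_ar_def [abs_def] fcomp_def)

text \<open>The pair of arrows underlying
  \<open>F \<boxtimes> m X -> m \<Phi> \<boxtimes> m X\<close>, carried to the components of
  \<open>MM\<close>. The unit of \<open>al\<close> enters in the first entry, which does not vary
  with \<open>X\<close>.\<close>

definition \<rho> :: "(nat \<Rightarrow> 'o) \<Rightarrow> nat \<Rightarrow> nat \<Rightarrow> 'a" where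
  "\<rho> X = (\<lambda>i\<in>{1,2}. if i = 1 then v 1 F else tr i X)"

lemma trans_\<rho>: "cat_trans C2 PP (R \<odot> m) (MM \<odot> R') \<rho>"
proof (rule cat_transI)
  show "cat_functor C2 PP (R \<odot> m)" by (rule cat_functor_fcomp [OF functor_m functor_R])
  show "cat_functor C2 PP (MM \<odot> R')" by (rule cat_functor_fcomp [OF functor_R' functor_MM])
  interpret e: cat_adj C1 "tot (P 1)" "e 1" by (rule adj_e) simp
  interpret e': cat_adj C2 "tot (Q 1)" "e' 1" by (rule adj_e') simp
  interpret M: cat_functor "tot (Q 1)" "tot (P 1)" "M 1" by (rule functor_M) simp
  interpret v: cat_trans C1 "tot (P 1)" "LF (e 1)" "M 1 \<odot> LF (e' 1) \<odot> LF al" "v 1"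
    by (rule trans_v) simp
  interpret tr: cat_trans C2 "tot (P 2)" "LF (e 2) \<odot> m" "M 2 \<odot> LF (e' 2)" "tr 2"
    by (rule trans_tr) simp
  show "nat_trans C2 PP (R \<odot> m) (MM \<odot> R') \<rho>"
    by (rule nat_transI) (use F tr.naturality in \<open>auto simp: \<rho>_def restrict_eq_iff\<close>)
qed

definition \<alpha> :: "(nat \<Rightarrow> 'o) \<Rightarrow> nat \<Rightarrow> 'a" where
  "\<alpha> X = Cmp C2 (\<sigma> (FO R' X)) (FA c (\<rho> X))"

lemma trans_\<alpha>: "cat_trans C2 C2 (LF aF \<odot> m) (n \<odot> LF a\<Phi>) \<alpha>"
  using cat_trans_vcomp [OF cat_trans_whisker_left [OF trans_\<rho> functor_c]
      cat_trans_whisker_right [OF cat_iso.axioms(1) [OF iso_\<sigma>] functor_R', unfolded fcomp_assoc]]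
  by (simp add: LF_aF' LF_a\<Phi>' fcomp_assoc \<alpha>_def [abs_def])

lemma square_\<alpha>: "mate_square C2 C1 C4 C2 m n a\<Phi> aF \<alpha>"
  by (intro mate_square.intro a\<Phi>.cat_adj_axioms aF.cat_adj_axioms functor_m functor_n trans_\<alpha>)

lemma square_\<beta>: "mate_square C4 C2 C2 C1 n m ar2 ar \<beta>"
  by (intro mate_square.intro ar2.cat_adj_axioms ar.cat_adj_axioms functor_m functor_n)
    (simp add: LF_ar LF_ar2 cat_iso.axioms(1) [OF iso_\<beta>])

text \<open>At \<open>\<Delta>\<^sup>l X\<close>, after the unit in the second entry, \<rho> becomes
  the pair of \<open>v 1 F\<close> and \<open>v 2 X\<close>. Both are universal, so the pair is
  universal to \<open>MM\<close>, and \<open>univ_arrow_n\<close> makes its external product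
  universal to \<open>n\<close>, as \<open>is_iso_mate_if_univ_arrow\<close> requires.\<close>

lemma is_iso_mate_\<alpha>:
  assumes Y: "Y \<in> Ob C4"
  shows "is_iso C1 (right_mate C1 m n a\<Phi> aF \<alpha> Y)"
proof (rule mate_square.is_iso_mate_if_univ_arrow [OF square_\<alpha> adj_al RF_al _ Y])
  fix X assume X: "X \<in> Ob C1"
  let ?Y = "FO (LF al) X"
  interpret c: cat_functor PP C2 c by (rule functor_c)
  interpret R: cat_functor C1 PP R by (rule functor_R)
  interpret \<rho>: cat_trans C2 PP "R \<odot> m" "MM \<odot> R'" \<rho> by (rule trans_\<rho>)
  interpret \<sigma>: cat_iso QQ C2 "c \<odot> MM" "n \<odot> d" \<sigma> by (rule iso_\<sigma>)
  interpret R': cat_functor C2 QQ R' by (rule functor_R')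
  interpret e: cat_adj C1 "tot (P 1)" "e 1" by (rule adj_e) simp
  interpret v: cat_trans C1 "tot (P 1)" "LF (e 1)" "M 1 \<odot> LF (e' 1) \<odot> LF al" "v 1"
    by (rule trans_v) simp
  let ?w = "\<lambda>i\<in>{1,2}. v i (if i = 1 then F else X)"
  have Y: "?Y \<in> Ob C2" using X by simp
  have unit: "Cod C1 (Unit al X) = FO m ?Y" using X al.unit.Cod [OF X] by (simp add: RF_al)
  have w: "Cmp PP (\<rho> ?Y) (FA R (Unit al X)) = ?w"
    using F by (auto simp: \<rho>_def restrict_eq_iff v_def [of 2])
  have "univ_arrow PP QQ MM (\<lambda>i\<in>{1,2}. FO (LF (e i)) (if i = 1 then F else X))
      (\<lambda>i\<in>{1,2}. FO (LF (e' i)) (FO (LF al) (if i = 1 then F else X))) ?w"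
    using F X by (intro univ_arrow_prodc functor_M univ_v) auto
  moreover have "(\<lambda>i\<in>{1,2}. FO (LF (e i)) (if i = 1 then F else X)) = FO R X"
    "(\<lambda>i\<in>{1,2}. FO (LF (e' i)) (FO (LF al) (if i = 1 then F else X))) = FO R' ?Y"
    by (auto simp: restrict_eq_iff)
  ultimately have univ: "univ_arrow PP QQ MM (FO R X) (FO R' ?Y) ?w" by (simp only:)
  note [simp del] = prodc_simps pairing_simps prodf_simps
  have "FA c (Cmp PP (\<rho> ?Y) (FA R (Unit al X))) = Cmp C2 (FA c (\<rho> ?Y)) (FA c (FA R (Unit al X)))"
    by (rule c.FA_Cmp) (use X Y unit in simp_all)
  moreover have "Cmp C2 (\<alpha> ?Y) (FA c (FA R (Unit al X))) =
      Cmp C2 (\<sigma> (FO R' ?Y)) (Cmp C2 (FA c (\<rho> ?Y)) (FA c (FA R (Unit al X))))"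
    unfolding \<alpha>_def using X Y unit by simp
  ultimately have "Cmp C2 (\<alpha> ?Y) (FA (LF aF) (Unit al X)) = Cmp C2 (\<sigma> (FO R' ?Y)) (FA c ?w)"
    unfolding LF_aF' fcomp_simps w by (simp only:)
  then show "univ_arrow C2 C4 n (FO (LF aF) X) (FO (LF a\<Phi>) ?Y)
      (Cmp C2 (\<alpha> ?Y) (FA (LF aF) (Unit al X)))"
    using univ_arrow_n [OF R.FO_Ob [OF X] univ] unfolding LF_aF' LF_a\<Phi>' fcomp_simps by (simp only:)
qed

lemma is_iso_mate_\<beta>:
  assumes Y: "Y \<in> Ob C2"
  shows "is_iso C2 (right_mate C2 n m ar2 ar \<beta> Y)"
proof -
  have "beck_chevalley (HS H {1..4}) (HS H {1,2}) (HS H {1,2}) (HS H {1}) n m2 m m \<beta>"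
    using BC [OF cartesian_square_m] by (simp add: HM_def fun_unary m_ar_def n_ar_def m2_ar_def)
  then show ?thesis
    unfolding beck_chevalley_def using ar ar2 LF_ar LF_ar2 Y by blast
qed

text \<open>\<open>canonical_cell\<close> applies the unit of \<open>al\<close> at \<open>F\<close>
  before transporting both factors by \<open>tr\<close>. As \<open>v 1 F\<close> is this unit
  followed by \<open>tr 1\<close>, the two arrows merge into \<rho>.\<close>

lemma canonical_cell_eq:
  assumes X: "X \<in> Ob C2"
  shows "canonical_cell H e e' al F X = Cmp C1 (\<beta> (FO (LF a\<Phi>) X)) (FA m (\<alpha> X))"
proof -
  interpret m: cat_functor C2 C1 m by (rule functor_m)
  interpret c: cat_functor PP C2 c by (rule functor_c)
  interpret R: cat_functor C1 PP R by (rule functor_R)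
  interpret \<sigma>: cat_iso QQ C2 "c \<odot> MM" "n \<odot> d" \<sigma> by (rule iso_\<sigma>)
  interpret R': cat_functor C2 QQ R' by (rule functor_R')
  interpret MM: cat_functor QQ PP MM by (rule functor_MM)
  interpret tr1: cat_trans C2 "tot (P 1)" "LF (e 1) \<odot> m" "M 1 \<odot> LF (e' 1)" "tr 1"
    by (rule trans_tr) simp
  interpret tr2: cat_trans C2 "tot (P 2)" "LF (e 2) \<odot> m" "M 2 \<odot> LF (e' 2)" "tr 2"
    by (rule trans_tr) simp
  interpret e1: cat_adj C1 "tot (P 1)" "e 1" by (rule adj_e) simp
  interpret e2: cat_adj C1 "tot (P 2)" "e 2" by (rule adj_e) simp
  let ?t = "\<lambda>i\<in>{1,2}. tr i (if i = 1 then \<Phi> else X)"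
  let ?s = "\<lambda>i\<in>{1,2}. FA (LF (e i)) (if i = 1 then Unit al F else Id C1 (FO m X))"
  have unit: "Cod C1 (Unit al F) = FO m \<Phi>" using al.unit.Cod [OF F] by (simp add: RF_al)
  have ar: "?t \<in> Ar PP" "?s \<in> Ar PP" "Cod PP ?s = Dom PP ?t" "Cod PP ?t = FO MM (FO R' X)"
    using X F \<Phi> unit by (auto simp: restrict_eq_iff)
  have \<rho>: "Cmp PP ?t ?s = \<rho> X"
    using X F by (auto simp: \<rho>_def restrict_eq_iff v_def)
  have R'X: "(\<lambda>i\<in>{1,2}. FO (LF (e' i)) (if i = 1 then \<Phi> else X)) = FO R' X" by simp
  note [simp del] = prodc_simps pairing_simps prodf_simps
  have "\<alpha> X = Cmp C2 (Cmp C2 (\<sigma> (FO R' X)) (FA c ?t)) (FA c ?s)"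
    unfolding \<alpha>_def \<rho> [symmetric] using X ar by simp
  moreover have "FA m (Cmp C2 (Cmp C2 (\<sigma> (FO R' X)) (FA c ?t)) (FA c ?s)) =
      Cmp C1 (FA m (Cmp C2 (\<sigma> (FO R' X)) (FA c ?t))) (FA m (FA c ?s))"
    using X ar by (intro m.FA_Cmp) simp_all
  moreover have "ext_ob H e' cbar_ar \<Phi> X = FO (LF a\<Phi>) X"
    by (simp add: LF_a\<Phi> ibar_fun_def)
  ultimately show ?thesis
    by (simp add: canonical_cell_def m_box_m_def ext_ar_def Let_def R'X)
qed

lemma canonical_map_eq:
  assumes Y: "Y \<in> Ob C2"
  shows "canonical_map H e e' al ar aF ar2 a\<Phi> F Y =
    Cmp C1 (FA (RF aF) (right_mate C2 n m ar2 ar \<beta> Y)) (right_mate C1 m n a\<Phi> aF \<alpha> (FO (RF ar2) Y))"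
proof -
  \<comment> \<open>The mate at \<open>Y\<close> involves the cell only at this object, so agreement
    of the cells on objects of \<open>C2\<close> suffices.\<close>
  have "FO (RF a\<Phi>) (FO (RF ar2) Y) \<in> Ob C2" using Y by simp
  note cell = canonical_cell_eq [OF this]
  show ?thesis
    using right_mate_paste [OF square_\<alpha> square_\<beta> Y] cell
    by (simp add: canonical_map_def right_mate_def adj_comp_def LF_ar)
qed

lemma iso_canonical_map:
  "cat_iso C2 C1 (m \<odot> (RF a\<Phi> \<odot> RF ar2)) ((RF aF \<odot> RF ar) \<odot> m) (canonical_map H e e' al ar aF ar2 a\<Phi> F)"
proof -
  interpret \<alpha>: mate_square C2 C1 C4 C2 m n a\<Phi> aF \<alpha> by (rule square_\<alpha>)
  interpret \<beta>: mate_square C4 C2 C2 C1 n m ar2 ar \<beta> by (rule square_\<beta>)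
  have 1: "cat_trans C4 C1 (m \<odot> RF a\<Phi>) (RF aF \<odot> n) \<alpha>.mate"
    by (intro cat_transI \<alpha>.nat_trans_mate cat_functor_fcomp [OF a\<Phi>.RF.cat_functor_axioms functor_m]
        cat_functor_fcomp [OF functor_n aF.RF.cat_functor_axioms])
  have 2: "cat_trans C2 C2 (n \<odot> RF ar2) (RF ar \<odot> m) \<beta>.mate"
    by (intro cat_transI \<beta>.nat_trans_mate cat_functor_fcomp [OF ar2.RF.cat_functor_axioms functor_n]
        cat_functor_fcomp [OF functor_m ar.RF.cat_functor_axioms])
  interpret t: cat_trans C2 C1 "m \<odot> (RF a\<Phi> \<odot> RF ar2)" "(RF aF \<odot> RF ar) \<odot> m"
    "\<lambda>Y. Cmp C1 (FA (RF aF) (\<beta>.mate Y)) (\<alpha>.mate (FO (RF ar2) Y))"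
    using cat_trans_vcomp [OF cat_trans_whisker_right [OF 1 ar2.RF.cat_functor_axioms]
        cat_trans_whisker_left [OF 2 aF.RF.cat_functor_axioms, folded fcomp_assoc]]
    by (simp add: fcomp_assoc)
  have "is_iso C1 (Cmp C1 (FA (RF aF) (\<beta>.mate Y)) (\<alpha>.mate (FO (RF ar2) Y)))" if Y: "Y \<in> Ob C2" for Y
    using Y is_iso_mate_\<alpha> [of "FO (RF ar2) Y"] is_iso_mate_\<beta> [OF Y]
    by (intro category.is_iso_Cmp [OF cat_functor.axioms(2) [OF functor_m]] aF.RF.is_iso_FA) simp_all
  then have "nat_iso C2 C1 (m \<odot> (RF a\<Phi> \<odot> RF ar2)) ((RF aF \<odot> RF ar) \<odot> m)
      (\<lambda>Y. Cmp C1 (FA (RF aF) (\<beta>.mate Y)) (\<alpha>.mate (FO (RF ar2) Y)))"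
    using t.nat_trans by (simp add: nat_iso_def)
  then have "nat_iso C2 C1 (m \<odot> (RF a\<Phi> \<odot> RF ar2)) ((RF aF \<odot> RF ar) \<odot> m)
      (canonical_map H e e' al ar aF ar2 a\<Phi> F)"
    by (rule nat_iso_cong [OF _ cat_functor.axioms(1) [OF functor_m]]) (simp_all only: canonical_map_eq)
  then show ?thesis
    by (rule cat_isoI [OF t.source.cat_functor_axioms t.target.cat_functor_axioms])
qed

end

theorem theorem2:
  fixes H :: "('k::field_char_0, 'o, 'a) psdata"
    and F :: "nat \<Rightarrow> 'o"
    and e e' :: "nat \<Rightarrow> ('o, 'a) gadj"
    and al ar aF ar2 a\<Phi> :: "('o, 'a) gadj"
  assumes "ssh_category H"
    and "p_identification H e" and "q_identification H e'"
    and "F \<in> Ob (tot (HS H {1}))"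
    and "gr_adj (HS H {1}) (HS H {1,2}) al" and "RF al = m_fun H"
    and "gr_adj (HS H {1,2}) (HS H {1}) ar" and "LF ar = m_fun H"
    and "gr_adj (HS H {1}) (HS H {1,2}) aF" and "LF aF = i_fun H e F"
    and "gr_adj (HS H {1..4}) (HS H {1,2}) ar2" and "LF ar2 = m2_fun H"
    and "gr_adj (HS H {1,2}) (HS H {1..4}) a\<Phi>" and "LF a\<Phi> = ibar_fun H e' (FO (LF al) F)"
  shows "nat_iso (tot (HS H {1,2})) (tot (HS H {1}))
    ((RF aF \<odot> RF ar) \<odot> m_fun H) (m_fun H \<odot> (RF a\<Phi> \<odot> RF ar2))
    (\<lambda>X. inv_ar (tot (HS H {1})) (canonical_map H e e' al ar aF ar2 a\<Phi> F X))"
proof -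
  interpret ssh_category H by fact
  interpret ssh_adjoints H e e' al F ar aF ar2 a\<Phi>
    by unfold_locales (fact assms)+
  \<comment> \<open>The canonical map starts at the functor on the right of the claim, so its
    pointwise inverse is taken.\<close>
  show ?thesis
    by (rule cat_iso.nat_iso [OF cat_iso.inverse [OF iso_canonical_map]])
qed

end
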